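(* Let $\Lambda=\{\Lambda(A):A\in\mathcal{S}\}$ be a centered Lévy basis on a non-empty space $S$ equipped with a $\sigma$-finite $\delta$-ring $\mathcal{S}$, with associated $m$, $\sigma^2$, $\nu$, $\phi$, $\|\cdot\|_\phi$ and $L^\phi$ as in the context. Let $\mu$ be a $\sigma$-finite measure on a complete separable metric space $T$ (with its Borel $\sigma$-algebra $\mathcal{B}(T)$). Let $f:T\times S\to\mathbb{R}$ be a $\mathcal{B}(T)\otimes\sigma(\mathcal{S})$-measurable function such that $$f_x=f(x,\cdot)\in L^\phi\ \text{ for all }x\in T,\qquad\text{and}\qquad\int_T\|f_x\|_\phi\,\mu(dx)<\infty.$$ Then $f(\cdot,s)\in L^1(\mu)$ for $m$-a.a. $s\in S$, the function $s\mapsto\int_Tf(x,s)\,\mu(dx)$ belongs to $L^\phi$, all of the following integrals exist, and $$\int_T\Big(\int_Sf(x,s)\,\Lambda(ds)\Big)\mu(dx)=\int_S\Big(\int_Tf(x,s)\,\mu(dx)\Big)\Lambda(ds)\qquad\text{a.s.}$$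
   Context: A $\delta$-ring $\mathcal{S}$ on $S$ is a family of subsets of $S$ closed under (finite) union, countable intersection and set difference; it is $\sigma$-finite if there is $(S_n)_{n\ge1}\subseteq\mathcal{S}$ with $\bigcup_nS_n=S$. A Lévy basis is an infinitely divisible independently scattered random measure: a family $\{\Lambda(A):A\in\mathcal{S}\}$ of infinitely divisible real random variables such that for pairwise disjoint $A_1,A_2,\dots\in\mathcal{S}$ the $\Lambda(A_n)$ are independent and, if $\bigcup_nA_n\in\mathcal{S}$, $\Lambda(\bigcup_nA_n)=\sum_n\Lambda(A_n)$ a.s. It is centered if every $\Lambda(A)$ is integrable with mean $0$. There are a $\sigma$-finite measure $m$ on $(S,\sigma(\mathcal{S}))$, a measurable $\sigma^2:S\to[0,\infty)$ and a measurable parametrization $\nu(du,s)$ of Lévy measures on $\mathbb{R}$ such that for all $A\in\mathcal{S}$, $y\in\mathbb{R}$, $$E[e^{iy\Lambda(A)}]=\exp\Big(\int_A\Big[-\sigma^2(s)y^2/2+\int_{\mathbb{R}}(e^{iyu}-1-iyu)\,\nu(du,s)\Big]m(ds)\Big),$$ and such that $(\sigma^2(s),\nu(\cdot,s))\ne(0,0)$ for $m$-a.a. $s$. Define $\phi:\mathbb{R}\times S\to\mathbb{R}$ by $$\phi(y,s)=y^2\sigma^2(s)+\int_{\mathbb{R}}\big[(uy)^2\mathbf{1}_{\{|uy|\le1\}}+(2|uy|-1)\mathbf{1}_{\{|uy|>1\}}\big]\nu(du,s),$$ and for measurable $g:S\to\mathbb{R}$ the Luxemburg norm $\|g\|_\phi=\inf\{c>0:\int_S\phi(c^{-1}g(s),s)\,m(ds)\le1\}\in[0,\infty]$.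 $L^\phi$ is the Musielak--Orlicz space of measurable $g$ with $$\int_S\Big[g(s)^2\sigma^2(s)+\int_{\mathbb{R}}\big(|ug(s)|^2\wedge|ug(s)|\big)\nu(du,s)\Big]m(ds)<\infty;$$ equivalently $\|g\|_\phi<\infty$. Integrals with respect to $\Lambda$ are in the sense of Rajput and Rosiński: for a simple function $h=\sum_{i=1}^na_i\mathbf{1}_{A_i}$ ($A_i\in\mathcal{S}$) and $A\in\sigma(\mathcal{S})$, $\int_Ah\,d\Lambda=\sum_ia_i\Lambda(A_i\cap A)$; a measurable $g$ is integrable if there are simple $g_n\to g$ $m$-a.e. such that $\int_Ag_n\,d\Lambda$ converges in probability for every $A\in\sigma(\mathcal{S})$, and $\int_Sg\,d\Lambda$ is the limit in probability of $\int_Sg_n\,d\Lambda$. In the iterated integral, a measurable modification of $x\mapsto\int_Sf(x,s)\,\Lambda(ds)$ is used (one exists). *)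

theory Defs
  imports "HOL-Probability.Probability"
begin

definition delta_ring :: "'s set \<Rightarrow> 's set set \<Rightarrow> bool" where
  "delta_ring \<Omega> R \<longleftrightarrow> ring_of_sets \<Omega> R \<and>
     (\<forall>A :: nat \<Rightarrow> 's set. range A \<subseteq> R \<longrightarrow> (\<Inter>n. A n) \<in> R)"

definition sigma_finite_delta_ring :: "'s set \<Rightarrow> 's set set \<Rightarrow> bool" where
  "sigma_finite_delta_ring \<Omega> R \<longleftrightarrow> delta_ring \<Omega> R \<and>
     (\<exists>E :: nat \<Rightarrow> 's set. range E \<subseteq> R \<and> (\<Union>n. E n) = \<Omega>)"

text \<open>A law is infinitely divisible if, for every \<open>n \<ge> 1\<close>, it is the law of a sum of \<open>n\<close>
  independent variables with a common distribution \<open>\<rho>\<close> (the coordinates on a product space).\<close>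

definition infinitely_divisible :: "real measure \<Rightarrow> bool" where
  "infinitely_divisible L \<longleftrightarrow> (\<forall>n::nat. n \<ge> 1 \<longrightarrow> (\<exists>\<rho>. real_distribution \<rho> \<and>
     L = distr (PiM {..<n} (\<lambda>_. \<rho>)) borel (\<lambda>x. \<Sum>i<n. x i)))"

locale levy_basis = prob_space M
  for M :: "'w measure" +
  fixes \<Omega> :: "'s set" and R :: "'s set set" and \<Lambda> :: "'s set \<Rightarrow> 'w \<Rightarrow> real"
  assumes ring: "sigma_finite_delta_ring \<Omega> R"
    and random_variable: "A \<in> R \<Longrightarrow> \<Lambda> A \<in> borel_measurable M"
    and inf_divisible: "A \<in> R \<Longrightarrow> infinitely_divisible (distr M borel (\<Lambda> A))"
    and indep: "range B \<subseteq> R \<Longrightarrow> disjoint_family B \<Longrightarrow>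
      indep_vars (\<lambda>_. borel) (\<lambda>n::nat. \<Lambda> (B n)) UNIV"
    and additive: "range B \<subseteq> R \<Longrightarrow> disjoint_family B \<Longrightarrow> (\<Union>n::nat. B n) \<in> R \<Longrightarrow>
      AE \<omega> in M. (\<lambda>n. \<Lambda> (B n) \<omega>) sums \<Lambda> (\<Union>n. B n) \<omega>"

locale centered_levy_basis = levy_basis M \<Omega> R \<Lambda>
  for M :: "'w measure" and \<Omega> :: "'s set" and R :: "'s set set" and \<Lambda> :: "'s set \<Rightarrow> 'w \<Rightarrow> real" +
  assumes integrable: "A \<in> R \<Longrightarrow> integrable M (\<Lambda> A)"
    and mean_zero: "A \<in> R \<Longrightarrow> expectation (\<Lambda> A) = 0"

definition levy_measure :: "real measure \<Rightarrow> bool" where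
  "levy_measure \<rho> \<longleftrightarrow> sets \<rho> = sets borel \<and> emeasure \<rho> {0} = 0 \<and>
     (\<integral>\<^sup>+u. ennreal (min 1 (u\<^sup>2)) \<partial>\<rho>) < \<infinity>"

definition levy_exponent :: "('s \<Rightarrow> real) \<Rightarrow> ('s \<Rightarrow> real measure) \<Rightarrow> real \<Rightarrow> 's \<Rightarrow> complex" where
  "levy_exponent \<sigma>2 \<nu> y s =
     complex_of_real (- (\<sigma>2 s * y\<^sup>2 / 2)) +
     (\<integral>u. iexp (y * u) - 1 - \<i> * complex_of_real (y * u) \<partial>\<nu> s)"

text \<open>The Bochner integral of a non-integrable function is \<open>0\<close> by convention. The existence of the
  integrals in the characteristic function formula, which is implicit in writing the formula, is
  therefore stated explicitly.\<close>

locale centered_levy_characteristics = centered_levy_basis M \<Omega> R \<Lambda>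
  for M :: "'w measure" and \<Omega> :: "'s set" and R :: "'s set set" and \<Lambda> :: "'s set \<Rightarrow> 'w \<Rightarrow> real" +
  fixes m :: "'s measure" and \<sigma>2 :: "'s \<Rightarrow> real" and \<nu> :: "'s \<Rightarrow> real measure"
  assumes sigma_finite_m: "sigma_finite_measure m"
    and space_m: "space m = \<Omega>"
    and sets_m: "sets m = sigma_sets \<Omega> R"
    and measurable_\<sigma>2: "\<sigma>2 \<in> borel_measurable m"
    and nonneg_\<sigma>2: "s \<in> \<Omega> \<Longrightarrow> 0 \<le> \<sigma>2 s"
    and levy_measure_\<nu>: "s \<in> \<Omega> \<Longrightarrow> levy_measure (\<nu> s)"
    and measurable_\<nu>: "C \<in> sets borel \<Longrightarrow> (\<lambda>s. emeasure (\<nu> s) C) \<in> borel_measurable m"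
    and inner_integrable: "A \<in> R \<Longrightarrow> AE s\<in>A in m.
      integrable (\<nu> s) (\<lambda>u. iexp (y * u) - 1 - \<i> * complex_of_real (y * u))"
    and outer_integrable: "A \<in> R \<Longrightarrow> set_integrable m A (levy_exponent \<sigma>2 \<nu> y)"
    and characteristic_function: "A \<in> R \<Longrightarrow>
      (\<integral>\<omega>. iexp (y * \<Lambda> A \<omega>) \<partial>M) = exp (set_lebesgue_integral m A (levy_exponent \<sigma>2 \<nu> y))"
    and nondegenerate: "AE s in m. (\<sigma>2 s, \<nu> s) \<noteq> (0, null_measure borel)"

text \<open>\<open>levy_phi\<close> takes values in \<open>[0, \<infinity>]\<close>: it is finite for \<open>m\<close>-almost every \<open>s\<close>, but
  a Levy measure \<open>\<nu> s\<close> need not have a finite first moment away from the origin on an exceptional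
  null set.\<close>

definition levy_phi :: "('s \<Rightarrow> real) \<Rightarrow> ('s \<Rightarrow> real measure) \<Rightarrow> real \<Rightarrow> 's \<Rightarrow> ennreal" where
  "levy_phi \<sigma>2 \<nu> y s = ennreal (y\<^sup>2 * \<sigma>2 s) +
     (\<integral>\<^sup>+u. ennreal (if \<bar>u * y\<bar> \<le> 1 then (u * y)\<^sup>2 else 2 * \<bar>u * y\<bar> - 1) \<partial>\<nu> s)"

definition luxemburg_norm ::
  "'s measure \<Rightarrow> ('s \<Rightarrow> real) \<Rightarrow> ('s \<Rightarrow> real measure) \<Rightarrow> ('s \<Rightarrow> real) \<Rightarrow> ennreal" where
  "luxemburg_norm m \<sigma>2 \<nu> g =
     Inf {ennreal c | c. 0 < c \<and> (\<integral>\<^sup>+s. levy_phi \<sigma>2 \<nu> (inverse c * g s) s \<partial>m) \<le> 1}"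

definition L_phi ::
  "'s measure \<Rightarrow> ('s \<Rightarrow> real) \<Rightarrow> ('s \<Rightarrow> real measure) \<Rightarrow> ('s \<Rightarrow> real) set" where
  "L_phi m \<sigma>2 \<nu> = {g \<in> borel_measurable m.
     (\<integral>\<^sup>+s. (ennreal ((g s)\<^sup>2 * \<sigma>2 s) +
        (\<integral>\<^sup>+u. ennreal (min (\<bar>u * g s\<bar>\<^sup>2) \<bar>u * g s\<bar>) \<partial>\<nu> s)) \<partial>m) < \<infinity>}"

definition tendsto_in_probability ::
  "'w measure \<Rightarrow> (nat \<Rightarrow> 'w \<Rightarrow> real) \<Rightarrow> ('w \<Rightarrow> real) \<Rightarrow> bool" where
  "tendsto_in_probability M X Y \<longleftrightarrow> (\<forall>\<epsilon>>0.
     (\<lambda>n. measure M {\<omega> \<in> space M. \<bar>X n \<omega> - Y \<omega>\<bar> > \<epsilon>}) \<longlonglongrightarrow> 0)"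

text \<open>A simple function \<open>\<Sum>i. a\<^sub>i 1\<^bsub>A\<^sub>i\<^esub>\<close> is represented by the list of the pairs \<open>(a\<^sub>i, A\<^sub>i)\<close>; the
  sets need not be disjoint.\<close>

definition simple_fun :: "(real \<times> 's set) list \<Rightarrow> 's \<Rightarrow> real" where
  "simple_fun h s = (\<Sum>(a, B)\<leftarrow>h. a * indicator B s)"

definition simple_integral ::
  "('s set \<Rightarrow> 'w \<Rightarrow> real) \<Rightarrow> (real \<times> 's set) list \<Rightarrow> 's set \<Rightarrow> 'w \<Rightarrow> real" where
  "simple_integral \<Lambda> h A \<omega> = (\<Sum>(a, B)\<leftarrow>h. a * \<Lambda> (B \<inter> A) \<omega>)"

text \<open>The random variable \<open>Y\<close> is a version of the Rajput-Rosinski integral of \<open>g\<close> over the whole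
  space; in particular \<open>g\<close> is integrable.\<close>

definition has_levy_integral ::
  "'w measure \<Rightarrow> 's set set \<Rightarrow> ('s set \<Rightarrow> 'w \<Rightarrow> real) \<Rightarrow> 's measure \<Rightarrow>
   ('s \<Rightarrow> real) \<Rightarrow> ('w \<Rightarrow> real) \<Rightarrow> bool" where
  "has_levy_integral M R \<Lambda> m g Y \<longleftrightarrow> g \<in> borel_measurable m \<and> Y \<in> borel_measurable M \<and>
     (\<exists>h :: nat \<Rightarrow> (real \<times> 's set) list.
        (\<forall>n. snd ` set (h n) \<subseteq> R) \<and>
        (AE s in m. (\<lambda>n. simple_fun (h n) s) \<longlonglongrightarrow> g s) \<and>
        (\<forall>A\<in>sets m. \<exists>Z\<in>borel_measurable M.
           tendsto_in_probability M (\<lambda>n. simple_integral \<Lambda> (h n) A) Z) \<and>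
        tendsto_in_probability M (\<lambda>n. simple_integral \<Lambda> (h n) (space m)) Y)"

definition levy_integrable ::
  "'w measure \<Rightarrow> 's set set \<Rightarrow> ('s set \<Rightarrow> 'w \<Rightarrow> real) \<Rightarrow> 's measure \<Rightarrow> ('s \<Rightarrow> real) \<Rightarrow> bool" where
  "levy_integrable M R \<Lambda> m g \<longleftrightarrow> (\<exists>Y. has_levy_integral M R \<Lambda> m g Y)"

text \<open>A jointly measurable version of the process \<open>x \<mapsto> \<integral> f x d\<Lambda>\<close>.\<close>

definition measurable_levy_integral ::
  "'w measure \<Rightarrow> 's set set \<Rightarrow> ('s set \<Rightarrow> 'w \<Rightarrow> real) \<Rightarrow> 's measure \<Rightarrow>
   ('t::topological_space \<Rightarrow> 's \<Rightarrow> real) \<Rightarrow> ('t \<Rightarrow> 'w \<Rightarrow> real) \<Rightarrow> bool" where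
  "measurable_levy_integral M R \<Lambda> m f Y \<longleftrightarrow>
     (\<lambda>(x, \<omega>). Y x \<omega>) \<in> borel_measurable (borel \<Otimes>\<^sub>M M) \<and>
     (\<forall>x. has_levy_integral M R \<Lambda> m (f x) (Y x))"

end

theory Submission
  imports Defs
begin

text \<open>Writing \<open>\<phi>(y, s) = y\<^sup>2 \<sigma>\<^sup>2(s) + \<integral> k(uy) \<nu>(du, s)\<close>, the integral of a simple function \<open>h\<close> has an
  explicit characteristic function, and \<open>\<Sum>j. 2\<^sup>j (1 - cos(x/2\<^sup>j))\<close> is comparable with both \<open>k(x)\<close> and,
  for large \<open>x\<close>, with \<open>\<bar>x\<bar>\<close>; averaging the characteristic function with these weights bounds
  \<open>E \<bar>\<integral> h d\<Lambda>\<bar>\<close> by a multiple of \<open>\<parallel>h\<parallel>\<^sub>\<phi>\<close>. Hence the integral extends to a bounded linear operator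
  from \<open>L\<^sup>\<phi>\<close> to \<open>L\<^sup>1\<close>, and a gliding hump identifies every Rajput-Rosinski integral of an element of
  \<open>L\<^sup>\<phi>\<close> with its value. Jensen's inequality for the convex function \<open>\<phi>(_, s)\<close> gives the Minkowski
  inequality \<open>\<parallel>\<integral> f(x, _) \<mu>(dx)\<parallel>\<^sub>\<phi> \<le> \<integral> \<parallel>f(x, _)\<parallel>\<^sub>\<phi> \<mu>(dx)\<close>. By these two bounds both iterated integrals
  depend continuously on \<open>f\<close>, so that it suffices to compare them on indicators of rectangles.\<close>

section \<open>Two comparable kernels\<close>

text \<open>The interchange needs a first moment, while only characteristic functions are given. Up
  to a constant, \<open>|x|\<close> is the integral of \<open>(1 - cos (t x)) / t^2\<close> over t >
  0. Keeping only t \<le> 1 preserves the linear growth at infinity and makes the integral quadratic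
  at 0, which is the behaviour of k; the dyadic sum samples this integral at
  \<open>t = 2^-j\<close>. Thus the same weights turn the real part of the exponent into \<phi> and
  the law into a first moment. The imaginary part cannot be summed against the weights
  \<open>2^j\<close>, but it enters \<open>1 - Re (exp z)\<close> only through its square, which
  decays like \<open>4^-j\<close>.

  The Rajput-Rosinski definition gives no modular control over the approximating simple functions,
  only convergence almost everywhere and, for each set, in probability. Continuity of the operator
  therefore says nothing about an arbitrary such sequence, and uniqueness has to exploit the
  convergence over all measurable sets. Constants are not optimised: crude quasi-triangle
  inequalities are enough for finiteness and convergence.\<close>

definition orlicz_kernel :: "real \<Rightarrow> real" where
  "orlicz_kernel t = (if \<bar>t\<bar> \<le> 1 then t\<^sup>2 else 2 * \<bar>t\<bar> - 1)"

lemma orlicz_kernel_nonneg [simp]: "0 \<le> orlicz_kernel t"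
  by (auto simp: orlicz_kernel_def)

lemma orlicz_kernel_0 [simp]: "orlicz_kernel 0 = 0"
  by (auto simp: orlicz_kernel_def)

lemma orlicz_kernel_measurable [measurable]: "orlicz_kernel \<in> borel_measurable borel"
  unfolding orlicz_kernel_def by measurable

lemma orlicz_kernel_mono: "\<bar>t\<bar> \<le> \<bar>r\<bar> \<Longrightarrow> orlicz_kernel t \<le> orlicz_kernel r"
proof -
  assume *: "\<bar>t\<bar> \<le> \<bar>r\<bar>"
  then have "\<bar>t\<bar> \<le> 1 \<Longrightarrow> t\<^sup>2 \<le> 1"
    using abs_square_le_1 by blast
  moreover have "t\<^sup>2 \<le> r\<^sup>2" using * by (simp add: abs_le_square_iff)
  ultimately show ?thesis using * by (auto simp: orlicz_kernel_def)
qed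

lemma orlicz_kernel_ge: "\<bar>t\<bar> * min 1 \<bar>t\<bar> \<le> orlicz_kernel t"
  by (auto simp: orlicz_kernel_def min_def power2_eq_square)

lemma orlicz_kernel_le: "orlicz_kernel t \<le> 2 * (\<bar>t\<bar> * min 1 \<bar>t\<bar>)"
  by (auto simp: orlicz_kernel_def min_def power2_eq_square)

lemma orlicz_kernel_le_abs: "\<bar>t\<bar> \<le> 1 \<Longrightarrow> orlicz_kernel t \<le> \<bar>t\<bar>"
proof -
  assume t: "\<bar>t\<bar> \<le> 1"
  then have "\<bar>t\<bar> * \<bar>t\<bar> \<le> 1 * \<bar>t\<bar>" by (intro mult_right_mono) auto
  then show ?thesis using t by (simp add: orlicz_kernel_def power2_eq_square)
qed

lemma orlicz_kernel_le_square: "orlicz_kernel t \<le> t\<^sup>2"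
proof -
  have "0 \<le> (\<bar>t\<bar> - 1)\<^sup>2" by simp
  then have "2 * \<bar>t\<bar> - 1 \<le> t\<^sup>2" by (simp add: power2_diff)
  then show ?thesis by (simp add: orlicz_kernel_def)
qed

text \<open>The tangent of \<open>orlicz_kernel\<close> at \<open>r\<close> has slope \<open>2 min(r, 1)\<close> and ordinate
  \<open>- min(r\<^sup>2, 1)\<close> at the origin.\<close>

lemma orlicz_kernel_tangent_eq:
  "0 \<le> r \<Longrightarrow> 2 * min r 1 * r = orlicz_kernel r + min (r\<^sup>2) 1"
  using power_le_one[of r 2] one_le_power[of r 2]
  by (auto simp: orlicz_kernel_def min_def power2_eq_square not_le dest: antisym)

text \<open>This is convexity on [0, \<infinity>) in supporting-line form. Squares of differences
  settle the cases with t \<le> 1; for r \<le> 1 < t the gap factors as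
  \<open>(1 - r) (2 t - 1 - r)\<close>, and above 1 the kernel is its own tangent.\<close>

lemma orlicz_kernel_tangent_le:
  assumes "0 \<le> r" "0 \<le> t"
  shows "2 * min r 1 * t \<le> orlicz_kernel t + min (r\<^sup>2) 1"
proof -
  have a: "r \<le> 1 \<Longrightarrow> r\<^sup>2 \<le> 1" "\<not> r \<le> 1 \<Longrightarrow> 1 \<le> r\<^sup>2"
    using assms power_le_one[of r 2] one_le_power[of r 2] by auto
  have 1: "2 * r * t \<le> t\<^sup>2 + r\<^sup>2" using sum_squares_bound[of r t] by (simp add: algebra_simps)
  have 2: "2 * t \<le> t\<^sup>2 + 1" using sum_squares_bound[of 1 t] by (simp add: algebra_simps)
  have 3: "2 * r * t \<le> 2 * t - 1 + r\<^sup>2" if "r \<le> 1" "1 < t"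
  proof -
    have "0 \<le> (1 - r) * (2 * t - 1 - r)" using that by (intro mult_nonneg_nonneg) auto
    then show ?thesis by (simp add: algebra_simps power2_eq_square)
  qed
  show ?thesis
  proof (cases "r \<le> 1")
    case True
    then have "min r 1 = r" "min (r\<^sup>2) 1 = r\<^sup>2" using a by auto
    then show ?thesis using 1 3 True assms by (cases "t \<le> 1") (auto simp: orlicz_kernel_def)
  next
    case False
    then have "min r 1 = 1" "min (r\<^sup>2) 1 = 1" using a by auto
    then show ?thesis using 2 assms by (cases "t \<le> 1") (auto simp: orlicz_kernel_def)
  qed
qed

text \<open>Growth is at most quadratic. At c = 2 this is the doubling condition, which makes the
  modular stable under dilation.\<close>

lemma orlicz_kernel_scale_ge_1:
  assumes "1 \<le> c" shows "orlicz_kernel (c * t) \<le> c\<^sup>2 * orlicz_kernel t"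
proof (cases "\<bar>t\<bar> \<le> 1")
  case True
  then have "c\<^sup>2 * orlicz_kernel t = (c * t)\<^sup>2" by (simp add: orlicz_kernel_def power_mult_distrib)
  then show ?thesis using orlicz_kernel_le_square by simp
next
  case False
  then have "1 \<le> c * \<bar>t\<bar>" using assms mult_mono[of 1 c 1 "\<bar>t\<bar>"] by simp
  then have "1 \<le> \<bar>c * t\<bar>" using assms by (simp add: abs_mult)
  then have "orlicz_kernel (c * t) \<le> 2 * \<bar>c * t\<bar> - 1"
    using orlicz_kernel_le_abs[of "c * t"] by (cases "\<bar>c * t\<bar> \<le> 1") (auto simp: orlicz_kernel_def)
  also have "\<dots> = 2 * (c * \<bar>t\<bar>) - 1" using assms by (simp add: abs_mult)
  also have "\<dots> \<le> c\<^sup>2 * (2 * \<bar>t\<bar> - 1)"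
  proof -
    \<comment> \<open>The product is the difference of the two sides, factored.\<close>
    have "0 \<le> (c - 1) * ((\<bar>t\<bar> - 1) * (2 * c) + (c - 1))"
      using assms False by (intro mult_nonneg_nonneg add_nonneg_nonneg) auto
    then show ?thesis by (simp add: algebra_simps power2_eq_square)
  qed
  finally show ?thesis using False by (simp add: orlicz_kernel_def)
qed

text \<open>The kernel is convex and vanishes at 0, so dilation by c \<le> 1 contracts it at least
  linearly.\<close>

lemma orlicz_kernel_scale_le_1:
  assumes "0 \<le> c" "c \<le> 1" shows "orlicz_kernel (c * t) \<le> c * orlicz_kernel t"
proof (cases "\<bar>t\<bar> \<le> 1")
  case True
  then have "c * \<bar>t\<bar> \<le> 1" using assms by (simp add: mult_le_one)
  moreover have "c\<^sup>2 \<le> c" using assms by (simp add: power2_eq_square mult_left_le)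
  ultimately show ?thesis using True assms
    by (auto simp: orlicz_kernel_def power_mult_distrib abs_mult intro: mult_right_mono)
next
  case False
  note t = this
  show ?thesis
  proof (cases "c * \<bar>t\<bar> \<le> 1")
    case True
    have "orlicz_kernel (c * t) \<le> c * \<bar>t\<bar>"
      using orlicz_kernel_le_abs[of "c * t"] True assms by (simp add: abs_mult)
    also have "\<dots> \<le> c * (2 * \<bar>t\<bar> - 1)" using t assms by (intro mult_left_mono) auto
    finally show ?thesis using t by (simp add: orlicz_kernel_def)
  next
    case False
    then show ?thesis using t assms by (simp add: orlicz_kernel_def abs_mult algebra_simps)
  qed
qed

text \<open>Partial sums of \<open>H x = (\<Sum>j. 2^j * (1 - cos (x / 2^j)))\<close>, a function comparable with
  \<open>orlicz_kernel\<close> whose expectation is a combination of values of the characteristic function.\<close>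

definition cos_kernel :: "nat \<Rightarrow> real \<Rightarrow> real" where
  "cos_kernel n x = (\<Sum>j<n. 2 ^ j * (1 - cos (x / 2 ^ j)))"

lemma cos_kernel_0 [simp]: "cos_kernel 0 x = 0"
  by (simp add: cos_kernel_def)

text \<open>Splitting off j = 0 leaves the same sum at half the argument. This self-similarity
  drives the inductions below, in which x must therefore vary.\<close>

lemma cos_kernel_Suc: "cos_kernel (Suc n) x = (1 - cos x) + 2 * cos_kernel n (x / 2)"
  unfolding cos_kernel_def by (subst sum.lessThan_Suc_shift) (simp add: sum_distrib_left mult.assoc)

lemma cos_kernel_nonneg [simp]: "0 \<le> cos_kernel n x"
  unfolding cos_kernel_def by (auto intro!: sum_nonneg)

lemma cos_kernel_mono: "n \<le> n' \<Longrightarrow> cos_kernel n x \<le> cos_kernel n' x"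
  unfolding cos_kernel_def by (auto intro!: sum_mono2)

lemma cos_kernel_measurable [measurable]: "cos_kernel n \<in> borel_measurable borel"
  unfolding cos_kernel_def by measurable

section \<open>Trigonometric estimates and comparison of the two kernels\<close>

lemma one_minus_cos_le: "1 - cos x \<le> (x::real)\<^sup>2 / 2"
proof -
  have "(sin (x / 2))\<^sup>2 \<le> (x / 2)\<^sup>2"
    using abs_sin_x_le_abs_x[of "x / 2"] by (simp only: abs_le_square_iff)
  then show ?thesis using cos_double_sin[of "x / 2"] by (simp add: power_divide)
qed

lemma abs_sin_minus_self_le: "\<bar>sin x - x\<bar> \<le> x\<^sup>2 / 2" "\<bar>sin x - x\<bar> \<le> 2 * \<bar>x::real\<bar>"
proof -
  show "\<bar>sin x - x\<bar> \<le> x\<^sup>2 / 2"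
    using Maclaurin_sin_bound[of x 2] by (simp add: sin_coeff_def numeral_eq_Suc)
  show "\<bar>sin x - x\<bar> \<le> 2 * \<bar>x\<bar>"
    using abs_sin_x_le_abs_x[of x] by linarith
qed

lemma one_minus_cos_ge:
  assumes "\<bar>x\<bar> \<le> 1" shows "(x::real)\<^sup>2 / 4 \<le> 1 - cos x"
proof -
  define y where "y = \<bar>x / 2\<bar>"
  have y: "0 \<le> y" "y \<le> 1 / 2" using assms by (auto simp: y_def)
  have "y * y \<le> y * (1 / 2)" using y by (intro mult_left_mono) auto
  \<comment> \<open>From \<open>sin y \<ge> y - y^2 / 2\<close> and y \<le> 1/2. Squaring gives
    \<open>1 - cos x \<ge> 2 (9/16) (x^2 / 4)\<close>, that is 9/32 of \<open>x^2\<close>, more than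
    the quarter claimed.\<close>
  then have "3 / 4 * y \<le> sin y"
    using abs_sin_minus_self_le(1)[of y] y unfolding power2_eq_square abs_le_iff by linarith
  then have "(3 / 4 * y)\<^sup>2 \<le> (sin y)\<^sup>2" using y by (intro power_mono) auto
  moreover have "1 - cos x = 2 * (sin y)\<^sup>2" "y\<^sup>2 = x\<^sup>2 / 4"
    using cos_double_sin[of y] by (auto simp: y_def power_divide)
  ultimately have "x\<^sup>2 * (9 / 32) \<le> 1 - cos x" by (simp add: power_mult_distrib power_divide)
  moreover have "0 \<le> x\<^sup>2" by simp
  ultimately show ?thesis by linarith
qed

text \<open>\<open>x^2 / 2 + 2 (x / 2)^2 = x^2\<close>, so the constant 1 reproduces itself in the
  induction.\<close>

lemma cos_kernel_le_square: "cos_kernel n x \<le> x\<^sup>2"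
proof (induction n arbitrary: x)
  case (Suc n)
  show ?case using Suc[of "x / 2"] one_minus_cos_le[of x]
    by (simp add: cos_kernel_Suc power_divide)
qed auto

text \<open>For \<open>|x| \<ge> 1\<close> the first term is at most 2, and
  \<open>2 + 2 (5 |x| / 2 - 2) = 5 |x| - 2\<close>: the ordinate -2 is what absorbs it. The range
  starts at 1/2 so that halving stays inside; on [1/2, 1] the chord of the square lies below the
  line.\<close>

lemma cos_kernel_le_abs: "1 / 2 \<le> \<bar>x\<bar> \<Longrightarrow> cos_kernel n x \<le> 5 * \<bar>x\<bar> - 2"
proof (induction n arbitrary: x)
  case (Suc n)
  show ?case
  proof (cases "1 \<le> \<bar>x\<bar>")
    case True
    then have "cos_kernel n (x / 2) \<le> 5 * \<bar>x / 2\<bar> - 2" by (intro Suc(1)) auto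
    then show ?thesis using cos_ge_minus_one[of x] unfolding cos_kernel_Suc by linarith
  next
    case False
    have "(\<bar>x\<bar> - 1/2) * (1 - \<bar>x\<bar>) \<ge> 0" using False Suc(2) by (intro mult_nonneg_nonneg) auto
    moreover have "(\<bar>x\<bar> - 1/2) * (1 - \<bar>x\<bar>) = 3 / 2 * \<bar>x\<bar> - 1 / 2 - x\<^sup>2"
      by (simp add: field_simps power2_eq_square)
    ultimately have "x\<^sup>2 \<le> 5 * \<bar>x\<bar> - 2" using Suc(2) by linarith
    then show ?thesis using cos_kernel_le_square[of "Suc n" x] by linarith
  qed
qed auto

lemma cos_kernel_le: "cos_kernel n x \<le> 5 * orlicz_kernel x"
  using cos_kernel_le_square[of n x] cos_kernel_le_abs[of x n]
  by (auto simp: orlicz_kernel_def intro: order_trans)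

lemma cos_kernel_le_linear: "cos_kernel n x \<le> 5 * \<bar>x\<bar>"
proof (cases "1 \<le> \<bar>x\<bar>")
  case True then show ?thesis using cos_kernel_le_abs[of x n] by simp
next
  case False
  then have "\<bar>x\<bar> * \<bar>x\<bar> \<le> 1 * \<bar>x\<bar>" by (intro mult_right_mono) auto
  then have "x\<^sup>2 \<le> \<bar>x\<bar>" by (simp add: power2_eq_square)
  then show ?thesis using cos_kernel_le_square[of n x] by simp
qed

text \<open>Halving brings \<open>|x|\<close> into [1, 2), where
  \<open>1 - cos x \<ge> 1 - cos 1 \<ge> 1/4\<close>; hence the constant 8. The bound
  \<open>|x| < 2^n\<close> guarantees enough terms for the halvings.\<close>

lemma abs_le_cos_kernel: "1 \<le> \<bar>x\<bar> \<Longrightarrow> \<bar>x\<bar> < 2 ^ n \<Longrightarrow> \<bar>x\<bar> \<le> 8 * cos_kernel n x"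
proof (induction n arbitrary: x)
  case (Suc n)
  show ?case
  proof (cases "2 \<le> \<bar>x\<bar>")
    case True
    then have "\<bar>x / 2\<bar> \<le> 8 * cos_kernel n (x / 2)" using Suc(3) by (intro Suc(1)) auto
    then have "\<bar>x\<bar> \<le> 16 * cos_kernel n (x / 2)" by simp
    then show ?thesis using cos_le_one[of x] unfolding cos_kernel_Suc by argo
  next
    case False
    have "cos \<bar>x\<bar> \<le> cos 1" using False Suc(2) pi_gt3 by (subst cos_mono_le_eq) auto
    then have "1 / 4 \<le> 1 - cos x" using one_minus_cos_ge[of 1] by simp
    then show ?thesis using False cos_kernel_nonneg[of n "x/2"] unfolding cos_kernel_Suc by argo
  qed
qed auto

lemma orlicz_kernel_le_cos_kernel:
  assumes "1 \<le> n" "\<bar>x\<bar> < 2 ^ n" shows "orlicz_kernel x \<le> 16 * cos_kernel n x"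
proof (cases "1 \<le> \<bar>x\<bar>")
  case True
  then show ?thesis using abs_le_cos_kernel[of x n] assms orlicz_kernel_le[of x] by (simp add: min_absorb1)
next
  case False
  have "x\<^sup>2 / 4 \<le> 1 - cos x" using one_minus_cos_ge[of x] False by simp
  also have "\<dots> = cos_kernel 1 x" by (simp add: cos_kernel_def)
  also have "\<dots> \<le> cos_kernel n x" using assms by (intro cos_kernel_mono)
  finally show ?thesis using orlicz_kernel_le_square[of x] cos_kernel_nonneg[of n x] by linarith
qed

section \<open>The Musielak-Orlicz function\<close>

lemma ennreal_le_of_mult_less_one:
  fixes x y :: ennreal
  assumes "\<And>c. 0 < c \<Longrightarrow> c < 1 \<Longrightarrow> ennreal c * x \<le> y"
  shows "x \<le> y"
proof (cases y)
  case (real r)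
  show ?thesis
  proof (cases x)
    case (real q)
    have "c * q \<le> r" if "0 < c" "c < 1" for c
      using assms[OF that] that \<open>y = ennreal r\<close> \<open>0 \<le> r\<close> real
      by (simp add: ennreal_mult[symmetric])
    then have "q \<le> r" by (rule field_le_mult_one_interval)
    then show ?thesis using \<open>y = ennreal r\<close> real by (simp add: ennreal_leI)
  next
    case top
    then show ?thesis using assms[of "1/2"] real by (simp add: ennreal_mult_top)
  qed
qed auto

text \<open>For inequalities between Luxemburg norms: it suffices to test real c above the
  right-hand side, and such c are admissible in the infimum that defines the norm.\<close>

lemma ennreal_le_of_real_upper_bounds:
  assumes "K < \<infinity>" "\<And>c. 0 < c \<Longrightarrow> K < ennreal c \<Longrightarrow> X \<le> ennreal c"
  shows "X \<le> K"
proof (rule ennreal_le_epsilon)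
  fix e :: real assume "0 < e"
  obtain k where k: "K = ennreal k" "0 \<le> k" using assms(1) by (cases K) auto
  have "X \<le> ennreal (k + e)" using k \<open>0 < e\<close> by (intro assms(2)) (auto simp: ennreal_less_iff)
  then show "X \<le> K + ennreal e" using k \<open>0 < e\<close> by simp
qed

lemma levy_phi_eq:
  "levy_phi \<sigma>2 \<nu> y s = ennreal (y\<^sup>2 * \<sigma>2 s) + (\<integral>\<^sup>+u. ennreal (orlicz_kernel (u * y)) \<partial>\<nu> s)"
  by (simp add: levy_phi_def orlicz_kernel_def)

context centered_levy_characteristics
begin

abbreviation \<phi> :: "real \<Rightarrow> 's \<Rightarrow> ennreal" where
  "\<phi> \<equiv> levy_phi \<sigma>2 \<nu>"

sublocale m: sigma_finite_measure m
  by (rule sigma_finite_m)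

declare measurable_\<sigma>2 [measurable]

lemma sets_\<nu>: "s \<in> \<Omega> \<Longrightarrow> sets (\<nu> s) = sets borel"
  using levy_measure_\<nu> by (auto simp: levy_measure_def)

lemma measurable_\<nu>_iff: "s \<in> \<Omega> \<Longrightarrow> borel_measurable (\<nu> s) = borel_measurable borel"
  by (intro measurable_cong_sets sets_\<nu>) auto

text \<open>Measurability of \<nu> is assumed set by set; induction on F extends it to integrals,
  also when \<open>\<nu> s\<close> has infinite mass near 0. Every case rewrites on
  \<open>space m\<close> only, because nothing is known of \<open>\<nu> s\<close> elsewhere, not
  even its sets.\<close>

lemma nn_integral_\<nu>_measurable:
  assumes "F \<in> borel_measurable borel"
  shows "(\<lambda>s. \<integral>\<^sup>+u. F u \<partial>\<nu> s) \<in> borel_measurable m"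
  using assms
proof (induction rule: borel_measurable_induct)
  case (cong f g)
  then show ?case by (simp add: fun_eq_iff)
next
  case (set A)
  then have "(\<integral>\<^sup>+u. indicator A u \<partial>\<nu> s) = emeasure (\<nu> s) A" if "s \<in> space m" for s
    using sets_\<nu>[of s] that space_m by simp
  then show ?case using measurable_\<nu>[OF set] by (simp cong: measurable_cong)
next
  case (mult u c)
  then have "(\<integral>\<^sup>+x. c * u x \<partial>\<nu> s) = c * (\<integral>\<^sup>+x. u x \<partial>\<nu> s)" if "s \<in> space m" for s
    using measurable_\<nu>_iff[of s] that space_m by (intro nn_integral_cmult) auto
  then show ?case using mult by (simp cong: measurable_cong)
next
  case (add u v)
  then have "(\<integral>\<^sup>+x. v x + u x \<partial>\<nu> s) = (\<integral>\<^sup>+x. v x \<partial>\<nu> s) + (\<integral>\<^sup>+x. u x \<partial>\<nu> s)" if "s \<in> space m" for s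
    using measurable_\<nu>_iff[of s] that space_m by (intro nn_integral_add) auto
  then show ?case using add by (simp cong: measurable_cong)
next
  case (seq U)
  then have "(\<integral>\<^sup>+x. (SUP i. U i x) \<partial>\<nu> s) = (SUP i. \<integral>\<^sup>+x. U i x \<partial>\<nu> s)" if "s \<in> space m" for s
    using measurable_\<nu>_iff[of s] that space_m by (intro nn_integral_monotone_convergence_SUP) auto
  then show ?case using seq by (simp add: SUP_apply[abs_def] image_comp cong: measurable_cong)
qed

lemma phi_measurable [measurable]: "\<phi> y \<in> borel_measurable m"
  unfolding levy_phi_eq by (intro borel_measurable_add nn_integral_\<nu>_measurable; measurable)

lemma phi_0 [simp]: "\<phi> 0 s = 0"
  by (simp add: levy_phi_eq)

lemma phi_mono:
  assumes "s \<in> \<Omega>" "\<bar>y\<bar> \<le> \<bar>z\<bar>" shows "\<phi> y s \<le> \<phi> z s"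
  unfolding levy_phi_eq using assms nonneg_\<sigma>2[of s]
  by (intro add_mono nn_integral_mono ennreal_leI orlicz_kernel_mono mult_right_mono)
     (auto simp: abs_mult abs_le_square_iff intro: mult_left_mono)

lemma phi_scale_ge_1:
  assumes s: "s \<in> \<Omega>" and "1 \<le> c" shows "\<phi> (c * y) s \<le> ennreal (c\<^sup>2) * \<phi> y s"
proof -
  have "\<phi> (c * y) s \<le> ennreal (c\<^sup>2 * (y\<^sup>2 * \<sigma>2 s)) + (\<integral>\<^sup>+u. ennreal (c\<^sup>2 * orlicz_kernel (u * y)) \<partial>\<nu> s)"
    unfolding levy_phi_eq using assms orlicz_kernel_scale_ge_1[of c]
    by (intro add_mono nn_integral_mono ennreal_leI) (auto simp: power_mult_distrib mult.assoc mult.left_commute[of _ c])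
  also have "\<dots> = ennreal (c\<^sup>2) * \<phi> y s"
    unfolding levy_phi_eq using s
    by (simp add: ennreal_mult distrib_left nonneg_\<sigma>2 nn_integral_cmult measurable_\<nu>_iff)
  finally show ?thesis .
qed

lemma phi_scale_le_1:
  assumes s: "s \<in> \<Omega>" and c: "0 \<le> c" "c \<le> 1" shows "\<phi> (c * y) s \<le> ennreal c * \<phi> y s"
proof -
  have "c\<^sup>2 \<le> c" using c by (simp add: power2_eq_square mult_left_le)
  then have "c\<^sup>2 * (y\<^sup>2 * \<sigma>2 s) \<le> c * (y\<^sup>2 * \<sigma>2 s)"
    using nonneg_\<sigma>2[OF s] by (intro mult_right_mono) auto
  then have "\<phi> (c * y) s \<le> ennreal (c * (y\<^sup>2 * \<sigma>2 s)) + (\<integral>\<^sup>+u. ennreal (c * orlicz_kernel (u * y)) \<partial>\<nu> s)"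
    unfolding levy_phi_eq using c orlicz_kernel_scale_le_1[of c]
    by (intro add_mono nn_integral_mono ennreal_leI) (auto simp: power_mult_distrib mult.assoc mult.left_commute[of _ c])
  also have "\<dots> = ennreal c * \<phi> y s"
    unfolding levy_phi_eq using assms
    by (simp add: ennreal_mult distrib_left nonneg_\<sigma>2 nn_integral_cmult measurable_\<nu>_iff)
  finally show ?thesis .
qed

lemma phi_abs: "s \<in> \<Omega> \<Longrightarrow> \<phi> \<bar>y\<bar> s = \<phi> y s"
  by (intro antisym phi_mono) auto

lemma phi_uminus: "s \<in> \<Omega> \<Longrightarrow> \<phi> (- y) s = \<phi> y s"
  by (intro antisym phi_mono) auto

text \<open>The sum is at most twice the larger argument in modulus, and doubling costs the factor
  4.\<close>

lemma phi_add:
  assumes s: "s \<in> \<Omega>" shows "\<phi> (a + b) s \<le> 4 * (\<phi> a s + \<phi> b s)"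
proof -
  define z where "z = (if \<bar>a\<bar> \<le> \<bar>b\<bar> then b else a)"
  have "\<phi> (a + b) s \<le> \<phi> (2 * z) s" by (intro phi_mono s) (auto simp: z_def)
  also have "\<dots> \<le> 4 * \<phi> z s" using phi_scale_ge_1[OF s, of 2 z] by simp
  also have "\<dots> \<le> 4 * (\<phi> a s + \<phi> b s)" by (intro mult_left_mono) (auto simp: z_def)
  finally show ?thesis .
qed

lemma phi_le_linear:
  "s \<in> \<Omega> \<Longrightarrow> \<bar>y\<bar> \<le> 1 \<Longrightarrow> \<phi> y s \<le> ennreal \<bar>y\<bar> * \<phi> 1 s"
  using phi_scale_le_1[of s "\<bar>y\<bar>" 1] by (simp add: phi_abs)

text \<open>Contraction by \<open>1 / |y|\<close>, read backwards. Where
  \<open>\<phi> 1 s > 0\<close> this growth shows later that \<phi> cannot stay bounded, which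
  excludes infinite inner integrals.\<close>

lemma phi_ge_linear:
  assumes s: "s \<in> \<Omega>" and y: "1 \<le> \<bar>y\<bar>" shows "ennreal \<bar>y\<bar> * \<phi> 1 s \<le> \<phi> y s"
proof -
  have "\<phi> 1 s \<le> ennreal (1 / \<bar>y\<bar>) * \<phi> \<bar>y\<bar> s"
    using phi_scale_le_1[OF s, of "1 / \<bar>y\<bar>" "\<bar>y\<bar>"] y by (cases "y = 0") auto
  then have "ennreal \<bar>y\<bar> * \<phi> 1 s \<le> ennreal \<bar>y\<bar> * (ennreal (1 / \<bar>y\<bar>) * \<phi> \<bar>y\<bar> s)"
    by (intro mult_left_mono) auto
  also have "\<dots> = \<phi> y s"
    using y s by (simp add: mult.assoc[symmetric] ennreal_mult[symmetric] phi_abs)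
  finally show ?thesis .
qed

lemma phi_ge_square:
  assumes s: "s \<in> \<Omega>" and y: "\<bar>y\<bar> \<le> 1" shows "ennreal (y\<^sup>2) * \<phi> 1 s \<le> \<phi> y s"
proof (cases "y = 0")
  case False
  have "\<phi> 1 s \<le> ennreal ((1 / \<bar>y\<bar>)\<^sup>2) * \<phi> \<bar>y\<bar> s"
    using phi_scale_ge_1[OF s, of "1 / \<bar>y\<bar>" "\<bar>y\<bar>"] y False by auto
  then have "ennreal (y\<^sup>2) * \<phi> 1 s \<le> ennreal (y\<^sup>2) * (ennreal ((1 / \<bar>y\<bar>)\<^sup>2) * \<phi> \<bar>y\<bar> s)"
    by (intro mult_left_mono) auto
  also have "\<dots> = \<phi> y s"
    using False s by (simp add: mult.assoc[symmetric] ennreal_mult[symmetric] phi_abs power_divide)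
  finally show ?thesis .
qed auto

text \<open>Measurability in s is known for fixed y only; a countable supremum makes \<phi> jointly
  measurable. \<phi> is increasing in \<open>|y|\<close>, and the quadratic dilation bound gives the
  left continuity that lets rationals suffice, also for infinite values. The case distinction keeps
  the index set independent of y.\<close>

lemma phi_eq_SUP_Rats:
  assumes s: "s \<in> \<Omega>"
  shows "\<phi> y s = (SUP q\<in>\<rat>. if \<bar>q\<bar> \<le> \<bar>y\<bar> then \<phi> q s else 0)" (is "_ = ?S")
proof (rule antisym)
  show "\<phi> y s \<le> ?S"
  proof (rule ennreal_le_of_mult_less_one)
    fix z :: real assume z: "0 < z" "z < 1"
    \<comment> \<open>Dilation by c costs the square of c, hence the root.\<close>
    define c where "c = sqrt z"
    have c: "0 < c" "c < 1" "c\<^sup>2 = z" using z by (auto simp: c_def)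
    show "ennreal z * \<phi> y s \<le> ?S"
    proof (cases "y = 0")
      case False
      then have "c * \<bar>y\<bar> < \<bar>y\<bar>" using c by simp
      then obtain q where q: "q \<in> \<rat>" "c * \<bar>y\<bar> < q" "q < \<bar>y\<bar>" using Rats_dense_in_real by blast
      have "0 \<le> q" using q(2) c(1) by (smt (verit) abs_ge_zero mult_nonneg_nonneg)
      have "\<phi> y s \<le> ennreal ((1 / c)\<^sup>2) * \<phi> (c * y) s"
        using phi_scale_ge_1[OF s, of "1 / c" "c * y"] c by simp
      then have "ennreal z * \<phi> y s \<le> ennreal z * (ennreal ((1 / c)\<^sup>2) * \<phi> (c * y) s)"
        by (intro mult_left_mono) auto
      also have "\<dots> = \<phi> (c * y) s"
        using c z by (simp add: mult.assoc[symmetric] ennreal_mult[symmetric] power_divide)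
      also have "\<dots> \<le> \<phi> q s"
        using q c \<open>0 \<le> q\<close> by (intro phi_mono s) (auto simp: abs_mult)
      also have "\<dots> \<le> ?S"
        using q \<open>0 \<le> q\<close> by (intro SUP_upper2[of q]) auto
      finally show ?thesis .
    qed auto
  qed
  show "?S \<le> \<phi> y s"
    by (intro SUP_least) (auto intro: phi_mono s)
qed

lemma phi_measurable_compose [measurable (raw)]:
  assumes [measurable]: "g \<in> borel_measurable N" "p \<in> measurable N m"
  shows "(\<lambda>w. \<phi> (g w) (p w)) \<in> borel_measurable N"
proof -
  have "(\<lambda>w. SUP q\<in>\<rat>. if \<bar>q\<bar> \<le> \<bar>g w\<bar> then \<phi> q (p w) else 0) \<in> borel_measurable N"
    by (intro borel_measurable_SUP countable_rat) measurable
  moreover have "\<phi> (g w) (p w) = (SUP q\<in>\<rat>. if \<bar>q\<bar> \<le> \<bar>g w\<bar> then \<phi> q (p w) else 0)"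
    if "w \<in> space N" for w
    using measurable_space[OF assms(2) that] space_m by (intro phi_eq_SUP_Rats) simp
  ultimately show ?thesis by (simp cong: measurable_cong)
qed

text \<open>A supporting line of \<open>\<phi> _ s\<close> at \<open>t0\<close>, with slope \<open>l\<close> and ordinate \<open>- d\<close> at the origin;
  moving \<open>d\<close> to the other side avoids subtraction in \<open>[0, \<infinity>]\<close>.\<close>

lemma phi_tangent:
  assumes s: "s \<in> \<Omega>" and fin: "\<phi> t0 s < \<infinity>" and t0: "0 \<le> t0"
  obtains l d where "d < \<infinity>" "l * ennreal t0 = \<phi> t0 s + d"
    "\<And>t. 0 \<le> t \<Longrightarrow> l * ennreal t \<le> \<phi> t s + d"
proof -
  note [simp] = measurable_\<nu>_iff[OF s]
  \<comment> \<open>Slope and ordinate of the tangent to \<open>y^2 \<sigma>2 s\<close> at t0, plus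
    those of the tangents to the kernel at \<open>|u t0|\<close>, integrated in u; the chain rule
    contributes the extra factor \<open>|u|\<close> to the slope.\<close>
  define l where "l = ennreal (2 * t0 * \<sigma>2 s) + (\<integral>\<^sup>+u. ennreal (2 * \<bar>u\<bar> * min \<bar>u * t0\<bar> 1) \<partial>\<nu> s)"
  define d where "d = ennreal (t0\<^sup>2 * \<sigma>2 s) + (\<integral>\<^sup>+u. ennreal (min ((u * t0)\<^sup>2) 1) \<partial>\<nu> s)"
  have l: "l * ennreal t = ennreal (2 * t0 * t * \<sigma>2 s) + (\<integral>\<^sup>+u. ennreal (2 * min \<bar>u * t0\<bar> 1 * \<bar>u * t\<bar>) \<partial>\<nu> s)"
    if "0 \<le> t" for t
  proof -
    have "l * ennreal t = ennreal (2 * t0 * \<sigma>2 s) * ennreal t + (\<integral>\<^sup>+u. ennreal (2 * \<bar>u\<bar> * min \<bar>u * t0\<bar> 1) * ennreal t \<partial>\<nu> s)"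
      unfolding l_def by (simp add: distrib_right nn_integral_multc)
    then show ?thesis
      using that t0 nonneg_\<sigma>2[OF s]
      by (simp add: ennreal_mult'[symmetric] abs_mult mult_ac)
  qed
  have phi_d: "\<phi> t s + d = ennreal ((t\<^sup>2 + t0\<^sup>2) * \<sigma>2 s)
      + (\<integral>\<^sup>+u. ennreal (orlicz_kernel \<bar>u * t\<bar> + min ((u * t0)\<^sup>2) 1) \<partial>\<nu> s)" for t
  proof -
    have "orlicz_kernel \<bar>u * t\<bar> = orlicz_kernel (u * t)" for u
      by (simp add: orlicz_kernel_def)
    moreover have "ennreal ((t\<^sup>2 + t0\<^sup>2) * \<sigma>2 s) = ennreal (t\<^sup>2 * \<sigma>2 s) + ennreal (t0\<^sup>2 * \<sigma>2 s)"
      using nonneg_\<sigma>2[OF s] by (simp add: distrib_right)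
    ultimately show ?thesis
      unfolding levy_phi_eq d_def by (simp add: nn_integral_add add_ac)
  qed
  have eq: "l * ennreal t0 = \<phi> t0 s + d"
    unfolding l[OF t0] phi_d using orlicz_kernel_tangent_eq[of "\<bar>u * t0\<bar>" for u] t0
    by (simp add: power2_eq_square distrib_right mult_ac)
  have le: "l * ennreal t \<le> \<phi> t s + d" if "0 \<le> t" for t
    unfolding l[OF that] phi_d
  proof (intro add_mono nn_integral_mono ennreal_leI)
    show "2 * t0 * t * \<sigma>2 s \<le> (t\<^sup>2 + t0\<^sup>2) * \<sigma>2 s"
      using sum_squares_bound[of t0 t] nonneg_\<sigma>2[OF s] by (intro mult_right_mono) (auto simp: ac_simps)
    show "2 * min \<bar>u * t0\<bar> 1 * \<bar>u * t\<bar> \<le> orlicz_kernel \<bar>u * t\<bar> + min ((u * t0)\<^sup>2) 1" for u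
      using orlicz_kernel_tangent_le[of "\<bar>u * t0\<bar>" "\<bar>u * t\<bar>"] by simp
  qed
  have "min (x\<^sup>2) 1 \<le> orlicz_kernel x" for x :: real
    by (auto simp: orlicz_kernel_def)
  then have "d \<le> \<phi> t0 s"
    unfolding d_def levy_phi_eq by (intro add_mono nn_integral_mono ennreal_leI) auto
  then have "d < \<infinity>" using fin by (rule le_less_trans)
  then show ?thesis using eq le by (rule that)
qed

end

section \<open>Simple functions\<close>

lemma disjoint_family_on_reindex:
  assumes "disjoint_family_on F I" "bij_betw b J I"
  shows "disjoint_family_on (\<lambda>i. F (b i)) J"
  unfolding disjoint_family_on_def
proof (intro ballI impI)
  fix i j assume "i \<in> J" "j \<in> J" "i \<noteq> j"
  then have "b i \<in> I" "b j \<in> I" "b i \<noteq> b j"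
    using assms(2) by (auto simp: bij_betw_def inj_on_def)
  then show "F (b i) \<inter> F (b j) = {}" using assms(1) by (auto simp: disjoint_family_on_def)
qed

context centered_levy_characteristics
begin

section \<open>The delta-ring and almost sure finite additivity\<close>

lemma R_ring: "ring_of_sets \<Omega> R"
  using ring by (auto simp: sigma_finite_delta_ring_def delta_ring_def)

sublocale R: ring_of_sets \<Omega> R
  by (rule R_ring)

lemma R_sub_sets: "A \<in> R \<Longrightarrow> A \<in> sets m"
  using sets_m by auto

lemma R_INT: "(\<And>n::nat. A n \<in> R) \<Longrightarrow> (\<Inter>n. A n) \<in> R"
  using ring by (auto simp: sigma_finite_delta_ring_def delta_ring_def)

text \<open>This ideal property makes \<open>\<Lambda> (B \<inter> A)\<close> available for every
  measurable A. In the union case, closure under countable intersections is used through complements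
  relative to B.\<close>

lemma R_trace:
  assumes "A \<in> sets m" "B \<in> R" shows "A \<inter> B \<in> R"
proof -
  have "A \<in> sigma_sets \<Omega> R" using assms sets_m by simp
  then show ?thesis
  proof (induction rule: sigma_sets.induct)
    case (Basic a)
    then show ?case using \<open>B \<in> R\<close> by (rule R.Int)
  next
    case Empty
    then show ?case by simp
  next
    case (Compl a)
    moreover have "(\<Omega> - a) \<inter> B = B - a \<inter> B" using \<open>B \<in> R\<close> R.space_closed by auto
    ultimately show ?case using \<open>B \<in> R\<close> by auto
  next
    case (Union a)
    have "(\<Inter>i. B - a i \<inter> B) \<in> R" using Union \<open>B \<in> R\<close> by (intro R_INT R.Diff) auto
    then have "B - (\<Inter>i. B - a i \<inter> B) \<in> R" using \<open>B \<in> R\<close> by auto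
    moreover have "B - (\<Inter>i. B - a i \<inter> B) = (\<Union>i. a i) \<inter> B" by auto
    ultimately show ?case by simp
  qed
qed

lemma R_exhaustion:
  obtains E :: "nat \<Rightarrow> 's set" where "\<And>n. E n \<in> R" "incseq E" "(\<Union>n. E n) = \<Omega>"
proof -
  obtain F :: "nat \<Rightarrow> 's set" where F: "range F \<subseteq> R" "(\<Union>n. F n) = \<Omega>"
    using ring by (auto simp: sigma_finite_delta_ring_def)
  show ?thesis
  proof
    show "(\<Union>i\<le>n. F i) \<in> R" for n using F by (intro R.finite_UN) auto
    show "incseq (\<lambda>n. \<Union>i\<le>n. F i)" 
      by (auto simp: incseq_def) (meson atMost_iff order_trans)
    show "(\<Union>n. \<Union>i\<le>n. F i) = \<Omega>" using F by auto
  qed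
qed

text \<open>A convergent series with equal terms has vanishing terms. This value allows finite
  families to be padded with empty sets, as additivity is assumed for sequences.\<close>

lemma \<Lambda>_empty: "AE \<omega> in M. \<Lambda> {} \<omega> = 0"
proof -
  have "AE \<omega> in M. (\<lambda>n. \<Lambda> {} \<omega>) sums \<Lambda> {} \<omega>"
    using additive[of "\<lambda>_. {}"] by (auto simp: disjoint_family_on_def)
  then show ?thesis
  proof eventually_elim
    case (elim \<omega>)
    then have "(\<lambda>n::nat. \<Lambda> {} \<omega>) \<longlonglongrightarrow> 0" by (intro summable_LIMSEQ_zero) (auto simp: sums_iff)
    then show ?case by (simp add: LIMSEQ_const_iff)
  qed
qed

lemma \<Lambda>_finite_additive:
  fixes N :: nat
  assumes F: "\<And>i. i < N \<Longrightarrow> F i \<in> R" and disj: "disjoint_family_on F {..<N}"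
  shows "AE \<omega> in M. \<Lambda> (\<Union>i<N. F i) \<omega> = (\<Sum>i<N. \<Lambda> (F i) \<omega>)"
proof -
  define B where "B n = (if n < N then F n else {})" for n
  have B: "range B \<subseteq> R" "disjoint_family B" "(\<Union>n. B n) = (\<Union>i<N. F i)"
    using F disj by (auto simp: B_def disjoint_family_on_def)
  have "(\<Union>i<N. F i) \<in> R" by (intro R.finite_UN) (use F in auto)
  then have "AE \<omega> in M. (\<lambda>n. \<Lambda> (B n) \<omega>) sums \<Lambda> (\<Union>i<N. F i) \<omega>"
    using additive[OF B(1,2)] by (simp add: B(3))
  then show ?thesis using \<Lambda>_empty
  proof eventually_elim
    case (elim \<omega>)
    have "(\<lambda>n. \<Lambda> (B n) \<omega>) sums (\<Sum>n<N. \<Lambda> (B n) \<omega>)"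
      using elim(2) by (intro sums_finite) (auto simp: B_def)
    then have "\<Lambda> (\<Union>i<N. F i) \<omega> = (\<Sum>n<N. \<Lambda> (B n) \<omega>)" using elim(1) sums_unique2 by blast
    then show ?case by (simp add: B_def)
  qed
qed

lemma \<Lambda>_finite_additive_set:
  assumes I: "finite I" and F: "\<And>i. i \<in> I \<Longrightarrow> F i \<in> R" and disj: "disjoint_family_on F I"
  shows "AE \<omega> in M. \<Lambda> (\<Union>i\<in>I. F i) \<omega> = (\<Sum>i\<in>I. \<Lambda> (F i) \<omega>)"
proof -
  obtain b where b: "bij_betw b {..<card I} I"
    using ex_bij_betw_nat_finite[OF I] by (auto simp: atLeast0LessThan)
  have "AE \<omega> in M. \<Lambda> (\<Union>i<card I. F (b i)) \<omega> = (\<Sum>i<card I. \<Lambda> (F (b i)) \<omega>)"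
  proof (rule \<Lambda>_finite_additive)
    show "F (b i) \<in> R" if "i < card I" for i
      using F bij_betwE[OF b] that by auto
    show "disjoint_family_on (\<lambda>i. F (b i)) {..<card I}"
      by (rule disjoint_family_on_reindex[OF disj b])
  qed
  moreover have "\<Union> (F ` b ` {..<card I}) = (\<Union>i\<in>I. F i)"
    by (simp only: bij_betw_imp_surj_on[OF b])
  moreover have "(\<Sum>i<card I. \<Lambda> (F (b i)) \<omega>) = (\<Sum>i\<in>I. \<Lambda> (F i) \<omega>)" for \<omega>
    by (rule sum.reindex_bij_betw[OF b])
  ultimately show ?thesis by (simp add: image_image)
qed

end

text \<open>The atoms of the algebra generated by finitely many sets turn a simple function into one
  with disjoint sets; the values of the integral follow by finite additivity.\<close>

definition atom :: "'s set list \<Rightarrow> nat set \<Rightarrow> 's set" where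
  "atom Bs I = {s. \<forall>i<length Bs. s \<in> Bs ! i \<longleftrightarrow> i \<in> I}"

lemma disjoint_atoms: "disjoint_family_on (atom Bs) (Pow {..<length Bs})"
  unfolding disjoint_family_on_def atom_def by blast

lemma nth_eq_Union_atoms:
  assumes "i < length Bs" shows "Bs ! i = (\<Union>I\<in>{I\<in>Pow {..<length Bs}. i \<in> I}. atom Bs I)"
proof -
  have "s \<in> (\<Union>I\<in>{I\<in>Pow {..<length Bs}. i \<in> I}. atom Bs I)" if "s \<in> Bs ! i" for s
    using that assms
    by (auto simp: atom_def intro!: exI[of _ "{j. j < length Bs \<and> s \<in> Bs ! j}"])
  then show ?thesis using assms by (auto simp: atom_def)
qed

lemma nth_snd_in_R: "snd ` set h \<subseteq> R \<Longrightarrow> i < length h \<Longrightarrow> snd (h ! i) \<in> R"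
  by (meson image_subset_iff nth_mem)

lemma simple_fun_conv_nth: "simple_fun h s = (\<Sum>i<length h. fst (h ! i) * indicator (snd (h ! i)) s)"
  unfolding simple_fun_def by (simp add: sum_list_sum_nth case_prod_beta atLeast0LessThan)

lemma simple_integral_conv_nth:
  "simple_integral \<Lambda> h A \<omega> = (\<Sum>i<length h. fst (h ! i) * \<Lambda> (snd (h ! i) \<inter> A) \<omega>)"
  unfolding simple_integral_def by (simp add: sum_list_sum_nth case_prod_beta atLeast0LessThan)

context centered_levy_characteristics
begin

lemma atom_in_R:
  assumes Bs: "set Bs \<subseteq> R" and I: "I \<subseteq> {..<length Bs}" "I \<noteq> {}"
  shows "atom Bs I \<in> R"
proof -
  have fin: "finite I" using I finite_subset by blast
  have nth: "Bs ! i \<in> R" if "i < length Bs" for i using Bs that by auto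
  have "(\<Inter>i\<in>I. Bs ! i) \<in> R" using fin I nth by (intro R.finite_INT) auto
  moreover have "(\<Union>i\<in>{..<length Bs} - I. Bs ! i) \<in> R" using nth by (intro R.finite_UN) auto
  moreover have "atom Bs I = (\<Inter>i\<in>I. Bs ! i) - (\<Union>i\<in>{..<length Bs} - I. Bs ! i)"
    using I by (auto simp: atom_def)
  ultimately show ?thesis by auto
qed

lemma simple_fun_disjoint_repr:
  assumes h: "snd ` set h \<subseteq> R"
  obtains N :: nat and c :: "nat \<Rightarrow> real" and F :: "nat \<Rightarrow> 's set"
  where "\<And>k. F k \<in> R" "disjoint_family F"
    "\<And>s. simple_fun h s = (\<Sum>k<N. c k * indicator (F k) s)"
    "AE \<omega> in M. simple_integral \<Lambda> h \<Omega> \<omega> = (\<Sum>k<N. c k * \<Lambda> (F k) \<omega>)"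
proof -
  define Bs where "Bs = map snd h"
  define n where "n = length h"
  have Bs: "set Bs \<subseteq> R" "length Bs = n" "\<And>i. i < n \<Longrightarrow> Bs ! i = snd (h ! i)"
    using h by (auto simp: Bs_def n_def)
  \<comment> \<open>The empty index set is left out: its atom is the complement of all the sets,
    which need not belong to R.\<close>
  define P where "P = Pow {..<n} - {{}}"
  have P: "finite P" by (auto simp: P_def)
  define a where "a I = (\<Sum>i\<in>I. fst (h ! i))" for I
  \<comment> \<open>For arbitrary x, because it is applied to the indicators of the atoms and again
    to their random measures.\<close>
  have swap: "(\<Sum>i<n. fst (h ! i) * (\<Sum>I\<in>{I\<in>P. i \<in> I}. x I)) = (\<Sum>I\<in>P. a I * x I)" for x :: "nat set \<Rightarrow> real"
  proof -
    have "(\<Sum>i<n. fst (h ! i) * (\<Sum>I\<in>{I\<in>P. i \<in> I}. x I)) = (\<Sum>i<n. \<Sum>I\<in>P. if i \<in> I then fst (h ! i) * x I else 0)"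
      using P by (auto simp: sum_distrib_left sum.inter_filter intro!: sum.cong)
    also have "\<dots> = (\<Sum>I\<in>P. \<Sum>i<n. if i \<in> I then fst (h ! i) * x I else 0)"
      by (rule sum.swap)
    also have "\<dots> = (\<Sum>I\<in>P. \<Sum>i\<in>I. fst (h ! i) * x I)"
    proof (rule sum.cong[OF refl])
      fix I assume "I \<in> P"
      then have "{i\<in>{..<n}. i \<in> I} = I" by (auto simp: P_def)
      then show "(\<Sum>i<n. if i \<in> I then fst (h ! i) * x I else 0) = (\<Sum>i\<in>I. fst (h ! i) * x I)"
        using sum.inter_filter[of "{..<n}" "\<lambda>i. fst (h ! i) * x I" "\<lambda>i. i \<in> I"] by simp
    qed
    finally show ?thesis by (simp add: a_def sum_distrib_right)
  qed
  have U: "snd (h ! i) = (\<Union>I\<in>{I\<in>P. i \<in> I}. atom Bs I)" if "i < n" for i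
    using nth_eq_Union_atoms[of i Bs] that Bs unfolding P_def by auto
  have disj: "disjoint_family_on (atom Bs) P"
    using disjoint_atoms[of Bs] Bs by (auto simp: P_def disjoint_family_on_def)
  have atR: "atom Bs I \<in> R" if "I \<in> P" for I
    using atom_in_R[OF Bs(1), of I] that Bs(2) by (auto simp: P_def)
  have fun_eq: "simple_fun h s = (\<Sum>I\<in>P. a I * indicator (atom Bs I) s)" for s
  proof -
    have "indicator (snd (h ! i)) s = (\<Sum>I\<in>{I\<in>P. i \<in> I}. indicator (atom Bs I) s :: real)" if "i < n" for i
      unfolding U[OF that] using P disj
      by (intro indicator_UN_disjoint) (auto simp: disjoint_family_on_def)
    then show ?thesis
      unfolding simple_fun_conv_nth n_def[symmetric] by (simp add: swap)
  qed
  have "AE \<omega> in M. \<forall>i\<in>{..<n}. \<Lambda> (snd (h ! i)) \<omega> = (\<Sum>I\<in>{I\<in>P. i \<in> I}. \<Lambda> (atom Bs I) \<omega>)"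
  proof (rule AE_finite_allI)
    fix i assume "i \<in> {..<n}"
    then show "AE \<omega> in M. \<Lambda> (snd (h ! i)) \<omega> = (\<Sum>I\<in>{I\<in>P. i \<in> I}. \<Lambda> (atom Bs I) \<omega>)"
      using \<Lambda>_finite_additive_set[of "{I\<in>P. i \<in> I}" "atom Bs"] P atR disj U[of i]
      by (auto simp: disjoint_family_on_def)
  qed auto
  then have int_eq: "AE \<omega> in M. simple_integral \<Lambda> h \<Omega> \<omega> = (\<Sum>I\<in>P. a I * \<Lambda> (atom Bs I) \<omega>)"
  proof eventually_elim
    case (elim \<omega>)
    have "snd (h ! i) \<inter> \<Omega> = snd (h ! i)" if "i < n" for i
      using h that nth_mem[of i h] R.space_closed unfolding n_def by (metis R.Int_space_eq2 image_subset_iff)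
    then show ?case using elim
      unfolding simple_integral_conv_nth n_def[symmetric] by (simp add: swap)
  qed
  obtain b where b: "bij_betw b {..<card P} P"
    using ex_bij_betw_nat_finite[OF P] by (auto simp: atLeast0LessThan)
  show ?thesis
  proof
    \<comment> \<open>A full sequence, padded by empty sets, since independence is assumed for
      disjoint sequences.\<close>
    show "(if k < card P then atom Bs (b k) else {}) \<in> R" for k
      using atR bij_betwE[OF b] by auto
    show "disjoint_family (\<lambda>k. if k < card P then atom Bs (b k) else {})"
      using disjoint_family_on_reindex[OF disj b] by (auto simp: disjoint_family_on_def)
    show "simple_fun h s = (\<Sum>k<card P. a (b k) * indicator (if k < card P then atom Bs (b k) else {}) s)" for s
      unfolding fun_eq sum.reindex_bij_betw[OF b, symmetric] by simp
    show "AE \<omega> in M. simple_integral \<Lambda> h \<Omega> \<omega> = (\<Sum>k<card P. a (b k) * \<Lambda> (if k < card P then atom Bs (b k) else {}) \<omega>)"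
      using int_eq unfolding sum.reindex_bij_betw[OF b, symmetric] by simp
  qed
qed

lemma simple_integral_measurable [measurable]:
  assumes "snd ` set h \<subseteq> R" "A \<in> sets m"
  shows "simple_integral \<Lambda> h A \<in> borel_measurable M"
proof -
  have "snd (h ! i) \<inter> A \<in> R" if "i < length h" for i
    using assms(2) nth_snd_in_R[OF assms(1) that] R_trace[of A "snd (h ! i)"] by (simp add: Int_commute)
  then have "(\<lambda>\<omega>. \<Sum>i<length h. fst (h ! i) * \<Lambda> (snd (h ! i) \<inter> A) \<omega>) \<in> borel_measurable M"
    by (intro borel_measurable_sum borel_measurable_times borel_measurable_const random_variable) auto
  then show ?thesis by (simp add: simple_integral_conv_nth[abs_def])
qed

lemma simple_integral_integrable:
  assumes "snd ` set h \<subseteq> R" "A \<in> sets m"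
  shows "integrable M (simple_integral \<Lambda> h A)"
proof -
  have "snd (h ! i) \<inter> A \<in> R" if "i < length h" for i
    using assms(2) nth_snd_in_R[OF assms(1) that] R_trace[of A "snd (h ! i)"] by (simp add: Int_commute)
  then have "integrable M (\<lambda>\<omega>. \<Sum>i<length h. fst (h ! i) * \<Lambda> (snd (h ! i) \<inter> A) \<omega>)"
    by (intro Bochner_Integration.integrable_sum integrable_mult_right integrable) auto
  then show ?thesis by (simp add: simple_integral_conv_nth[abs_def])
qed

lemma simple_fun_measurable [measurable]:
  assumes "snd ` set h \<subseteq> R" shows "simple_fun h \<in> borel_measurable m"
proof -
  have "snd (h ! i) \<in> sets m" if "i < length h" for i
    using nth_snd_in_R[OF assms that] by (rule R_sub_sets)
  then have "(\<lambda>s. \<Sum>i<length h. fst (h ! i) * indicator (snd (h ! i)) s) \<in> borel_measurable m"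
    by (intro borel_measurable_sum borel_measurable_times borel_measurable_const borel_measurable_indicator) auto
  then show ?thesis by (simp add: simple_fun_conv_nth[abs_def])
qed

end

lemma simple_fun_Nil [simp]: "simple_fun [] s = 0"
  by (simp add: simple_fun_def)

lemma simple_fun_Cons [simp]: "simple_fun ((a, B) # h) s = a * indicator B s + simple_fun h s"
  by (simp add: simple_fun_def)

lemma simple_fun_append [simp]: "simple_fun (h @ h') s = simple_fun h s + simple_fun h' s"
  by (simp add: simple_fun_def)

lemma simple_integral_Nil [simp]: "simple_integral \<Lambda> [] A \<omega> = 0"
  by (simp add: simple_integral_def)

lemma simple_integral_Cons [simp]:
  "simple_integral \<Lambda> ((a, B) # h) A \<omega> = a * \<Lambda> (B \<inter> A) \<omega> + simple_integral \<Lambda> h A \<omega>"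
  by (simp add: simple_integral_def)

lemma simple_integral_append [simp]:
  "simple_integral \<Lambda> (h @ h') A \<omega> = simple_integral \<Lambda> h A \<omega> + simple_integral \<Lambda> h' A \<omega>"
  by (simp add: simple_integral_def)

text \<open>Linear operations act on representations, as the integral is defined from a list and not
  from the function it represents. The identities for the integral then hold at every \<omega>, not
  merely almost surely.\<close>

definition simple_scale :: "real \<Rightarrow> (real \<times> 's set) list \<Rightarrow> (real \<times> 's set) list" where
  "simple_scale c h = map (\<lambda>(a, B). (c * a, B)) h"

lemma snd_simple_scale [simp]: "snd ` set (simple_scale c h) = snd ` set h"
  by (force simp: simple_scale_def)

lemma simple_fun_scale [simp]: "simple_fun (simple_scale c h) s = c * simple_fun h s"
  by (induction h) (auto simp: simple_scale_def distrib_left)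

lemma simple_integral_scale [simp]:
  "simple_integral \<Lambda> (simple_scale c h) A \<omega> = c * simple_integral \<Lambda> h A \<omega>"
  by (induction h) (auto simp: simple_scale_def distrib_left)

definition simple_restrict :: "'s set \<Rightarrow> (real \<times> 's set) list \<Rightarrow> (real \<times> 's set) list" where
  "simple_restrict A h = map (\<lambda>(a, B). (a, B \<inter> A)) h"

lemma simple_fun_restrict [simp]: "simple_fun (simple_restrict A h) s = simple_fun h s * indicator A s"
  by (induction h) (auto simp: simple_restrict_def distrib_right indicator_inter_arith)

lemma simple_integral_restrict [simp]:
  "simple_integral \<Lambda> (simple_restrict A h) B \<omega> = simple_integral \<Lambda> h (A \<inter> B) \<omega>"
  by (induction h) (auto simp: simple_restrict_def Int_assoc)

lemma (in centered_levy_characteristics) snd_simple_restrict: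
  assumes "snd ` set h \<subseteq> R" "A \<in> sets m"
  shows "snd ` set (simple_restrict A h) \<subseteq> R"
proof -
  have "B \<inter> A \<in> R" if "(a, B) \<in> set h" for a B
    using R_trace[of A B] that assms by (fastforce simp: Int_commute)
  then show ?thesis by (auto simp: simple_restrict_def)
qed

section \<open>First moments of integrals of simple functions\<close>

lemma sum_disjoint_indicator:
  fixes x :: "nat \<Rightarrow> 'a::semiring_1"
  assumes "disjoint_family F" "s \<in> F k" "k < N"
  shows "(\<Sum>i<N. x i * indicator (F i) s) = x k"
proof -
  have "x i * indicator (F i) s = (if i = k then x k else 0)" for i
    using assms by (auto simp: disjoint_family_on_def indicator_def)
  then show ?thesis using assms(3) by simp
qed

text \<open>\<open>1 - e^a cos b = (1 - e^a) + e^a (1 - cos b)\<close> separates modulus and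
  argument of \<open>exp z\<close>. The imaginary part appears squared, which is what lets it be
  summed against the weights \<open>2^j\<close>.\<close>

lemma one_minus_Re_exp_le:
  assumes "Re z \<le> 0" shows "1 - Re (exp z) \<le> - Re z + (Im z)\<^sup>2 / 2"
proof -
  have "1 - Re (exp z) = (1 - exp (Re z)) + exp (Re z) * (1 - cos (Im z))"
    by (simp add: Re_exp algebra_simps)
  also have "\<dots> \<le> - Re z + 1 * ((Im z)\<^sup>2 / 2)"
  proof (intro add_mono mult_mono)
    show "1 - exp (Re z) \<le> - Re z" using exp_ge_add_one_self[of "Re z"] by linarith
  qed (use assms one_minus_cos_le[of "Im z"] in auto)
  finally show ?thesis by simp
qed

text \<open>With a = Re z, \<open>1 - a \<le> e^-a\<close> yields
  \<open>- a e^a \<le> 1 - e^a\<close>, and \<open>e^a \<ge> Re (exp z) \<ge> 1/2\<close> costs the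
  factor 2. It recovers the exponent from the characteristic function.\<close>

lemma minus_Re_le_one_minus_Re_exp:
  assumes "Re z \<le> 0" "1 / 2 \<le> Re (exp z)" shows "- Re z \<le> 2 * (1 - Re (exp z))"
proof -
  have "Re (exp z) \<le> exp (Re z)" using complex_Re_le_cmod[of "exp z"] by (simp add: norm_exp_eq_Re)
  moreover have "exp (Re z) * (1 + (- Re z)) \<le> exp (Re z) * exp (- Re z)"
    using exp_ge_add_one_self[of "- Re z"] by (intro mult_left_mono) auto
  then have "exp (Re z) * (1 - Re z) \<le> 1" by (simp add: exp_minus)
  moreover have "(1 / 2) * (- Re z) \<le> exp (Re z) * (- Re z)"
    using assms \<open>Re (exp z) \<le> exp (Re z)\<close> by (intro mult_right_mono) linarith+
  ultimately show ?thesis by (simp add: algebra_simps)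
qed

context centered_levy_characteristics
begin

text \<open>Minus the real part of the exponent, written as an integral in [0, \<infinity>] so that
  sums and suprema over frequencies can be formed without integrability conditions. For the
  imaginary part a bound in the same form is enough.\<close>

definition re_part :: "real \<Rightarrow> 's \<Rightarrow> ennreal" where
  "re_part y s = ennreal (\<sigma>2 s * y\<^sup>2 / 2) + (\<integral>\<^sup>+u. ennreal (1 - cos (u * y)) \<partial>\<nu> s)"

definition im_part :: "real \<Rightarrow> 's \<Rightarrow> ennreal" where
  "im_part y s = (\<integral>\<^sup>+u. ennreal \<bar>sin (u * y) - u * y\<bar> \<partial>\<nu> s)"

lemma re_part_measurable [measurable]: "re_part y \<in> borel_measurable m"
  unfolding re_part_def by (intro borel_measurable_add nn_integral_\<nu>_measurable; measurable)

lemma im_part_measurable [measurable]: "im_part y \<in> borel_measurable m"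
  unfolding im_part_def by (intro nn_integral_\<nu>_measurable; measurable)

lemma levy_exponent_parts:
  assumes s: "s \<in> \<Omega>"
    and int: "integrable (\<nu> s) (\<lambda>u. iexp (y * u) - 1 - \<i> * complex_of_real (y * u))"
  shows "Re (levy_exponent \<sigma>2 \<nu> y s) \<le> 0"
    and "ennreal (- Re (levy_exponent \<sigma>2 \<nu> y s)) = re_part y s"
    and "ennreal \<bar>Im (levy_exponent \<sigma>2 \<nu> y s)\<bar> \<le> im_part y s"
proof -
  let ?g = "\<lambda>u. iexp (y * u) - 1 - \<i> * complex_of_real (y * u)"
  have Re_g: "Re (?g u) = - (1 - cos (u * y))" and Im_g: "Im (?g u) = sin (u * y) - u * y" for u
    by (simp_all add: Re_exp Im_exp mult.commute)
  have intR: "integrable (\<nu> s) (\<lambda>u. 1 - cos (u * y))"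
    using Bochner_Integration.integrable_minus[OF integrable_Re[OF int]] unfolding Re_g by simp
  have intI: "integrable (\<nu> s) (\<lambda>u. sin (u * y) - u * y)"
    using integrable_Im[OF int] unfolding Im_g by simp
  have Re_L: "- Re (levy_exponent \<sigma>2 \<nu> y s) = \<sigma>2 s * y\<^sup>2 / 2 + (\<integral>u. 1 - cos (u * y) \<partial>\<nu> s)"
  proof -
    have "(\<integral>u. - (1 - cos (u * y)) \<partial>\<nu> s) = - (\<integral>u. 1 - cos (u * y) \<partial>\<nu> s)"
      by (rule Bochner_Integration.integral_minus)
    then have "Re (\<integral>u. ?g u \<partial>\<nu> s) = - (\<integral>u. 1 - cos (u * y) \<partial>\<nu> s)"
      using integral_Re[OF int] unfolding Re_g by metis
    then show ?thesis unfolding levy_exponent_def plus_complex.sel by simp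
  qed
  have Im_L: "Im (levy_exponent \<sigma>2 \<nu> y s) = (\<integral>u. sin (u * y) - u * y \<partial>\<nu> s)"
    using integral_Im[OF int] unfolding Im_g levy_exponent_def by simp
  have nn: "0 \<le> (\<integral>u. 1 - cos (u * y) \<partial>\<nu> s)" "0 \<le> \<sigma>2 s * y\<^sup>2 / 2"
    using nonneg_\<sigma>2[OF s] by (auto intro!: integral_nonneg_AE)
  show "Re (levy_exponent \<sigma>2 \<nu> y s) \<le> 0" using nn Re_L by linarith
  show "ennreal (- Re (levy_exponent \<sigma>2 \<nu> y s)) = re_part y s"
    unfolding Re_L re_part_def using nn nn_integral_eq_integral[OF intR] by simp
  show "ennreal \<bar>Im (levy_exponent \<sigma>2 \<nu> y s)\<bar> \<le> im_part y s"
    unfolding Im_L im_part_def using integral_norm_bound_ennreal[OF intI] by simp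
qed

lemma set_integral_levy_exponent_parts:
  assumes A: "A \<in> R"
  shows "Re (set_lebesgue_integral m A (levy_exponent \<sigma>2 \<nu> y)) \<le> 0"
    and "ennreal (- Re (set_lebesgue_integral m A (levy_exponent \<sigma>2 \<nu> y))) =
      (\<integral>\<^sup>+s. re_part y s * indicator A s \<partial>m)"
    and "ennreal \<bar>Im (set_lebesgue_integral m A (levy_exponent \<sigma>2 \<nu> y))\<bar> \<le>
      (\<integral>\<^sup>+s. im_part y s * indicator A s \<partial>m)"
proof -
  let ?L = "levy_exponent \<sigma>2 \<nu> y"
  have int: "integrable m (\<lambda>s. indicator A s *\<^sub>R ?L s)"
    using outer_integrable[OF A, of y] by (simp add: set_integrable_def)
  have ae: "AE s in m. s \<in> A \<longrightarrow> Re (?L s) \<le> 0 \<and> ennreal (- Re (?L s)) = re_part y s \<and>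
      ennreal \<bar>Im (?L s)\<bar> \<le> im_part y s"
    using inner_integrable[OF A, of y] AE_space
  proof eventually_elim
    case (elim s)
    then show ?case using levy_exponent_parts[of s y] space_m by auto
  qed
  have Re_S: "- Re (set_lebesgue_integral m A ?L) = (\<integral>s. indicator A s * - Re (?L s) \<partial>m)"
    using integral_Re[OF int] unfolding set_lebesgue_integral_def by simp
  have Im_S: "Im (set_lebesgue_integral m A ?L) = (\<integral>s. indicator A s * Im (?L s) \<partial>m)"
    using integral_Im[OF int] unfolding set_lebesgue_integral_def by simp
  have intR: "integrable m (\<lambda>s. indicator A s * - Re (?L s))"
    using integrable_Re[OF int] by simp
  have intI: "integrable m (\<lambda>s. indicator A s * Im (?L s))"
    using integrable_Im[OF int] by simp
  have nnR: "AE s in m. 0 \<le> indicator A s * - Re (?L s)"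
    using ae by eventually_elim (auto simp: indicator_def)
  have "0 \<le> (\<integral>s. indicator A s * - Re (?L s) \<partial>m)"
    using nnR by (rule integral_nonneg_AE)
  then show "Re (set_lebesgue_integral m A ?L) \<le> 0" using Re_S by linarith
  have "ennreal (- Re (set_lebesgue_integral m A ?L)) = (\<integral>\<^sup>+s. ennreal (indicator A s * - Re (?L s)) \<partial>m)"
    unfolding Re_S using nn_integral_eq_integral[OF intR nnR] by simp
  also have "\<dots> = (\<integral>\<^sup>+s. re_part y s * indicator A s \<partial>m)"
    using ae by (intro nn_integral_cong_AE) (auto simp: indicator_def)
  finally show "ennreal (- Re (set_lebesgue_integral m A ?L)) = (\<integral>\<^sup>+s. re_part y s * indicator A s \<partial>m)" .
  have "ennreal \<bar>Im (set_lebesgue_integral m A ?L)\<bar> \<le> (\<integral>\<^sup>+s. ennreal (norm (indicator A s * Im (?L s))) \<partial>m)"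
    unfolding Im_S using integral_norm_bound_ennreal[OF intI] by simp
  also have "\<dots> \<le> (\<integral>\<^sup>+s. im_part y s * indicator A s \<partial>m)"
    using ae by (intro nn_integral_mono_AE) (auto simp: indicator_def)
  finally show "ennreal \<bar>Im (set_lebesgue_integral m A ?L)\<bar> \<le> (\<integral>\<^sup>+s. im_part y s * indicator A s \<partial>m)" .
qed

text \<open>The weights \<open>2^j\<close> make the jump parts at the frequencies
  \<open>y / 2^j\<close> add up to \<open>cos_kernel n (u y)\<close>. The Gaussian parts form a
  geometric series, since \<open>2^j (y / 2^j)^2 = y^2 / 2^j\<close>.\<close>

lemma sum_re_part:
  assumes s: "s \<in> \<Omega>"
  shows "(\<Sum>j<n. ennreal (2 ^ j) * re_part (y / 2 ^ j) s) =
    ennreal ((\<Sum>j<n. (1 / 2) ^ j) / 2 * (y\<^sup>2 * \<sigma>2 s)) + (\<integral>\<^sup>+u. ennreal (cos_kernel n (u * y)) \<partial>\<nu> s)"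
proof -
  note [simp] = measurable_\<nu>_iff[OF s]
  have "ennreal (2 ^ j) * re_part (y / 2 ^ j) s = ennreal ((1 / 2) ^ j * (y\<^sup>2 * \<sigma>2 s / 2)) +
      (\<integral>\<^sup>+u. ennreal (2 ^ j * (1 - cos (u * y / 2 ^ j))) \<partial>\<nu> s)" for j
  proof -
    have "ennreal (2 ^ j) * ennreal (\<sigma>2 s * (y / 2 ^ j)\<^sup>2 / 2) = ennreal ((1 / 2) ^ j * (y\<^sup>2 * \<sigma>2 s / 2))"
      by (subst ennreal_mult'[symmetric])
         (use nonneg_\<sigma>2[OF s] in \<open>auto simp: power_divide power2_eq_square field_simps\<close>)
    moreover have "ennreal (2 ^ j) * (\<integral>\<^sup>+u. ennreal (1 - cos (u * (y / 2 ^ j))) \<partial>\<nu> s) =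
        (\<integral>\<^sup>+u. ennreal (2 ^ j * (1 - cos (u * y / 2 ^ j))) \<partial>\<nu> s)"
      by (subst nn_integral_cmult[symmetric]) (auto simp: ennreal_mult)
    ultimately show ?thesis unfolding re_part_def by (simp only: distrib_left)
  qed
  then have "(\<Sum>j<n. ennreal (2 ^ j) * re_part (y / 2 ^ j) s) =
      (\<Sum>j<n. ennreal ((1 / 2) ^ j * (y\<^sup>2 * \<sigma>2 s / 2))) +
      (\<Sum>j<n. \<integral>\<^sup>+u. ennreal (2 ^ j * (1 - cos (u * y / 2 ^ j))) \<partial>\<nu> s)"
    by (simp add: sum.distrib)
  also have "(\<Sum>j<n. ennreal ((1 / 2) ^ j * (y\<^sup>2 * \<sigma>2 s / 2))) =
      ennreal ((\<Sum>j<n. (1 / 2) ^ j) / 2 * (y\<^sup>2 * \<sigma>2 s))"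
    using nonneg_\<sigma>2[OF s] by (subst sum_ennreal) (auto simp: sum_distrib_right sum_divide_distrib intro!: arg_cong[of _ _ ennreal] sum.cong)
  also have "(\<Sum>j<n. \<integral>\<^sup>+u. ennreal (2 ^ j * (1 - cos (u * y / 2 ^ j))) \<partial>\<nu> s) =
      (\<integral>\<^sup>+u. ennreal (cos_kernel n (u * y)) \<partial>\<nu> s)"
    unfolding cos_kernel_def by (subst nn_integral_sum[symmetric]) (auto simp: sum_ennreal)
  finally show ?thesis .
qed

lemma sum_re_part_le:
  assumes s: "s \<in> \<Omega>"
  shows "(\<Sum>j<n. ennreal (2 ^ j) * re_part (y / 2 ^ j) s) \<le> 5 * \<phi> y s"
proof -
  note [simp] = measurable_\<nu>_iff[OF s]
  have "(\<Sum>j<n. (1 / 2) ^ j) / 2 \<le> (1::real)" by (simp add: sum_gp_strict)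
  then have "(\<Sum>j<n. (1 / 2) ^ j) / 2 * (y\<^sup>2 * \<sigma>2 s) \<le> 5 * (y\<^sup>2 * \<sigma>2 s)"
    using nonneg_\<sigma>2[OF s] by (intro mult_right_mono) auto
  then have "(\<Sum>j<n. ennreal (2 ^ j) * re_part (y / 2 ^ j) s) \<le>
      ennreal (5 * (y\<^sup>2 * \<sigma>2 s)) + (\<integral>\<^sup>+u. ennreal (5 * orlicz_kernel (u * y)) \<partial>\<nu> s)"
    unfolding sum_re_part[OF s] by (intro add_mono nn_integral_mono ennreal_leI cos_kernel_le)
  also have "\<dots> = 5 * \<phi> y s"
    unfolding levy_phi_eq using nonneg_\<sigma>2[OF s]
    by (simp add: ennreal_mult distrib_left nn_integral_cmult)
  finally show ?thesis .
qed

text \<open>A supremum is unavoidable: \<open>cos_kernel n\<close> dominates the Orlicz kernel only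
  for \<open>|u y| < 2^n\<close>, and the jumps u are unbounded.\<close>

lemma phi_le_SUP_re_part:
  assumes s: "s \<in> \<Omega>"
  shows "\<phi> y s \<le> 16 * (SUP n. \<Sum>j<n. ennreal (2 ^ j) * re_part (y / 2 ^ j) s)"
proof -
  note [simp] = measurable_\<nu>_iff[OF s]
  let ?S = "\<lambda>n. \<Sum>j<n. ennreal (2 ^ j) * re_part (y / 2 ^ j) s"
  have "(\<integral>\<^sup>+u. ennreal (orlicz_kernel (u * y)) \<partial>\<nu> s) \<le> (\<integral>\<^sup>+u. 16 * (SUP n. ennreal (cos_kernel n (u * y))) \<partial>\<nu> s)"
  proof (rule nn_integral_mono)
    fix u
    obtain n where n: "\<bar>u * y\<bar> < 2 ^ n" using real_arch_pow[of 2] by auto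
    then have "\<bar>u * y\<bar> < 2 ^ Suc n" by simp
    then have "orlicz_kernel (u * y) \<le> 16 * cos_kernel (Suc n) (u * y)"
      by (intro orlicz_kernel_le_cos_kernel) auto
    then have "ennreal (orlicz_kernel (u * y)) \<le> 16 * ennreal (cos_kernel (Suc n) (u * y))"
      using ennreal_leI by (fastforce simp: ennreal_mult)
    also have "\<dots> \<le> 16 * (SUP n. ennreal (cos_kernel n (u * y)))"
      by (intro mult_left_mono SUP_upper) auto
    finally show "ennreal (orlicz_kernel (u * y)) \<le> 16 * (SUP n. ennreal (cos_kernel n (u * y)))" .
  qed
  also have "\<dots> = 16 * (SUP n. \<integral>\<^sup>+u. ennreal (cos_kernel n (u * y)) \<partial>\<nu> s)"
    by (subst nn_integral_cmult; (subst nn_integral_monotone_convergence_SUP)?)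
       (auto simp: incseq_def le_fun_def cos_kernel_mono ennreal_leI)
  finally have 2: "(\<integral>\<^sup>+u. ennreal (orlicz_kernel (u * y)) \<partial>\<nu> s) \<le> 16 * (SUP n. \<integral>\<^sup>+u. ennreal (cos_kernel n (u * y)) \<partial>\<nu> s)" .
  \<comment> \<open>The index is shifted by one because the empty sum at 0 would lose the Gaussian
    part.\<close>
  have a: "ennreal (1 / 2 * (y\<^sup>2 * \<sigma>2 s)) + (\<integral>\<^sup>+u. ennreal (cos_kernel n (u * y)) \<partial>\<nu> s) \<le> ?S (Suc n)" for n
  proof -
    have "1 \<le> (\<Sum>j<Suc n. (1 / 2) ^ j :: real)"
      by (subst sum.lessThan_Suc_shift) (simp add: sum_nonneg)
    then have "1 / 2 * (y\<^sup>2 * \<sigma>2 s) \<le> (\<Sum>j<Suc n. (1 / 2) ^ j) / 2 * (y\<^sup>2 * \<sigma>2 s)"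
      using nonneg_\<sigma>2[OF s] by (intro mult_right_mono) auto
    then show ?thesis unfolding sum_re_part[OF s]
      by (intro add_mono nn_integral_mono ennreal_leI cos_kernel_mono) auto
  qed
  have "\<phi> y s \<le> 16 * ennreal (1 / 2 * (y\<^sup>2 * \<sigma>2 s)) + 16 * (SUP n. \<integral>\<^sup>+u. ennreal (cos_kernel n (u * y)) \<partial>\<nu> s)"
    unfolding levy_phi_eq
  proof (rule add_mono[OF _ 2])
    have "ennreal (y\<^sup>2 * \<sigma>2 s) \<le> ennreal (16 * (1 / 2 * (y\<^sup>2 * \<sigma>2 s)))"
      using nonneg_\<sigma>2[OF s] by (intro ennreal_leI) simp
    then show "ennreal (y\<^sup>2 * \<sigma>2 s) \<le> 16 * ennreal (1 / 2 * (y\<^sup>2 * \<sigma>2 s))"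
      by (subst (asm) ennreal_mult') simp_all
  qed
  also have "\<dots> = 16 * (SUP n. ennreal (1 / 2 * (y\<^sup>2 * \<sigma>2 s)) + (\<integral>\<^sup>+u. ennreal (cos_kernel n (u * y)) \<partial>\<nu> s))"
    by (subst ennreal_SUP_add_right[symmetric]) (auto simp: distrib_left)
  also have "\<dots> \<le> 16 * (SUP n. ?S n)"
    by (intro mult_left_mono SUP_mono) (use a in blast, simp)
  finally show ?thesis .
qed

text \<open>Small jumps decay like \<open>4^-j\<close> by the Taylor remainder of the sine; large
  jumps only admit the linear bound and determine the rate \<open>2^-j\<close>.\<close>

lemma im_part_le:
  assumes s: "s \<in> \<Omega>"
  shows "im_part (y / 2 ^ j) s \<le> ennreal (2 / 2 ^ j) * \<phi> y s"
proof -
  define q :: real where "q = 2 / 2 ^ j"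
  have "0 \<le> q" by (simp add: q_def)
  have bound: "\<bar>sin (x / 2 ^ j) - x / 2 ^ j\<bar> \<le> q * orlicz_kernel x" for x :: real
  proof (cases "\<bar>x\<bar> \<le> 1")
    case True
    define p :: real where "p = 2 ^ j"
    have "1 \<le> p" by (simp add: p_def)
    then have "x\<^sup>2 * 1 \<le> x\<^sup>2 * (p * 4)" by (intro mult_left_mono) auto
    then have "x\<^sup>2 / p\<^sup>2 / 2 \<le> 2 / p * x\<^sup>2"
      using \<open>1 \<le> p\<close> by (simp add: divide_simps power2_eq_square)
    then show ?thesis using abs_sin_minus_self_le(1)[of "x / 2 ^ j"] True
      by (simp add: orlicz_kernel_def power_divide p_def q_def)
  next
    case False
    then have "2 / 2 ^ j * \<bar>x\<bar> \<le> 2 / 2 ^ j * orlicz_kernel x"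
      by (intro mult_left_mono) (auto simp: orlicz_kernel_def)
    then show ?thesis using abs_sin_minus_self_le(2)[of "x / 2 ^ j"] by (simp add: abs_divide q_def)
  qed
  have "im_part (y / 2 ^ j) s \<le> (\<integral>\<^sup>+u. ennreal (q * orlicz_kernel (u * y)) \<partial>\<nu> s)"
    unfolding im_part_def times_divide_eq_right by (intro nn_integral_mono ennreal_leI) (rule bound)
  also have "\<dots> = ennreal q * (\<integral>\<^sup>+u. ennreal (orlicz_kernel (u * y)) \<partial>\<nu> s)"
    using \<open>0 \<le> q\<close> by (simp add: ennreal_mult nn_integral_cmult measurable_\<nu>_iff[OF s])
  also have "\<dots> \<le> ennreal q * \<phi> y s"
    unfolding levy_phi_eq by (intro mult_left_mono) auto
  finally show ?thesis by (simp add: q_def)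
qed

section \<open>The modular, and the first moment bound\<close>

abbreviation simple_over_R :: "(real \<times> 's set) list \<Rightarrow> bool" where
  "simple_over_R h \<equiv> snd ` set h \<subseteq> R"

abbreviation sint :: "(real \<times> 's set) list \<Rightarrow> 's set \<Rightarrow> 'w \<Rightarrow> real" where
  "sint \<equiv> simple_integral \<Lambda>"

text \<open>The modular of the Musielak-Orlicz space. It is easier to handle than the norm, and by
  the dilation bounds the two have the same null sequences.\<close>

definition modular :: "('s \<Rightarrow> real) \<Rightarrow> ennreal" where
  "modular g = (\<integral>\<^sup>+s. \<phi> (g s) s \<partial>m)"

lemma modular_cong_AE: "AE s in m. g s = g' s \<Longrightarrow> modular g = modular g'"
  unfolding modular_def by (intro nn_integral_cong_AE) auto

lemma modular_mono: "(\<And>s. s \<in> \<Omega> \<Longrightarrow> \<bar>g s\<bar> \<le> \<bar>g' s\<bar>) \<Longrightarrow> modular g \<le> modular g'"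
  unfolding modular_def by (intro nn_integral_mono phi_mono) (auto simp: space_m)

lemma modular_0 [simp]: "modular (\<lambda>s. 0) = 0"
  by (simp add: modular_def)

lemma modular_add:
  assumes [measurable]: "g \<in> borel_measurable m" "g' \<in> borel_measurable m"
  shows "modular (\<lambda>s. g s + g' s) \<le> 4 * (modular g + modular g')"
proof -
  have "modular (\<lambda>s. g s + g' s) \<le> (\<integral>\<^sup>+s. 4 * (\<phi> (g s) s + \<phi> (g' s) s) \<partial>m)"
    unfolding modular_def by (intro nn_integral_mono phi_add) (auto simp: space_m)
  also have "\<dots> = 4 * (modular g + modular g')"
    unfolding modular_def by (simp add: nn_integral_cmult nn_integral_add)
  finally show ?thesis .
qed

lemma modular_uminus: "modular (\<lambda>s. - g s) = modular g"
  unfolding modular_def by (intro nn_integral_cong phi_uminus) (auto simp: space_m)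

lemma modular_diff:
  assumes [measurable]: "g \<in> borel_measurable m" "g' \<in> borel_measurable m"
  shows "modular (\<lambda>s. g s - g' s) \<le> 4 * (modular g + modular g')"
  using modular_add[of g "\<lambda>s. - g' s"] by (simp add: modular_uminus)

lemma modular_scale_ge_1:
  assumes [measurable]: "g \<in> borel_measurable m" and "1 \<le> c"
  shows "modular (\<lambda>s. c * g s) \<le> ennreal (c\<^sup>2) * modular g"
proof -
  have "modular (\<lambda>s. c * g s) \<le> (\<integral>\<^sup>+s. ennreal (c\<^sup>2) * \<phi> (g s) s \<partial>m)"
    unfolding modular_def using assms by (intro nn_integral_mono phi_scale_ge_1) (auto simp: space_m)
  also have "\<dots> = ennreal (c\<^sup>2) * modular g"
    unfolding modular_def by (simp add: nn_integral_cmult)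
  finally show ?thesis .
qed

lemma modular_scale_le_1:
  assumes [measurable]: "g \<in> borel_measurable m" and "0 \<le> c" "c \<le> 1"
  shows "modular (\<lambda>s. c * g s) \<le> ennreal c * modular g"
proof -
  have "modular (\<lambda>s. c * g s) \<le> (\<integral>\<^sup>+s. ennreal c * \<phi> (g s) s \<partial>m)"
    unfolding modular_def using assms by (intro nn_integral_mono phi_scale_le_1) (auto simp: space_m)
  also have "\<dots> = ennreal c * modular g"
    unfolding modular_def by (simp add: nn_integral_cmult)
  finally show ?thesis .
qed

text \<open>Growth is at most quadratic; without doubling, finiteness could be lost under
  dilation.\<close>

lemma modular_scale_finite:
  assumes g [measurable]: "g \<in> borel_measurable m" and fin: "modular g < \<infinity>"
  shows "modular (\<lambda>s. c * g s) < \<infinity>"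
proof -
  have "modular (\<lambda>s. c * g s) \<le> modular (\<lambda>s. max 1 \<bar>c\<bar> * g s)"
    by (intro modular_mono) (auto simp: abs_mult intro!: mult_right_mono)
  also have "\<dots> \<le> ennreal ((max 1 \<bar>c\<bar>)\<^sup>2) * modular g"
    by (intro modular_scale_ge_1) auto
  also have "\<dots> < \<infinity>" using fin by (simp add: ennreal_mult_less_top)
  finally show ?thesis .
qed

lemma modular_disjoint_sum:
  fixes F :: "nat \<Rightarrow> 's set"
  assumes F: "\<And>k. F k \<in> R" "disjoint_family F"
    and g: "\<And>s. g s = (\<Sum>k<N. c k * indicator (F k) s)"
  shows "modular g = (\<Sum>k<N. \<integral>\<^sup>+s. \<phi> (c k) s * indicator (F k) s \<partial>m)"
proof -
  have [measurable]: "F k \<in> sets m" for k using F(1) by (rule R_sub_sets)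
  have "\<phi> (g s) s = (\<Sum>k<N. \<phi> (c k) s * indicator (F k) s)" for s
  proof (cases "\<exists>k<N. s \<in> F k")
    case True
    then obtain k where k: "k < N" "s \<in> F k" by auto
    show ?thesis unfolding g sum_disjoint_indicator[OF F(2) k(2,1)] ..
  next
    case False
    then show ?thesis unfolding g by (auto simp: indicator_def intro!: sum.neutral)
  qed
  then have "modular g = (\<integral>\<^sup>+s. (\<Sum>k<N. \<phi> (c k) s * indicator (F k) s) \<partial>m)"
    unfolding modular_def by simp
  also have "\<dots> = (\<Sum>k<N. \<integral>\<^sup>+s. \<phi> (c k) s * indicator (F k) s \<partial>m)"
    by (rule nn_integral_sum) measurable
  finally show ?thesis .
qed

lemma characteristic_function_disjoint_sum:
  fixes F :: "nat \<Rightarrow> 's set"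
  assumes F: "\<And>k. F k \<in> R" "disjoint_family F"
  shows "(\<integral>\<omega>. iexp (y * (\<Sum>k<N. c k * \<Lambda> (F k) \<omega>)) \<partial>M) =
    exp (\<Sum>k<N. set_lebesgue_integral m (F k) (levy_exponent \<sigma>2 \<nu> (y * c k)))"
proof -
  have [measurable]: "\<Lambda> (F k) \<in> borel_measurable M" for k using F(1) by (rule random_variable)
  have "indep_vars (\<lambda>_. borel) (\<lambda>k. \<Lambda> (F k)) UNIV" using F by (intro indep) auto
  then have "indep_vars (\<lambda>_. borel) (\<lambda>k \<omega>. c k * \<Lambda> (F k) \<omega>) UNIV"
    by (rule indep_vars_compose2[where Y="\<lambda>k x. c k * x"]) auto
  then have "indep_vars (\<lambda>_. borel) (\<lambda>k \<omega>. c k * \<Lambda> (F k) \<omega>) {..<N}"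
    by (rule indep_vars_subset) auto
  from char_distr_sum[OF this, of y]
  have "(\<integral>\<omega>. iexp (y * (\<Sum>k<N. c k * \<Lambda> (F k) \<omega>)) \<partial>M) = (\<Prod>k<N. \<integral>\<omega>. iexp (y * (c k * \<Lambda> (F k) \<omega>)) \<partial>M)"
    unfolding char_def by (simp add: integral_distr)
  also have "\<dots> = (\<Prod>k<N. exp (set_lebesgue_integral m (F k) (levy_exponent \<sigma>2 \<nu> (y * c k))))"
    using characteristic_function[OF F(1), of "y * c k" k for k] by (simp add: mult.assoc)
  finally show ?thesis by (simp add: exp_sum)
qed

lemma expectation_cos_kernel:
  assumes [measurable]: "X \<in> borel_measurable M"
  shows "(\<integral>\<^sup>+\<omega>. ennreal (cos_kernel n (X \<omega>)) \<partial>M) =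
    (\<Sum>j<n. ennreal (2 ^ j * (1 - Re (\<integral>\<omega>. iexp ((1 / 2 ^ j) * X \<omega>) \<partial>M))))"
proof -
  have int: "integrable M (\<lambda>\<omega>. iexp (y * X \<omega>))" for y
    by (rule integrable_const_bound[where B=1]) auto
  have "Re (\<integral>\<omega>. iexp (y * X \<omega>) \<partial>M) = (\<integral>\<omega>. cos (y * X \<omega>) \<partial>M)" for y
    using integral_Re[OF int, of y] by (simp add: Re_exp)
  moreover have "integrable M (\<lambda>\<omega>. cos (y * X \<omega>))" for y
    by (rule integrable_const_bound[where B=1]) auto
  ultimately have *: "ennreal (1 - Re (\<integral>\<omega>. iexp (y * X \<omega>) \<partial>M)) = (\<integral>\<^sup>+\<omega>. ennreal (1 - cos (y * X \<omega>)) \<partial>M)" for y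
    by (subst nn_integral_eq_integral) (auto simp: prob_space)
  have "(\<integral>\<^sup>+\<omega>. ennreal (cos_kernel n (X \<omega>)) \<partial>M) = (\<integral>\<^sup>+\<omega>. (\<Sum>j<n. ennreal (2 ^ j) * ennreal (1 - cos ((1 / 2 ^ j) * X \<omega>))) \<partial>M)"
    unfolding cos_kernel_def by (subst sum_ennreal[symmetric]) (auto simp: ennreal_mult)
  also have "\<dots> = (\<Sum>j<n. ennreal (2 ^ j) * (\<integral>\<^sup>+\<omega>. ennreal (1 - cos ((1 / 2 ^ j) * X \<omega>)) \<partial>M))"
    by (subst nn_integral_sum) (auto simp: nn_integral_cmult)
  also have "\<dots> = (\<Sum>j<n. ennreal (2 ^ j * (1 - Re (\<integral>\<omega>. iexp ((1 / 2 ^ j) * X \<omega>) \<partial>M))))"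
    unfolding *[symmetric] by (intro sum.cong refl ennreal_mult'[symmetric]) auto
  finally show ?thesis .
qed

lemma abs_le_SUP_cos_kernel: "ennreal \<bar>x\<bar> \<le> 1 + 8 * (SUP n. ennreal (cos_kernel n x))"
proof (cases "1 \<le> \<bar>x\<bar>")
  case True
  obtain n where "\<bar>x\<bar> < 2 ^ n" using real_arch_pow[of 2] by auto
  then have "ennreal \<bar>x\<bar> \<le> ennreal (8 * cos_kernel n x)"
    using True by (intro ennreal_leI abs_le_cos_kernel)
  also have "\<dots> = 8 * ennreal (cos_kernel n x)" by (simp add: ennreal_mult)
  also have "\<dots> \<le> 8 * (SUP n. ennreal (cos_kernel n x))" by (intro mult_left_mono SUP_upper) auto
  finally show ?thesis by (rule order_trans) simp
next
  case False
  then have "ennreal \<bar>x\<bar> \<le> 1" by (simp add: ennreal_le_1)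
  then show ?thesis by (rule order_trans) simp
qed

lemma expectation_abs_le_cos_kernel:
  assumes [measurable]: "X \<in> borel_measurable M"
    and K: "\<And>n. (\<integral>\<^sup>+\<omega>. ennreal (cos_kernel n (X \<omega>)) \<partial>M) \<le> K"
  shows "(\<integral>\<^sup>+\<omega>. ennreal \<bar>X \<omega>\<bar> \<partial>M) \<le> 1 + 8 * K"
proof -
  have "(\<integral>\<^sup>+\<omega>. ennreal \<bar>X \<omega>\<bar> \<partial>M) \<le> (\<integral>\<^sup>+\<omega>. 1 + 8 * (SUP n. ennreal (cos_kernel n (X \<omega>))) \<partial>M)"
    by (intro nn_integral_mono abs_le_SUP_cos_kernel)
  also have "\<dots> = 1 + 8 * (\<integral>\<^sup>+\<omega>. (SUP n. ennreal (cos_kernel n (X \<omega>))) \<partial>M)"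
    by (subst nn_integral_add) (auto simp: nn_integral_cmult emeasure_space_1)
  also have "(\<integral>\<^sup>+\<omega>. (SUP n. ennreal (cos_kernel n (X \<omega>))) \<partial>M) = (SUP n. \<integral>\<^sup>+\<omega>. ennreal (cos_kernel n (X \<omega>)) \<partial>M)"
    by (rule nn_integral_monotone_convergence_SUP)
       (auto simp: incseq_def le_fun_def cos_kernel_mono ennreal_leI)
  also have "\<dots> \<le> K" by (intro SUP_least K)
  finally show ?thesis by (simp add: add_left_mono mult_left_mono)
qed

text \<open>The constant is \<open>1 + 8 * 9\<close>. With \<open>- a j\<close> and
  \<open>\<plusminus> b j\<close> the real and imaginary parts of the exponent at frequency
  \<open>2^-j\<close>, the sum of \<open>2^j a j\<close> is at most five times the modular, and
  \<open>b j \<le> 2 / 2^j\<close> bounds the sum of \<open>2^j (b j)^2 / 2\<close> by 4. Together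
  they give 9 for the dyadic sum; the 1 accounts for values below 1 in modulus.\<close>

lemma simple_integral_first_moment:
  assumes h: "simple_over_R h" and mod: "modular (simple_fun h) \<le> 1"
  shows "(\<integral>\<^sup>+\<omega>. ennreal \<bar>sint h \<Omega> \<omega>\<bar> \<partial>M) \<le> 73"
proof -
  obtain N :: nat and c F where F: "\<And>k. F k \<in> R" "disjoint_family F"
    and fun_eq: "\<And>s. simple_fun h s = (\<Sum>k<N. c k * indicator (F k) s)"
    and int_eq: "AE \<omega> in M. sint h \<Omega> \<omega> = (\<Sum>k<N. c k * \<Lambda> (F k) \<omega>)"
    by (rule simple_fun_disjoint_repr[OF h]) (rule that)
  have [measurable]: "F k \<in> sets m" "\<Lambda> (F k) \<in> borel_measurable M" for k
    using F(1) by (auto intro: R_sub_sets random_variable)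
  define X where "X \<omega> = (\<Sum>k<N. c k * \<Lambda> (F k) \<omega>)" for \<omega>
  have [measurable]: "X \<in> borel_measurable M" unfolding X_def by measurable
  define L where "L j k = set_lebesgue_integral m (F k) (levy_exponent \<sigma>2 \<nu> ((1 / 2 ^ j) * c k))" for j :: nat and k
  define a where "a j = - Re (\<Sum>k<N. L j k)" for j
  define b where "b j = \<bar>Im (\<Sum>k<N. L j k)\<bar>" for j
  note L = set_integral_levy_exponent_parts[OF F(1)]
  have a_nonneg: "0 \<le> a j" for j
    unfolding a_def L_def using L(1) by (auto intro!: sum_nonpos)
  have a_eq: "ennreal (a j) = (\<Sum>k<N. \<integral>\<^sup>+s. re_part (c k / 2 ^ j) s * indicator (F k) s \<partial>m)" for j
  proof -
    have "ennreal (a j) = (\<Sum>k<N. ennreal (- Re (L j k)))"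
      using L(1) by (simp add: a_def L_def sum_negf[symmetric] del: sum_negf)
    then show ?thesis unfolding L_def L(2) by simp
  qed
  have mod_eq: "modular (simple_fun h) = (\<Sum>k<N. \<integral>\<^sup>+s. \<phi> (c k) s * indicator (F k) s \<partial>m)"
    using F fun_eq by (rule modular_disjoint_sum)
  have sum_a: "(\<Sum>j<n. ennreal (2 ^ j * a j)) \<le> 5" for n
  proof -
    have "(\<Sum>j<n. ennreal (2 ^ j * a j)) =
        (\<Sum>j<n. \<Sum>k<N. ennreal (2 ^ j) * (\<integral>\<^sup>+s. re_part (c k / 2 ^ j) s * indicator (F k) s \<partial>m))"
      by (simp add: ennreal_mult a_nonneg a_eq sum_distrib_left)
    also have "\<dots> = (\<Sum>k<N. \<Sum>j<n. \<integral>\<^sup>+s. ennreal (2 ^ j) * re_part (c k / 2 ^ j) s * indicator (F k) s \<partial>m)"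
      by (subst sum.swap) (simp add: nn_integral_cmult mult.assoc)
    also have "\<dots> = (\<Sum>k<N. \<integral>\<^sup>+s. (\<Sum>j<n. ennreal (2 ^ j) * re_part (c k / 2 ^ j) s) * indicator (F k) s \<partial>m)"
      unfolding sum_distrib_right by (intro sum.cong[OF refl] nn_integral_sum[symmetric]) measurable
    also have "\<dots> \<le> (\<Sum>k<N. \<integral>\<^sup>+s. 5 * (\<phi> (c k) s * indicator (F k) s) \<partial>m)"
      unfolding mult.assoc[symmetric]
      by (intro sum_mono nn_integral_mono mult_right_mono sum_re_part_le) (auto simp: space_m)
    also have "\<dots> = 5 * modular (simple_fun h)"
      by (simp add: mod_eq nn_integral_cmult sum_distrib_left)
    also have "\<dots> \<le> 5 * 1" using mod by (intro mult_left_mono) auto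
    finally show ?thesis by simp
  qed
  have b_le: "b j \<le> 2 / 2 ^ j" for j
  proof -
    have "b j \<le> (\<Sum>k<N. \<bar>Im (L j k)\<bar>)" unfolding b_def by (simp add: sum_abs)
    then have "ennreal (b j) \<le> (\<Sum>k<N. ennreal \<bar>Im (L j k)\<bar>)"
      by (simp add: ennreal_leI)
    also have "\<dots> \<le> (\<Sum>k<N. \<integral>\<^sup>+s. im_part (c k / 2 ^ j) s * indicator (F k) s \<partial>m)"
      unfolding L_def using L(3)[of k "(1 / 2 ^ j) * c k" for k] by (intro sum_mono) simp
    also have "\<dots> \<le> (\<Sum>k<N. \<integral>\<^sup>+s. ennreal (2 / 2 ^ j) * (\<phi> (c k) s * indicator (F k) s) \<partial>m)"
      unfolding mult.assoc[symmetric]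
      by (intro sum_mono nn_integral_mono mult_right_mono im_part_le) (auto simp: space_m)
    also have "\<dots> = ennreal (2 / 2 ^ j) * modular (simple_fun h)"
      by (simp add: mod_eq nn_integral_cmult sum_distrib_left)
    also have "\<dots> \<le> ennreal (2 / 2 ^ j) * 1" using mod by (intro mult_left_mono) auto
    finally show ?thesis by (simp add: ennreal_le_iff)
  qed
  have "(\<integral>\<^sup>+\<omega>. ennreal (cos_kernel n (X \<omega>)) \<partial>M) \<le> 9" for n
  proof -
    have "2 ^ j * (1 - Re (\<integral>\<omega>. iexp ((1 / 2 ^ j) * X \<omega>) \<partial>M)) \<le> 2 ^ j * a j + 2 * (1 / 2) ^ j" for j :: nat
    proof -
      have "(\<integral>\<omega>. iexp ((1 / 2 ^ j) * X \<omega>) \<partial>M) = exp (\<Sum>k<N. L j k)"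
        unfolding X_def L_def using F by (rule characteristic_function_disjoint_sum)
      then have "1 - Re (\<integral>\<omega>. iexp ((1 / 2 ^ j) * X \<omega>) \<partial>M) \<le> a j + (b j)\<^sup>2 / 2"
        using one_minus_Re_exp_le[of "\<Sum>k<N. L j k"] a_nonneg[of j] by (simp add: a_def b_def)
      also have "(b j)\<^sup>2 \<le> (2 / 2 ^ j)\<^sup>2" using b_le[of j] by (intro power_mono) (auto simp: b_def)
      finally have "2 ^ j * (1 - Re (\<integral>\<omega>. iexp ((1 / 2 ^ j) * X \<omega>) \<partial>M)) \<le> 2 ^ j * (a j + (2 / 2 ^ j)\<^sup>2 / 2)"
        by (intro mult_left_mono) auto
      also have "\<dots> = 2 ^ j * a j + 2 * (1 / 2) ^ j"
        by (simp add: distrib_left power_divide power2_eq_square)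
      finally show ?thesis .
    qed
    then have "(\<integral>\<^sup>+\<omega>. ennreal (cos_kernel n (X \<omega>)) \<partial>M) \<le> (\<Sum>j<n. ennreal (2 ^ j * a j + 2 * (1 / 2) ^ j))"
      unfolding expectation_cos_kernel[OF \<open>X \<in> borel_measurable M\<close>] by (intro sum_mono ennreal_leI)
    also have "\<dots> = (\<Sum>j<n. ennreal (2 ^ j * a j)) + (\<Sum>j<n. ennreal (2 * (1 / 2) ^ j))"
      using a_nonneg by (simp add: sum.distrib)
    also have "\<dots> \<le> 5 + 4"
    proof (rule add_mono[OF sum_a])
      have "(\<Sum>j<n. ennreal (2 * (1 / 2) ^ j)) = ennreal (2 * (\<Sum>j<n. (1 / 2) ^ j))"
        by (subst sum_ennreal) (auto simp: sum_distrib_left)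
      also have "\<dots> \<le> ennreal 4" by (intro ennreal_leI) (simp add: sum_gp_strict)
      finally show "(\<Sum>j<n. ennreal (2 * (1 / 2) ^ j)) \<le> 4" by simp
    qed
    finally show ?thesis by simp
  qed
  then have "(\<integral>\<^sup>+\<omega>. ennreal \<bar>X \<omega>\<bar> \<partial>M) \<le> 1 + 8 * 9"
    by (intro expectation_abs_le_cos_kernel) auto
  moreover have "(\<integral>\<^sup>+\<omega>. ennreal \<bar>sint h \<Omega> \<omega>\<bar> \<partial>M) = (\<integral>\<^sup>+\<omega>. ennreal \<bar>X \<omega>\<bar> \<partial>M)"
    using int_eq by (intro nn_integral_cong_AE) (auto simp: X_def)
  ultimately show ?thesis by simp
qed

text \<open>The existence of the first moment of \<open>\<Lambda> A\<close> bounds the large jumps: where the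
  characteristic function is at least \<open>1/2\<close>, the real part of its exponent is controlled by
  the characteristic function itself.\<close>

lemma nn_integral_phi_finite:
  assumes A: "A \<in> R" shows "(\<integral>\<^sup>+s. \<phi> y s * indicator A s \<partial>m) < \<infinity>"
proof -
  have [measurable]: "A \<in> sets m" "\<Lambda> A \<in> borel_measurable M"
    using A by (auto intro: R_sub_sets random_variable)
  \<comment> \<open>An upper bound for the expectation of every
    \<open>cos_kernel n (\<Lambda> A)\<close>, by \<open>cos_kernel_le_linear\<close>.\<close>
  define K where "K = 5 * (\<integral>\<omega>. \<bar>\<Lambda> A \<omega>\<bar> \<partial>M)"
  have K0: "0 \<le> K" by (simp add: K_def)
  \<comment> \<open>From j0 on, \<open>r j \<le> K\<close> forces the real part of the
    characteristic function at \<open>2^-j\<close> to be at least 1/2.\<close>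
  obtain j0 where j0: "2 * K < 2 ^ j0" using real_arch_pow[of 2] by auto
  define z where "z j = set_lebesgue_integral m A (levy_exponent \<sigma>2 \<nu> (1 / 2 ^ j))" for j :: nat
  define r where "r j = 2 ^ j * (1 - Re (exp (z j)))" for j
  note L = set_integral_levy_exponent_parts[OF A]
  have psi: "(\<integral>\<omega>. iexp ((1 / 2 ^ j) * \<Lambda> A \<omega>) \<partial>M) = exp (z j)" for j
    unfolding z_def by (rule characteristic_function[OF A])
  have r_nonneg: "0 \<le> r j" for j
  proof -
    have "Re (exp (z j)) \<le> exp (Re (z j))" using complex_Re_le_cmod[of "exp (z j)"] by (simp add: norm_exp_eq_Re)
    also have "\<dots> \<le> 1" using L(1) by (simp add: z_def)
    finally show ?thesis by (simp add: r_def)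
  qed
  have r_sum: "(\<Sum>j<n. r j) \<le> K" for n
  proof -
    have "ennreal (\<Sum>j<n. r j) = (\<integral>\<^sup>+\<omega>. ennreal (cos_kernel n (\<Lambda> A \<omega>)) \<partial>M)"
      unfolding expectation_cos_kernel[OF \<open>\<Lambda> A \<in> borel_measurable M\<close>] psi r_def[symmetric]
      using r_nonneg by simp
    also have "\<dots> \<le> (\<integral>\<^sup>+\<omega>. ennreal (5 * \<bar>\<Lambda> A \<omega>\<bar>) \<partial>M)"
      by (intro nn_integral_mono ennreal_leI cos_kernel_le_linear)
    also have "\<dots> = ennreal K"
      unfolding K_def using integrable[OF A] by (subst nn_integral_eq_integral) auto
    finally show ?thesis using K0 by simp
  qed
  have z_le: "2 ^ j * - Re (z j) \<le> 2 * r j" if "j0 \<le> j" for j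
  proof -
    have "r j \<le> (\<Sum>i<Suc j. r i)" using r_nonneg by (simp add: sum_nonneg)
    then have "r j \<le> K" using r_sum[of "Suc j"] by linarith
    moreover have "(2::real) ^ j0 \<le> 2 ^ j" using that by (simp add: power_increasing)
    ultimately have "2 * r j \<le> 2 ^ j" using j0 by linarith
    then have "1 / 2 \<le> Re (exp (z j))" by (simp add: r_def algebra_simps)
    then have "- Re (z j) \<le> 2 * (1 - Re (exp (z j)))"
      using L(1) by (intro minus_Re_le_one_minus_Re_exp) (simp_all add: z_def)
    then have "2 ^ j * - Re (z j) \<le> 2 ^ j * (2 * (1 - Re (exp (z j))))"
      by (intro mult_left_mono) auto
    then show ?thesis by (simp add: r_def algebra_simps)
  qed
  \<comment> \<open>The frequencies \<open>c / 2^j = 2^-(j0 + j)\<close> all lie in the range where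
    the exponent is controlled.\<close>
  define c :: real where "c = 1 / 2 ^ j0"
  have c: "0 < c" "c \<le> 1" by (auto simp: c_def)
  let ?S = "\<lambda>n s. \<Sum>j<n. ennreal (2 ^ j) * re_part (c / 2 ^ j) s"
  have S_le: "(\<integral>\<^sup>+s. ?S n s * indicator A s \<partial>m) \<le> ennreal (2 * K)" for n
  proof -
    have "(\<integral>\<^sup>+s. ?S n s * indicator A s \<partial>m) = (\<Sum>j<n. ennreal (2 ^ j) * (\<integral>\<^sup>+s. re_part (c / 2 ^ j) s * indicator A s \<partial>m))"
      by (simp add: sum_distrib_right nn_integral_sum nn_integral_cmult mult.assoc)
    also have "\<dots> = (\<Sum>j<n. ennreal (2 ^ j * - Re (z (j0 + j))))"
    proof (rule sum.cong[OF refl])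
      fix j
      have "c / 2 ^ j = 1 / 2 ^ (j0 + j)" by (simp add: c_def power_add)
      then show "ennreal (2 ^ j) * (\<integral>\<^sup>+s. re_part (c / 2 ^ j) s * indicator A s \<partial>m) = ennreal (2 ^ j * - Re (z (j0 + j)))"
        unfolding z_def by (simp only: L(2)[symmetric]) (simp only: ennreal_mult' zero_le_power zero_le_numeral)
    qed
    also have "\<dots> \<le> (\<Sum>j<n. ennreal (2 * r (j0 + j)))"
    proof (intro sum_mono ennreal_leI)
      fix j
      have "0 \<le> - Re (z (j0 + j))" using L(1) by (simp add: z_def)
      then have "1 * (2 ^ j * - Re (z (j0 + j))) \<le> 2 ^ j0 * (2 ^ j * - Re (z (j0 + j)))"
        by (intro mult_right_mono mult_nonneg_nonneg) auto
      then have "2 ^ j * - Re (z (j0 + j)) \<le> 2 ^ (j0 + j) * - Re (z (j0 + j))"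
        by (simp add: power_add mult.assoc)
      also have "\<dots> \<le> 2 * r (j0 + j)" by (rule z_le) simp
      finally show "2 ^ j * - Re (z (j0 + j)) \<le> 2 * r (j0 + j)" .
    qed
    also have "\<dots> = ennreal (2 * (\<Sum>j<n. r (j0 + j)))"
      using r_nonneg by (subst sum_ennreal) (auto simp: sum_distrib_left)
    also have "\<dots> \<le> ennreal (2 * K)"
    proof (intro ennreal_leI mult_left_mono)
      have "(\<Sum>j<n. r (j0 + j)) = (\<Sum>j\<in>{j0..<j0 + n}. r j)"
        using sum.shift_bounds_nat_ivl[of r 0 j0 n] by (simp add: atLeast0LessThan add.commute)
      also have "\<dots> \<le> (\<Sum>j<j0 + n. r j)" using r_nonneg by (intro sum_mono2) auto
      finally show "(\<Sum>j<n. r (j0 + j)) \<le> K" using r_sum[of "j0 + n"] by linarith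
    qed auto
    finally show ?thesis .
  qed
  have "(\<integral>\<^sup>+s. \<phi> c s * indicator A s \<partial>m) \<le> (\<integral>\<^sup>+s. 16 * (SUP n. ?S n s * indicator A s) \<partial>m)"
    by (intro nn_integral_mono)
       (auto simp: SUP_mult_right_ennreal[symmetric] mult.assoc[symmetric] space_m intro!: mult_right_mono phi_le_SUP_re_part)
  also have "\<dots> = 16 * (SUP n. \<integral>\<^sup>+s. ?S n s * indicator A s \<partial>m)"
    by (subst nn_integral_cmult; (subst nn_integral_monotone_convergence_SUP)?)
       (auto simp: incseq_def le_fun_def intro!: mult_right_mono sum_mono2)
  also have "\<dots> \<le> 16 * ennreal (2 * K)"
    by (intro mult_left_mono SUP_least S_le) auto
  finally have fin_c: "(\<integral>\<^sup>+s. \<phi> c s * indicator A s \<partial>m) < \<infinity>"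
    by (rule le_less_trans) (simp add: ennreal_mult_less_top)
  \<comment> \<open>Doubling carries the bound from the small argument c to an arbitrary y.\<close>
  have "modular (\<lambda>s. (y / c) * (c * indicator A s)) < \<infinity>"
  proof (rule modular_scale_finite)
    have "\<phi> (c * indicator A s) s = \<phi> c s * indicator A s" for s by (auto simp: indicator_def)
    then show "modular (\<lambda>s. c * indicator A s) < \<infinity>" using fin_c by (simp add: modular_def)
  qed measurable
  moreover have "\<phi> ((y / c) * (c * indicator A s)) s = \<phi> y s * indicator A s" for s
    using c by (auto simp: indicator_def)
  ultimately show ?thesis by (simp add: modular_def)
qed

end

section \<open>Convergence in mean and in probability\<close>

lemma tendsto_zero_ennrealI:
  fixes f :: "'a \<Rightarrow> ennreal"
  assumes "\<And>e::real. 0 < e \<Longrightarrow> eventually (\<lambda>x. f x \<le> ennreal e) F"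
  shows "(f \<longlongrightarrow> 0) F"
proof (rule order_tendstoI)
  fix a :: ennreal assume "0 < a"
  then obtain b where b: "0 < b" "b < a" using dense by blast
  then obtain e where e: "b = ennreal e" "0 \<le> e" by (cases b) auto
  then have "0 < e" using b by (cases "e = 0") auto
  from assms[OF this] show "eventually (\<lambda>x. f x < a) F"
    by eventually_elim (use b e in \<open>auto intro: le_less_trans\<close>)
qed auto

lemma tendsto_zero_ennrealD:
  fixes f :: "'a \<Rightarrow> ennreal"
  shows "(f \<longlongrightarrow> 0) F \<Longrightarrow> 0 < e \<Longrightarrow> eventually (\<lambda>x. f x < ennreal e) F"
  by (rule order_tendstoD) auto

lemma tendsto_zero_ennreal_mono:
  fixes f g :: "'a \<Rightarrow> ennreal"
  assumes "(g \<longlongrightarrow> 0) F" "eventually (\<lambda>x. f x \<le> g x) F"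
  shows "(f \<longlongrightarrow> 0) F"
  by (rule tendsto_sandwich[OF _ assms(2) tendsto_const assms(1)]) simp

lemma tendsto_zero_ennreal_cmult:
  fixes f :: "'a \<Rightarrow> ennreal"
  assumes "(f \<longlongrightarrow> 0) F" "c < \<infinity>" shows "((\<lambda>x. c * f x) \<longlongrightarrow> 0) F"
  using ennreal_tendsto_cmult[of c f 0 F] assms by simp

lemma tendsto_zero_ennreal_add:
  fixes f g :: "'a \<Rightarrow> ennreal"
  assumes "(f \<longlongrightarrow> 0) F" "(g \<longlongrightarrow> 0) F" shows "((\<lambda>x. f x + g x) \<longlongrightarrow> 0) F"
  using tendsto_add[OF assms] by simp

lemma suminf_ennreal_finite_imp_tendsto_zero:
  fixes f :: "nat \<Rightarrow> ennreal"
  assumes "(\<Sum>n. f n) < \<infinity>" shows "f \<longlonglongrightarrow> 0"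
proof -
  have "f n < \<infinity>" for n
    using assms sum_le_suminf[of f "{n}"] by (auto intro: le_less_trans simp: summableI)
  then have f: "f n = ennreal (enn2real (f n))" for n by (simp add: less_top)
  then have "(\<Sum>n. ennreal (enn2real (f n))) \<noteq> top" using assms by auto
  then have "summable (\<lambda>n. enn2real (f n))" by (rule summable_suminf_not_top[rotated]) simp
  then have "(\<lambda>n. enn2real (f n)) \<longlonglongrightarrow> 0" by (rule summable_LIMSEQ_zero)
  then have "(\<lambda>n. ennreal (enn2real (f n))) \<longlonglongrightarrow> 0" by (simp add: ennreal_tendsto_0_iff)
  then show ?thesis using f by simp
qed

text \<open>Values in [0, \<infinity>] keep integrability out of the estimates.\<close>

definition l1_dist :: "'w measure \<Rightarrow> ('w \<Rightarrow> real) \<Rightarrow> ('w \<Rightarrow> real) \<Rightarrow> ennreal" where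
  "l1_dist M X Y = (\<integral>\<^sup>+\<omega>. ennreal \<bar>X \<omega> - Y \<omega>\<bar> \<partial>M)"

lemma l1_dist_commute: "l1_dist M X Y = l1_dist M Y X"
  by (simp add: l1_dist_def abs_minus_commute)

lemma l1_dist_cong_AE:
  "AE \<omega> in M. X \<omega> = X' \<omega> \<Longrightarrow> AE \<omega> in M. Y \<omega> = Y' \<omega> \<Longrightarrow> l1_dist M X Y = l1_dist M X' Y'"
  unfolding l1_dist_def by (intro nn_integral_cong_AE) auto

lemma l1_dist_triangle:
  assumes [measurable]: "X \<in> borel_measurable M" "Y \<in> borel_measurable M" "Z \<in> borel_measurable M"
  shows "l1_dist M X Z \<le> l1_dist M X Y + l1_dist M Y Z"
proof -
  have "l1_dist M X Z \<le> (\<integral>\<^sup>+\<omega>. ennreal \<bar>X \<omega> - Y \<omega>\<bar> + ennreal \<bar>Y \<omega> - Z \<omega>\<bar> \<partial>M)"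
    unfolding l1_dist_def
    by (intro nn_integral_mono) (auto simp: ennreal_plus[symmetric] simp del: ennreal_plus intro!: ennreal_leI)
  also have "\<dots> = l1_dist M X Y + l1_dist M Y Z"
    unfolding l1_dist_def by (rule nn_integral_add) measurable
  finally show ?thesis .
qed

lemma l1_dist_zero_imp_AE_eq:
  assumes [measurable]: "X \<in> borel_measurable M" "Y \<in> borel_measurable M" and "l1_dist M X Y = 0"
  shows "AE \<omega> in M. X \<omega> = Y \<omega>"
proof -
  have "AE \<omega> in M. ennreal \<bar>X \<omega> - Y \<omega>\<bar> = 0"
    using assms(3) unfolding l1_dist_def by (subst (asm) nn_integral_0_iff_AE) auto
  then show ?thesis by eventually_elim (simp add: ennreal_eq_0_iff)
qed

lemma l1_dist_add:
  assumes [measurable]: "X \<in> borel_measurable M" "Y \<in> borel_measurable M"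
    "X' \<in> borel_measurable M" "Y' \<in> borel_measurable M"
  shows "l1_dist M (\<lambda>\<omega>. X \<omega> + X' \<omega>) (\<lambda>\<omega>. Y \<omega> + Y' \<omega>) \<le> l1_dist M X Y + l1_dist M X' Y'"
proof -
  have "l1_dist M (\<lambda>\<omega>. X \<omega> + X' \<omega>) (\<lambda>\<omega>. Y \<omega> + Y' \<omega>) \<le>
      (\<integral>\<^sup>+\<omega>. ennreal \<bar>X \<omega> - Y \<omega>\<bar> + ennreal \<bar>X' \<omega> - Y' \<omega>\<bar> \<partial>M)"
    unfolding l1_dist_def
    by (intro nn_integral_mono) (auto simp: ennreal_plus[symmetric] simp del: ennreal_plus intro!: ennreal_leI)
  also have "\<dots> = l1_dist M X Y + l1_dist M X' Y'"
    unfolding l1_dist_def by (rule nn_integral_add) measurable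
  finally show ?thesis .
qed

lemma l1_dist_scale:
  assumes [measurable]: "X \<in> borel_measurable M" "Y \<in> borel_measurable M"
  shows "l1_dist M (\<lambda>\<omega>. c * X \<omega>) (\<lambda>\<omega>. c * Y \<omega>) = ennreal \<bar>c\<bar> * l1_dist M X Y"
  unfolding l1_dist_def
  by (subst nn_integral_cmult[symmetric])
     (auto simp: ennreal_mult[symmetric] abs_mult[symmetric] right_diff_distrib)

text \<open>A Cauchy sequence in the mean has an almost everywhere convergent subsequence; Fatou's
  lemma carries the Cauchy bound over to its limit.\<close>

lemma L1_complete:
  fixes X :: "nat \<Rightarrow> 'w \<Rightarrow> real"
  assumes int: "\<And>n. integrable M (X n)"
    and cauchy: "\<And>e::real. 0 < e \<Longrightarrow> \<exists>N. \<forall>i\<ge>N. \<forall>j\<ge>N. l1_dist M (X i) (X j) < ennreal e"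
  obtains Z where "integrable M Z" "(\<lambda>n. l1_dist M (X n) Z) \<longlonglongrightarrow> 0"
proof -
  have [measurable]: "X n \<in> borel_measurable M" for n using int by auto
  have l1: "l1_dist M (X i) (X j) = ennreal (\<integral>\<omega>. norm (X i \<omega> - X j \<omega>) \<partial>M)" for i j
    unfolding l1_dist_def using int by (subst nn_integral_eq_integral) auto
  have "\<exists>N. \<forall>i\<ge>N. \<forall>j\<ge>N. (LINT \<omega>|M. norm (X i \<omega> - X j \<omega>)) < e" if "0 < e" for e
    using cauchy[OF that] unfolding l1 by (simp add: ennreal_less_iff)
  then obtain r where r: "strict_mono r" "AE \<omega> in M. Cauchy (\<lambda>i. X (r i) \<omega>)"
    using cauchy_L1_AE_cauchy_subseq[of M X] int by blast
  define Z where "Z \<omega> = lim (\<lambda>i. X (r i) \<omega>)" for \<omega>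
  have [measurable]: "Z \<in> borel_measurable M" unfolding Z_def by measurable
  have lim: "AE \<omega> in M. (\<lambda>i. X (r i) \<omega>) \<longlonglongrightarrow> Z \<omega>"
    using r(2) unfolding Z_def by eventually_elim (simp add: Cauchy_convergent_iff convergent_LIMSEQ_iff)
  have conv: "(\<lambda>n. l1_dist M (X n) Z) \<longlonglongrightarrow> 0"
  proof (rule tendsto_zero_ennrealI)
    fix e :: real assume "0 < e"
    from cauchy[OF this] obtain N where N: "\<And>i j. N \<le> i \<Longrightarrow> N \<le> j \<Longrightarrow> l1_dist M (X i) (X j) < ennreal e"
      by blast
    have "l1_dist M (X n) Z \<le> ennreal e" if "N \<le> n" for n
    proof -
      have "l1_dist M (X n) Z \<le> (\<integral>\<^sup>+\<omega>. liminf (\<lambda>i. ennreal \<bar>X n \<omega> - X (r i) \<omega>\<bar>) \<partial>M)"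
        unfolding l1_dist_def
      proof (intro nn_integral_mono_AE, use lim in eventually_elim)
        fix \<omega> assume "(\<lambda>i. X (r i) \<omega>) \<longlonglongrightarrow> Z \<omega>"
        then have "(\<lambda>i. ennreal \<bar>X n \<omega> - X (r i) \<omega>\<bar>) \<longlonglongrightarrow> ennreal \<bar>X n \<omega> - Z \<omega>\<bar>"
          by (intro tendsto_intros)
        then show "ennreal \<bar>X n \<omega> - Z \<omega>\<bar> \<le> liminf (\<lambda>i. ennreal \<bar>X n \<omega> - X (r i) \<omega>\<bar>)"
          using lim_imp_Liminf[OF trivial_limit_sequentially] by (metis order_refl)
      qed
      also have "\<dots> \<le> liminf (\<lambda>i. l1_dist M (X n) (X (r i)))"
        unfolding l1_dist_def by (rule nn_integral_liminf) measurable
      also have "\<dots> \<le> ennreal e"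
      proof (rule Liminf_le)
        show "\<forall>\<^sub>F i in sequentially. l1_dist M (X n) (X (r i)) \<le> ennreal e"
          using eventually_ge_at_top[of N]
        proof eventually_elim
          case (elim i)
          then have "N \<le> r i" using seq_suble[OF r(1), of i] by linarith
          then show ?case using N[OF that] by (simp add: less_imp_le)
        qed
      qed simp
      finally show ?thesis .
    qed
    then show "\<forall>\<^sub>F n in sequentially. l1_dist M (X n) Z \<le> ennreal e"
      by (auto simp: eventually_sequentially)
  qed
  obtain n where n: "l1_dist M (X n) Z < ennreal 1"
    using tendsto_zero_ennrealD[OF conv, of 1] by (auto simp: eventually_sequentially)
  have "integrable M (\<lambda>\<omega>. X n \<omega> - Z \<omega>)"
    using n unfolding l1_dist_def by (intro integrableI_bounded) (auto intro: less_trans)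
  then have "integrable M (\<lambda>\<omega>. X n \<omega> - (X n \<omega> - Z \<omega>))" by (rule Bochner_Integration.integrable_diff[OF int])
  moreover have "(\<lambda>\<omega>. X n \<omega> - (X n \<omega> - Z \<omega>)) = Z" by auto
  ultimately show ?thesis using conv that by metis
qed

text \<open>Summable distances give convergence without passing to a further subsequence. In
  \<open>joint_integral_limit\<close> such a subsequence would depend on x and spoil joint
  measurability.\<close>

lemma AE_tendsto_of_l1_summable:
  assumes [measurable]: "\<And>k. W k \<in> borel_measurable M" "Z \<in> borel_measurable M"
    and sum: "(\<Sum>k. l1_dist M (W k) Z) < \<infinity>"
  shows "AE \<omega> in M. (\<lambda>k. W k \<omega>) \<longlonglongrightarrow> Z \<omega>"
proof -
  have "(\<integral>\<^sup>+\<omega>. (\<Sum>k. ennreal \<bar>W k \<omega> - Z \<omega>\<bar>) \<partial>M) = (\<Sum>k. l1_dist M (W k) Z)"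
    unfolding l1_dist_def by (rule nn_integral_suminf) measurable
  then have "AE \<omega> in M. (\<Sum>k. ennreal \<bar>W k \<omega> - Z \<omega>\<bar>) \<noteq> \<infinity>"
    using sum by (intro nn_integral_PInf_AE) auto
  then show ?thesis
  proof eventually_elim
    case (elim \<omega>)
    then have "(\<lambda>k. ennreal \<bar>W k \<omega> - Z \<omega>\<bar>) \<longlonglongrightarrow> 0"
      by (intro suminf_ennreal_finite_imp_tendsto_zero) (simp add: less_top)
    then have "(\<lambda>k. \<bar>W k \<omega> - Z \<omega>\<bar>) \<longlonglongrightarrow> 0" by (simp add: ennreal_tendsto_0_iff)
    then have "(\<lambda>k. W k \<omega> - Z \<omega>) \<longlonglongrightarrow> 0" by (rule tendsto_rabs_zero_cancel)
    then show ?case by (simp add: LIM_zero_iff)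
  qed
qed

section \<open>Convergence in probability\<close>

context prob_space
begin

text \<open>Markov's inequality at each level.\<close>

lemma L1_imp_tendsto_in_probability:
  assumes [measurable]: "\<And>n. X n \<in> borel_measurable M" "Y \<in> borel_measurable M"
    and conv: "(\<lambda>n. l1_dist M (X n) Y) \<longlonglongrightarrow> 0"
  shows "tendsto_in_probability M X Y"
  unfolding tendsto_in_probability_def
proof (intro allI impI)
  fix e :: real assume e: "0 < e"
  have "emeasure M {\<omega> \<in> space M. \<bar>X n \<omega> - Y \<omega>\<bar> > e} \<le> ennreal (1 / e) * l1_dist M (X n) Y" for n
  proof -
    have "emeasure M {\<omega> \<in> space M. \<bar>X n \<omega> - Y \<omega>\<bar> > e} = (\<integral>\<^sup>+\<omega>. indicator {\<omega> \<in> space M. \<bar>X n \<omega> - Y \<omega>\<bar> > e} \<omega> \<partial>M)"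
      by simp
    also have "\<dots> \<le> (\<integral>\<^sup>+\<omega>. ennreal (1 / e) * ennreal \<bar>X n \<omega> - Y \<omega>\<bar> \<partial>M)"
    proof (rule nn_integral_mono)
      fix \<omega>
      show "indicator {\<omega> \<in> space M. \<bar>X n \<omega> - Y \<omega>\<bar> > e} \<omega> \<le> ennreal (1 / e) * ennreal \<bar>X n \<omega> - Y \<omega>\<bar>"
        using e by (auto simp: indicator_def ennreal_mult[symmetric] field_simps simp flip: ennreal_1 intro!: ennreal_leI)
    qed
    also have "\<dots> = ennreal (1 / e) * l1_dist M (X n) Y"
      unfolding l1_dist_def by (rule nn_integral_cmult) measurable
    finally show ?thesis .
  qed
  then have "(\<lambda>n. emeasure M {\<omega> \<in> space M. \<bar>X n \<omega> - Y \<omega>\<bar> > e}) \<longlonglongrightarrow> 0"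
    by (intro tendsto_zero_ennreal_mono[OF tendsto_zero_ennreal_cmult[OF conv, of "ennreal (1 / e)"]]) auto
  then show "(\<lambda>n. prob {\<omega> \<in> space M. \<bar>X n \<omega> - Y \<omega>\<bar> > e}) \<longlonglongrightarrow> 0"
    by (simp add: emeasure_eq_measure ennreal_tendsto_0_iff)
qed

lemma tendsto_in_probability_add:
  assumes [measurable]: "\<And>n. X n \<in> borel_measurable M" "Y \<in> borel_measurable M"
    "\<And>n. X' n \<in> borel_measurable M" "Y' \<in> borel_measurable M"
    and conv: "tendsto_in_probability M X Y" "tendsto_in_probability M X' Y'"
  shows "tendsto_in_probability M (\<lambda>n \<omega>. X n \<omega> + X' n \<omega>) (\<lambda>\<omega>. Y \<omega> + Y' \<omega>)"
  unfolding tendsto_in_probability_def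
proof (intro allI impI)
  fix e :: real assume e: "0 < e"
  have le: "prob {\<omega> \<in> space M. \<bar>X n \<omega> + X' n \<omega> - (Y \<omega> + Y' \<omega>)\<bar> > e} \<le>
      prob {\<omega> \<in> space M. \<bar>X n \<omega> - Y \<omega>\<bar> > e / 2} + prob {\<omega> \<in> space M. \<bar>X' n \<omega> - Y' \<omega>\<bar> > e / 2}" for n
  proof -
    have "prob {\<omega> \<in> space M. \<bar>X n \<omega> + X' n \<omega> - (Y \<omega> + Y' \<omega>)\<bar> > e} \<le>
        prob ({\<omega> \<in> space M. \<bar>X n \<omega> - Y \<omega>\<bar> > e / 2} \<union> {\<omega> \<in> space M. \<bar>X' n \<omega> - Y' \<omega>\<bar> > e / 2})"
      by (intro finite_measure_mono) (auto simp: abs_if split: if_splits)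
    also have "\<dots> \<le> prob {\<omega> \<in> space M. \<bar>X n \<omega> - Y \<omega>\<bar> > e / 2} + prob {\<omega> \<in> space M. \<bar>X' n \<omega> - Y' \<omega>\<bar> > e / 2}"
      by (intro measure_Un_le) measurable
    finally show ?thesis .
  qed
  have lim: "(\<lambda>n. prob {\<omega> \<in> space M. \<bar>X n \<omega> - Y \<omega>\<bar> > e / 2} + prob {\<omega> \<in> space M. \<bar>X' n \<omega> - Y' \<omega>\<bar> > e / 2}) \<longlonglongrightarrow> 0"
    using conv[unfolded tendsto_in_probability_def, rule_format, of "e / 2"] e
    by (intro tendsto_add_zero) (simp_all only: half_gt_zero)
  show "(\<lambda>n. prob {\<omega> \<in> space M. \<bar>X n \<omega> + X' n \<omega> - (Y \<omega> + Y' \<omega>)\<bar> > e}) \<longlonglongrightarrow> 0"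
    by (rule tendsto_sandwich[OF _ _ tendsto_const lim])
       (rule always_eventually allI measure_nonneg le)+
qed

lemma tendsto_in_probability_uminus:
  "tendsto_in_probability M X Y \<Longrightarrow> tendsto_in_probability M (\<lambda>n \<omega>. - X n \<omega>) (\<lambda>\<omega>. - Y \<omega>)"
  by (simp add: tendsto_in_probability_def abs_minus_commute)

lemma tendsto_in_probability_subseq:
  "tendsto_in_probability M X Y \<Longrightarrow> strict_mono r \<Longrightarrow> tendsto_in_probability M (\<lambda>n. X (r n)) Y"
  unfolding tendsto_in_probability_def using LIMSEQ_subseq_LIMSEQ unfolding o_def by fast

lemma tendsto_in_probability_cong_AE:
  assumes [measurable]: "\<And>n. X n \<in> borel_measurable M" "Y \<in> borel_measurable M"
    "\<And>n. X' n \<in> borel_measurable M" "Y' \<in> borel_measurable M"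
    and X: "\<And>n. AE \<omega> in M. X n \<omega> = X' n \<omega>" and Y: "AE \<omega> in M. Y \<omega> = Y' \<omega>"
    and conv: "tendsto_in_probability M X Y"
  shows "tendsto_in_probability M X' Y'"
proof -
  have "prob {\<omega> \<in> space M. \<bar>X n \<omega> - Y \<omega>\<bar> > e} = prob {\<omega> \<in> space M. \<bar>X' n \<omega> - Y' \<omega>\<bar> > e}" for n e
    using X[of n] Y by (intro finite_measure_eq_AE) auto
  then show ?thesis using conv by (simp add: tendsto_in_probability_def)
qed

lemma tendsto_in_probability_zero_unique:
  assumes [measurable]: "Y \<in> borel_measurable M" and conv: "tendsto_in_probability M (\<lambda>n \<omega>. 0) Y"
  shows "AE \<omega> in M. Y \<omega> = 0"
proof -
  have "AE \<omega> in M. \<not> \<bar>Y \<omega>\<bar> > 1 / real (Suc k)" for k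
  proof -
    have "0 < 1 / real (Suc k)" by simp
    then have "(\<lambda>n. prob {\<omega> \<in> space M. \<bar>0 - Y \<omega>\<bar> > 1 / real (Suc k)}) \<longlonglongrightarrow> 0"
      using conv unfolding tendsto_in_probability_def by blast
    then have "prob {\<omega> \<in> space M. \<bar>Y \<omega>\<bar> > 1 / real (Suc k)} = 0"
      by (simp add: LIMSEQ_const_iff)
    then show ?thesis by (subst (asm) prob_eq_0) auto
  qed
  then have "AE \<omega> in M. \<forall>k. \<not> \<bar>Y \<omega>\<bar> > 1 / real (Suc k)" by (simp add: AE_all_countable)
  then show ?thesis
  proof eventually_elim
    case (elim \<omega>)
    show ?case
    proof (rule ccontr)
      assume "Y \<omega> \<noteq> 0"
      then obtain k where "inverse (real (Suc k)) < \<bar>Y \<omega>\<bar>" using reals_Archimedean[of "\<bar>Y \<omega>\<bar>"] by auto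
      then show False using elim by (auto simp: inverse_eq_divide)
    qed
  qed
qed

lemma tendsto_in_probability_unique:
  assumes [measurable]: "\<And>n. X n \<in> borel_measurable M" "Y \<in> borel_measurable M" "Y' \<in> borel_measurable M"
    and "tendsto_in_probability M X Y" "tendsto_in_probability M X Y'"
  shows "AE \<omega> in M. Y \<omega> = Y' \<omega>"
proof -
  have "tendsto_in_probability M (\<lambda>n \<omega>. X n \<omega> + - X n \<omega>) (\<lambda>\<omega>. Y \<omega> + - Y' \<omega>)"
    using assms by (intro tendsto_in_probability_add tendsto_in_probability_uminus) auto
  then have "AE \<omega> in M. Y \<omega> + - Y' \<omega> = 0"
    by (intro tendsto_in_probability_zero_unique) auto
  then show ?thesis by eventually_elim simp
qed

end

lemma tendsto_zero_ennrealE: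
  fixes f :: "nat \<Rightarrow> ennreal"
  assumes "f \<longlonglongrightarrow> 0" "0 < (e::real)"
  obtains N where "\<And>n. N \<le> n \<Longrightarrow> f n < ennreal e"
  using tendsto_zero_ennrealD[OF assms] that by (auto simp: eventually_sequentially)

context centered_levy_characteristics
begin

abbreviation dist1 :: "('w \<Rightarrow> real) \<Rightarrow> ('w \<Rightarrow> real) \<Rightarrow> ennreal" where
  "dist1 \<equiv> l1_dist M"

section \<open>The integral as a continuous operator\<close>

text \<open>Integrability of the values of \<Lambda> enters here: it makes \<open>\<phi> 1\<close>
  integrable over each set of an exhaustion by R.\<close>

lemma AE_phi_finite: "AE s in m. \<phi> 1 s < \<infinity>"
proof -
  obtain E :: "nat \<Rightarrow> 's set" where E: "\<And>n. E n \<in> R" "incseq E" "(\<Union>n. E n) = \<Omega>"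
    by (rule R_exhaustion) (rule that)
  have "AE s in m. \<phi> 1 s * indicator (E n) s \<noteq> \<infinity>" for n
    using nn_integral_phi_finite[OF E(1), of 1 n] R_sub_sets[OF E(1)[of n]]
    by (intro nn_integral_PInf_AE) auto
  then have "AE s in m. \<forall>n. \<phi> 1 s * indicator (E n) s \<noteq> \<infinity>" by (simp add: AE_all_countable)
  with AE_space show ?thesis
  proof eventually_elim
    case (elim s)
    then obtain n where "s \<in> E n" using E(3) space_m by auto
    then show ?case using elim(2)[rule_format, of n] by (simp add: less_top)
  qed
qed

text \<open>If \<open>\<phi> 1 s = 0\<close>, then \<open>\<sigma>2 s = 0\<close> and
  \<open>\<nu> s\<close> lives on {0}, which a Levy measure does not charge. Positivity is what
  turns convergence of \<phi> into pointwise convergence of its argument.\<close>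

lemma AE_phi_pos: "AE s in m. 0 < \<phi> 1 s"
  using nondegenerate AE_space
proof eventually_elim
  case (elim s)
  then have s: "s \<in> \<Omega>" by (simp add: space_m)
  show ?case
  proof (rule ccontr)
    assume "\<not> 0 < \<phi> 1 s"
    then have "\<phi> 1 s = 0" by (simp add: zero_less_iff_neq_zero)
    then have \<sigma>: "ennreal (\<sigma>2 s) = 0" and "(\<integral>\<^sup>+u. ennreal (orlicz_kernel u) \<partial>\<nu> s) = 0"
      by (auto simp: levy_phi_eq)
    then have "AE u in \<nu> s. ennreal (orlicz_kernel u) = 0"
      by (subst (asm) nn_integral_0_iff_AE) (auto simp: measurable_\<nu>_iff[OF s])
    moreover have "AE u in \<nu> s. u \<noteq> 0"
      using levy_measure_\<nu>[OF s] by (intro AE_I[of _ _ "{0}"]) (auto simp: levy_measure_def)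
    ultimately have "AE u in \<nu> s. False"
      by eventually_elim (auto simp: orlicz_kernel_def split: if_splits)
    then have "\<nu> s = null_measure (\<nu> s)"
      by (intro measure_eqI) (auto simp: AE_iff_null null_sets_def intro: emeasure_eq_0[OF _ _ sets.sets_into_space])
    also have "\<dots> = null_measure borel" by (rule measure_eqI) (auto simp: sets_\<nu>[OF s])
    finally show False using elim \<sigma> nonneg_\<sigma>2[OF s] by (simp add: ennreal_eq_0_iff)
  qed
qed

lemma phi_tendsto_zero:
  assumes s: "s \<in> \<Omega>" "\<phi> 1 s < \<infinity>" and y: "y \<longlonglongrightarrow> 0"
  shows "(\<lambda>n. \<phi> (y n) s) \<longlonglongrightarrow> 0"
proof (rule tendsto_zero_ennreal_mono)
  have "(\<lambda>n. \<bar>y n\<bar>) \<longlonglongrightarrow> 0" using y by (rule tendsto_rabs_zero)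
  then have "(\<lambda>n. ennreal \<bar>y n\<bar>) \<longlonglongrightarrow> 0" by (simp add: ennreal_tendsto_0_iff)
  then show "(\<lambda>n. \<phi> 1 s * ennreal \<bar>y n\<bar>) \<longlonglongrightarrow> 0"
    using s by (intro tendsto_zero_ennreal_cmult) auto
  have "\<forall>\<^sub>F n in sequentially. \<bar>y n\<bar> < 1"
    using order_tendstoD(2)[OF \<open>(\<lambda>n. \<bar>y n\<bar>) \<longlonglongrightarrow> 0\<close>, of 1] by simp
  then show "\<forall>\<^sub>F n in sequentially. \<phi> (y n) s \<le> \<phi> 1 s * ennreal \<bar>y n\<bar>"
    by eventually_elim (use phi_le_linear[OF s(1)] in \<open>simp add: mult.commute\<close>)
qed

lemma phi_tendsto_zero_imp:
  assumes s: "s \<in> \<Omega>" "0 < \<phi> 1 s" and lim: "(\<lambda>n. \<phi> (y n) s) \<longlonglongrightarrow> 0"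
  shows "y \<longlonglongrightarrow> 0"
proof (rule LIMSEQ_I)
  fix r :: real assume "0 < r"
  define e where "e = min r 1"
  have e: "0 < e" "e \<le> 1" "e \<le> r" using \<open>0 < r\<close> by (auto simp: e_def)
  have "0 < ennreal (e\<^sup>2) * \<phi> 1 s" using e s by (simp add: ennreal_zero_less_mult_iff)
  also have "\<dots> \<le> \<phi> e s" using e by (intro phi_ge_square s) auto
  finally have "\<forall>\<^sub>F n in sequentially. \<phi> (y n) s < \<phi> e s" by (rule order_tendstoD(2)[OF lim])
  then obtain N where N: "\<And>n. N \<le> n \<Longrightarrow> \<phi> (y n) s < \<phi> e s" by (auto simp: eventually_sequentially)
  have "\<bar>y n\<bar> < r" if "N \<le> n" for n
  proof (rule ccontr)
    assume "\<not> \<bar>y n\<bar> < r"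
    then have "\<phi> e s \<le> \<phi> (y n) s" using e by (intro phi_mono s) auto
    then show False using N[OF that] by simp
  qed
  then show "\<exists>no. \<forall>n\<ge>no. norm (y n - 0) < r" by auto
qed

lemma modular_dominated_convergence:
  assumes [measurable]: "\<And>n. g n \<in> borel_measurable m" "G \<in> borel_measurable m"
    and fin: "modular G < \<infinity>" and dom: "\<And>n s. s \<in> \<Omega> \<Longrightarrow> \<bar>g n s\<bar> \<le> \<bar>G s\<bar>"
    and lim: "AE s in m. (\<lambda>n. g n s) \<longlonglongrightarrow> 0"
  shows "(\<lambda>n. modular (g n)) \<longlonglongrightarrow> 0"
proof -
  have "(\<lambda>n. \<integral>\<^sup>+s. \<phi> (g n s) s \<partial>m) \<longlonglongrightarrow> (\<integral>\<^sup>+s. 0 \<partial>m)"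
  proof (rule nn_integral_dominated_convergence[where w="\<lambda>s. \<phi> (G s) s"])
    show "AE s in m. \<phi> (g n s) s \<le> \<phi> (G s) s" for n
      using dom by (intro AE_I2 phi_mono) (auto simp: space_m)
    show "AE s in m. (\<lambda>n. \<phi> (g n s) s) \<longlonglongrightarrow> 0"
      using lim AE_phi_finite AE_space by eventually_elim (simp add: phi_tendsto_zero space_m)
  qed (use fin in \<open>simp_all add: modular_def\<close>)
  then show ?thesis by (simp add: modular_def)
qed

text \<open>Rescaling by 1/c reduces to modular at most 1. Restriction to A only decreases the
  modular, so one bound serves all measurable sets.\<close>

lemma simple_integral_abs_le:
  assumes h: "simple_over_R h" and A: "A \<in> sets m" and c: "0 < c"
    and mod: "modular (\<lambda>s. simple_fun h s / c) \<le> 1"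
  shows "dist1 (sint h A) (\<lambda>_. 0) \<le> ennreal (73 * c)"
proof -
  let ?h = "simple_scale (1 / c) (simple_restrict A h)"
  have h': "simple_over_R ?h" using snd_simple_restrict[OF h A] by simp
  have "modular (simple_fun ?h) \<le> modular (\<lambda>s. simple_fun h s / c)"
    by (intro modular_mono) (auto simp: indicator_def)
  then have "(\<integral>\<^sup>+\<omega>. ennreal \<bar>sint ?h \<Omega> \<omega>\<bar> \<partial>M) \<le> 73"
    using mod by (intro simple_integral_first_moment[OF h']) (rule order_trans)
  then have "ennreal c * (\<integral>\<^sup>+\<omega>. ennreal \<bar>sint ?h \<Omega> \<omega>\<bar> \<partial>M) \<le> ennreal c * 73"
    by (intro mult_left_mono) auto
  also have "ennreal c * (\<integral>\<^sup>+\<omega>. ennreal \<bar>sint ?h \<Omega> \<omega>\<bar> \<partial>M) =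
      (\<integral>\<^sup>+\<omega>. ennreal c * ennreal \<bar>sint ?h \<Omega> \<omega>\<bar> \<partial>M)"
    using h' sets.top[of m] unfolding space_m by (intro nn_integral_cmult[symmetric]) measurable
  also have "\<dots> = dist1 (sint h A) (\<lambda>_. 0)"
  proof -
    have "A \<inter> \<Omega> = A" using sets.sets_into_space[OF A] space_m by auto
    then show ?thesis
      unfolding l1_dist_def using c by (simp add: ennreal_mult[symmetric] abs_mult)
  qed
  finally show ?thesis using c by (simp add: ennreal_mult mult.commute)
qed

text \<open>Division by r \<le> 1 multiplies the modular by at most \<open>1 / r^2\<close>, so a
  modular below \<open>r^2\<close> acts like a norm below r.\<close>

lemma simple_integral_abs_le_sqrt:
  assumes h: "simple_over_R h" and A: "A \<in> sets m" and r: "0 < r" "r \<le> 1"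
    and mod: "modular (simple_fun h) \<le> ennreal (r\<^sup>2)"
  shows "dist1 (sint h A) (\<lambda>_. 0) \<le> ennreal (73 * r)"
proof (rule simple_integral_abs_le[OF h A r(1)])
  have [measurable]: "simple_fun h \<in> borel_measurable m" using h by measurable
  have "modular (\<lambda>s. (1 / r) * simple_fun h s) \<le> ennreal ((1 / r)\<^sup>2) * modular (simple_fun h)"
    using r by (intro modular_scale_ge_1) auto
  also have "\<dots> \<le> ennreal ((1 / r)\<^sup>2) * ennreal (r\<^sup>2)" using mod by (intro mult_left_mono) auto
  also have "\<dots> = 1" using r by (simp add: ennreal_mult[symmetric] power_divide)
  finally show "modular (\<lambda>s. simple_fun h s / r) \<le> 1" by simp
qed

lemma simple_integral_dist_le:
  assumes h: "simple_over_R h" "simple_over_R h'" and A: "A \<in> sets m" and r: "0 < r" "r \<le> 1"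
    and mod: "modular (\<lambda>s. simple_fun h s - simple_fun h' s) \<le> ennreal (r\<^sup>2)"
  shows "dist1 (sint h A) (sint h' A) \<le> ennreal (73 * r)"
proof -
  let ?d = "h @ simple_scale (- 1) h'"
  have "simple_fun ?d = (\<lambda>s. simple_fun h s - simple_fun h' s)" by (auto simp: fun_eq_iff)
  then have "dist1 (sint ?d A) (\<lambda>_. 0) \<le> ennreal (73 * r)"
    using h A r mod by (intro simple_integral_abs_le_sqrt) (auto simp: image_Un)
  then show ?thesis by (simp add: l1_dist_def)
qed

lemma simple_integral_L1_convergent:
  assumes h: "\<And>n. simple_over_R (h n)" and [measurable]: "g \<in> borel_measurable m"
    and lim: "(\<lambda>n. modular (\<lambda>s. simple_fun (h n) s - g s)) \<longlonglongrightarrow> 0" and A: "A \<in> sets m"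
  obtains Z where "integrable M Z" "(\<lambda>n. dist1 (sint (h n) A) Z) \<longlonglongrightarrow> 0"
proof (rule L1_complete)
  show "integrable M (sint (h n) A)" for n
    by (rule simple_integral_integrable[OF h A])
  fix e :: real assume "0 < e"
  \<comment> \<open>74 instead of 73 for strictness. Below, \<open>r^2 / 8\<close> is chosen because
    \<open>4 (r^2 / 8 + r^2 / 8) = r^2\<close>.\<close>
  define r where "r = min 1 (e / 74)"
  have r: "0 < r" "r \<le> 1" "73 * r < e" using \<open>0 < e\<close> by (auto simp: r_def)
  have [measurable]: "simple_fun (h n) \<in> borel_measurable m" for n using h by measurable
  obtain N where N: "\<And>n. N \<le> n \<Longrightarrow> modular (\<lambda>s. simple_fun (h n) s - g s) < ennreal (r\<^sup>2 / 8)"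
    using tendsto_zero_ennrealE[OF lim, of "r\<^sup>2 / 8"] r by auto
  have "dist1 (sint (h i) A) (sint (h j) A) < ennreal e"
    if "N \<le> i" "N \<le> j" for i j
  proof -
    have "modular (\<lambda>s. simple_fun (h i) s - simple_fun (h j) s) =
        modular (\<lambda>s. (simple_fun (h i) s - g s) - (simple_fun (h j) s - g s))" by simp
    also have "\<dots> \<le> 4 * (modular (\<lambda>s. simple_fun (h i) s - g s) + modular (\<lambda>s. simple_fun (h j) s - g s))"
      by (rule modular_diff) measurable
    also have "\<dots> \<le> 4 * (ennreal (r\<^sup>2 / 8) + ennreal (r\<^sup>2 / 8))"
      using N[OF that(1)] N[OF that(2)] by (intro mult_left_mono add_mono) auto
    also have "ennreal (r\<^sup>2 / 8) + ennreal (r\<^sup>2 / 8) = ennreal (r\<^sup>2 / 4)"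
      by (simp flip: ennreal_plus)
    also have "4 * ennreal (r\<^sup>2 / 4) = ennreal (r\<^sup>2)"
      using ennreal_mult[of 4 "r\<^sup>2 / 4"] by simp
    finally have "dist1 (sint (h i) A) (sint (h j) A) \<le> ennreal (73 * r)"
      by (intro simple_integral_dist_le h A r) simp
    also have "\<dots> < ennreal e" using r by (simp add: ennreal_less_iff)
    finally show ?thesis .
  qed
  then show "\<exists>N. \<forall>i\<ge>N. \<forall>j\<ge>N. dist1 (sint (h i) A) (sint (h j) A) < ennreal e"
    by blast
qed (rule that)

section \<open>Density of simple functions and extension of the integral\<close>

lemma simple_function_restrict_eq_simple_fun:
  assumes U: "simple_function m U" and E: "E \<in> R"
  obtains h where "simple_over_R h" "\<And>s. s \<in> \<Omega> \<Longrightarrow> simple_fun h s = U s * indicator E s"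
proof -
  have fin: "finite (U ` space m)" using U by (rule simple_functionD)
  obtain ys where ys: "set ys = U ` space m" "distinct ys" using finite_distinct_list[OF fin] by blast
  define h where "h = map (\<lambda>y. (y, (U -` {y} \<inter> space m) \<inter> E)) ys"
  show ?thesis
  proof
    show "simple_over_R h"
      using simple_functionD(2)[OF U] R_trace[OF _ E] by (auto simp: h_def)
    fix s assume s: "s \<in> \<Omega>"
    have "simple_fun h s = (\<Sum>y\<in>U ` space m. y * indicator ((U -` {y} \<inter> space m) \<inter> E) s)"
      unfolding simple_fun_def h_def using ys by (simp add: o_def sum_list_distinct_conv_sum_set)
    also have "\<dots> = (\<Sum>y\<in>U ` space m. if y = U s then U s * indicator E s else 0)"
      using s by (intro sum.cong refl) (auto simp: indicator_def space_m)
    also have "\<dots> = U s * indicator E s"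
      using s fin by (simp add: space_m)
    finally show "simple_fun h s = U s * indicator E s" .
  qed
qed

lemma simple_fun_dense:
  assumes g [measurable]: "g \<in> borel_measurable m" and fin: "modular g < \<infinity>"
  obtains h where "\<And>n. simple_over_R (h n)"
    "(\<lambda>n. modular (\<lambda>s. simple_fun (h n) s - g s)) \<longlonglongrightarrow> 0"
proof -
  obtain E :: "nat \<Rightarrow> 's set" where E: "\<And>n. E n \<in> R" "incseq E" "(\<Union>n. E n) = \<Omega>"
    by (rule R_exhaustion) (rule that)
  from borel_measurable_implies_sequence_metric[OF g, of 0] obtain U where
    U: "\<And>i. simple_function m (U i)" "\<And>s. s \<in> space m \<Longrightarrow> (\<lambda>i. U i s) \<longlonglongrightarrow> g s"
      "\<And>i s. s \<in> space m \<Longrightarrow> \<bar>U i s\<bar> \<le> 2 * \<bar>g s\<bar>"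
    by simp metis
  have "\<exists>h. simple_over_R h \<and> (\<forall>s\<in>\<Omega>. simple_fun h s = U n s * indicator (E n) s)" for n
    using simple_function_restrict_eq_simple_fun[OF U(1) E(1), of n n] by metis
  then obtain h where h: "\<And>n. simple_over_R (h n)"
    "\<And>n s. s \<in> \<Omega> \<Longrightarrow> simple_fun (h n) s = U n s * indicator (E n) s"
    by metis
  have [measurable]: "simple_fun (h n) \<in> borel_measurable m" for n using h by measurable
  show ?thesis
  proof (rule that[OF h(1)])
    show "(\<lambda>n. modular (\<lambda>s. simple_fun (h n) s - g s)) \<longlonglongrightarrow> 0"
    \<comment> \<open>The approximants satisfy \<open>|U n s| \<le> 2 |g s|\<close>, also after the
      cut-off, so the difference is at most \<open>3 |g s|\<close>.\<close>
    proof (rule modular_dominated_convergence[where G="\<lambda>s. 3 * g s"])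
      show "modular (\<lambda>s. 3 * g s) < \<infinity>" using g fin by (rule modular_scale_finite)
      show "\<bar>simple_fun (h n) s - g s\<bar> \<le> \<bar>3 * g s\<bar>" if "s \<in> \<Omega>" for n s
        using U(3)[of s n] that by (auto simp: h(2) space_m indicator_def)
      show "AE s in m. (\<lambda>n. simple_fun (h n) s - g s) \<longlonglongrightarrow> 0"
      proof (rule AE_I2)
        fix s assume s: "s \<in> space m"
        then obtain k where "s \<in> E k" using E(3) space_m by auto
        then have "s \<in> E n" if "k \<le> n" for n using E(2) that by (auto simp: incseq_def)
        then have "\<forall>\<^sub>F n in sequentially. U n s - g s = simple_fun (h n) s - g s"
          using s by (auto simp: eventually_sequentially h(2) space_m intro!: exI[of _ k])
        moreover have "(\<lambda>n. U n s - g s) \<longlonglongrightarrow> 0" using U(2)[OF s] by (simp add: LIM_zero)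
        ultimately show "(\<lambda>n. simple_fun (h n) s - g s) \<longlonglongrightarrow> 0" by (rule Lim_transform_eventually[rotated])
      qed
    qed measurable
  qed
qed

text \<open>The closure, in modular and in \<open>L\<^sup>1\<close>, of the graph of the integral of simple functions.\<close>

definition modular_integral :: "('s \<Rightarrow> real) \<Rightarrow> ('w \<Rightarrow> real) \<Rightarrow> bool" where
  "modular_integral g Y \<longleftrightarrow> g \<in> borel_measurable m \<and> integrable M Y \<and>
    (\<forall>e>0. \<exists>h. simple_over_R h \<and> modular (\<lambda>s. simple_fun h s - g s) < ennreal e \<and>
      dist1 (sint h \<Omega>) Y < ennreal e)"

lemma modular_integralD:
  assumes "modular_integral g Y"
  shows "g \<in> borel_measurable m" "integrable M Y" "Y \<in> borel_measurable M"
  using assms by (auto simp: modular_integral_def)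

lemma modular_integralE:
  assumes "modular_integral g Y" "0 < e"
  obtains h where "simple_over_R h" "modular (\<lambda>s. simple_fun h s - g s) < ennreal e"
    "dist1 (sint h \<Omega>) Y < ennreal e"
  using assms by (auto simp: modular_integral_def)

lemma simple_integral_\<Omega>_measurable [measurable]:
  "simple_over_R h \<Longrightarrow> sint h \<Omega> \<in> borel_measurable M"
  by (rule simple_integral_measurable[OF _ sets.top[of m], unfolded space_m])

lemma modular_integral_exists:
  assumes g: "g \<in> borel_measurable m" "modular g < \<infinity>"
  shows "\<exists>Y. modular_integral g Y"
proof -
  obtain h where h: "\<And>n. simple_over_R (h n)"
    "(\<lambda>n. modular (\<lambda>s. simple_fun (h n) s - g s)) \<longlonglongrightarrow> 0"
    by (rule simple_fun_dense[OF g]) (rule that)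
  obtain Y where Y: "integrable M Y"
    "(\<lambda>n. dist1 (sint (h n) (space m)) Y) \<longlonglongrightarrow> 0"
    using simple_integral_L1_convergent[OF h(1) g(1) h(2), of "space m"] by auto
  have "\<exists>h. simple_over_R h \<and> modular (\<lambda>s. simple_fun h s - g s) < ennreal e \<and>
      dist1 (sint h \<Omega>) Y < ennreal e" if "0 < e" for e
  proof -
    have "\<forall>\<^sub>F n in sequentially. modular (\<lambda>s. simple_fun (h n) s - g s) < ennreal e \<and>
        dist1 (sint (h n) (space m)) Y < ennreal e"
      using tendsto_zero_ennrealD[OF h(2) that] tendsto_zero_ennrealD[OF Y(2) that] by (rule eventually_conj)
    then have "\<exists>n. modular (\<lambda>s. simple_fun (h n) s - g s) < ennreal e \<and>
        dist1 (sint (h n) (space m)) Y < ennreal e"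
      by (rule eventually_happens'[OF sequentially_bot])
    then show ?thesis using h(1) unfolding space_m by blast
  qed
  then show ?thesis using g Y by (auto simp: modular_integral_def)
qed

lemma modular_integral_simple:
  assumes h: "simple_over_R h"
  shows "modular_integral (simple_fun h) (sint h \<Omega>)"
  using simple_integral_integrable[OF h sets.top] h
  by (auto simp: modular_integral_def space_m l1_dist_def intro!: exI[of _ h])

text \<open>Lets later arguments approximate by any pairs already in the relation instead of
  returning to simple functions each time.\<close>

lemma modular_integral_closed:
  assumes [measurable]: "g \<in> borel_measurable m" and Y: "integrable M Y"
    and approx: "\<And>e. 0 < e \<Longrightarrow> \<exists>g' Y'. modular_integral g' Y' \<and>
      modular (\<lambda>s. g' s - g s) < ennreal e \<and> dist1 Y' Y < ennreal e"
  shows "modular_integral g Y"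
  unfolding modular_integral_def
proof (intro conjI allI impI Y)
  fix e :: real assume "0 < e"
  \<comment> \<open>\<open>modular_add\<close> costs a factor 4, and
    \<open>4 (e / 8 + e / 8) = e\<close>.\<close>
  then have "0 < e / 8" by simp
  then obtain g' Y' where g': "modular_integral g' Y'" "modular (\<lambda>s. g' s - g s) < ennreal (e / 8)"
    "dist1 Y' Y < ennreal (e / 8)" using approx by blast
  note [measurable] = modular_integralD(1,3)[OF g'(1)] borel_measurable_integrable[OF Y]
  obtain h where h: "simple_over_R h" "modular (\<lambda>s. simple_fun h s - g' s) < ennreal (e / 8)"
    "dist1 (sint h \<Omega>) Y' < ennreal (e / 8)"
    by (rule modular_integralE[OF g'(1) \<open>0 < e / 8\<close>]) (rule that)
  have [measurable]: "simple_fun h \<in> borel_measurable m" using h by measurable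
  have "modular (\<lambda>s. simple_fun h s - g s) = modular (\<lambda>s. (simple_fun h s - g' s) + (g' s - g s))" by simp
  also have "\<dots> \<le> 4 * (modular (\<lambda>s. simple_fun h s - g' s) + modular (\<lambda>s. g' s - g s))"
    by (rule modular_add) measurable
  also have "\<dots> < 4 * (ennreal (e / 8) + ennreal (e / 8))"
    using h(2) g'(2) by (intro ennreal_mult_strict_left_mono add_strict_mono) auto
  also have "\<dots> = ennreal e"
    using \<open>0 < e\<close> ennreal_mult[of 4 "e / 8 + e / 8"] by (simp add: ennreal_plus[symmetric] del: ennreal_plus)
  finally have 1: "modular (\<lambda>s. simple_fun h s - g s) < ennreal e" .
  have "dist1 (sint h \<Omega>) Y \<le> dist1 (sint h \<Omega>) Y' + dist1 Y' Y"
    using h by (intro l1_dist_triangle) measurable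
  also have "\<dots> < ennreal (e / 8) + ennreal (e / 8)" using h(3) g'(3) by (rule add_strict_mono)
  also have "\<dots> \<le> ennreal e" using \<open>0 < e\<close> by (simp add: ennreal_plus[symmetric] ennreal_leI del: ennreal_plus)
  finally have "dist1 (sint h \<Omega>) Y < ennreal e" .
  then show "\<exists>h. simple_over_R h \<and> modular (\<lambda>s. simple_fun h s - g s) < ennreal e \<and>
      dist1 (sint h \<Omega>) Y < ennreal e"
    using h(1) 1 by blast
qed fact

lemma modular_integral_cong_AE:
  assumes "modular_integral g Y" "AE s in m. g s = g' s" "AE \<omega> in M. Y \<omega> = Y' \<omega>"
    and [measurable]: "g' \<in> borel_measurable m" "Y' \<in> borel_measurable M"
  shows "modular_integral g' Y'"
proof (rule modular_integral_closed)
  note [measurable] = modular_integralD[OF assms(1)]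
  show "integrable M Y'"
    using modular_integralD(2)[OF assms(1)] by (rule integrable_cong_AE_imp) (use assms in auto)
  have "modular (\<lambda>s. g s - g' s) = modular (\<lambda>s. 0)"
    using assms(2) by (intro modular_cong_AE) auto
  moreover have "dist1 Y Y' = dist1 Y Y"
    using assms(3) by (intro l1_dist_cong_AE) auto
  ultimately show "\<exists>g'' Y''. modular_integral g'' Y'' \<and> modular (\<lambda>s. g'' s - g' s) < ennreal e \<and> dist1 Y'' Y' < ennreal e"
    if "0 < e" for e
    using assms(1) that by (intro exI[of _ g] exI[of _ Y]) (simp add: l1_dist_def)
qed measurable

lemma modular_integral_add:
  assumes "modular_integral g Y" "modular_integral g' Y'"
  shows "modular_integral (\<lambda>s. g s + g' s) (\<lambda>\<omega>. Y \<omega> + Y' \<omega>)"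
proof (rule modular_integral_closed)
  note [measurable] = modular_integralD[OF assms(1)] modular_integralD[OF assms(2)]
  show "integrable M (\<lambda>\<omega>. Y \<omega> + Y' \<omega>)" by (intro Bochner_Integration.integrable_add) measurable
  fix e :: real assume "0 < e"
  then have "0 < e / 8" by simp
  obtain h where h: "simple_over_R h" "modular (\<lambda>s. simple_fun h s - g s) < ennreal (e / 8)"
    "dist1 (sint h \<Omega>) Y < ennreal (e / 8)"
    by (rule modular_integralE[OF assms(1) \<open>0 < e / 8\<close>]) (rule that)
  obtain h' where h': "simple_over_R h'" "modular (\<lambda>s. simple_fun h' s - g' s) < ennreal (e / 8)"
    "dist1 (sint h' \<Omega>) Y' < ennreal (e / 8)"
    by (rule modular_integralE[OF assms(2) \<open>0 < e / 8\<close>]) (rule that)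
  have [measurable]: "simple_fun h \<in> borel_measurable m" "simple_fun h' \<in> borel_measurable m"
    using h h' by measurable
  have "modular (\<lambda>s. simple_fun (h @ h') s - (g s + g' s)) =
      modular (\<lambda>s. (simple_fun h s - g s) + (simple_fun h' s - g' s))" by (simp add: algebra_simps)
  also have "\<dots> \<le> 4 * (modular (\<lambda>s. simple_fun h s - g s) + modular (\<lambda>s. simple_fun h' s - g' s))"
    by (rule modular_add) measurable
  also have "\<dots> < 4 * (ennreal (e / 8) + ennreal (e / 8))"
    using h(2) h'(2) by (intro ennreal_mult_strict_left_mono add_strict_mono) auto
  also have "\<dots> = ennreal e"
    using \<open>0 < e\<close> ennreal_mult[of 4 "e / 8 + e / 8"] by (simp add: ennreal_plus[symmetric] del: ennreal_plus)
  finally have 1: "modular (\<lambda>s. simple_fun (h @ h') s - (g s + g' s)) < ennreal e" .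
  have "dist1 (sint (h @ h') \<Omega>) (\<lambda>\<omega>. Y \<omega> + Y' \<omega>) \<le>
      dist1 (sint h \<Omega>) Y + dist1 (sint h' \<Omega>) Y'"
    unfolding simple_integral_append[abs_def] using h h' by (intro l1_dist_add) measurable
  also have "\<dots> < ennreal (e / 8) + ennreal (e / 8)" using h(3) h'(3) by (rule add_strict_mono)
  also have "\<dots> \<le> ennreal e" using \<open>0 < e\<close> by (simp add: ennreal_plus[symmetric] ennreal_leI del: ennreal_plus)
  finally have 2: "dist1 (sint (h @ h') \<Omega>) (\<lambda>\<omega>. Y \<omega> + Y' \<omega>) < ennreal e" .
  have "modular_integral (simple_fun (h @ h')) (sint (h @ h') \<Omega>)"
    using h h' by (intro modular_integral_simple) auto
  then show "\<exists>g'' Y''. modular_integral g'' Y'' \<and> modular (\<lambda>s. g'' s - (g s + g' s)) < ennreal e \<and>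
      dist1 Y'' (\<lambda>\<omega>. Y \<omega> + Y' \<omega>) < ennreal e"
    using 1 2 by blast
qed (use modular_integralD[OF assms(1)] modular_integralD[OF assms(2)] in measurable)

lemma modular_integral_scale:
  assumes "modular_integral g Y"
  shows "modular_integral (\<lambda>s. c * g s) (\<lambda>\<omega>. c * Y \<omega>)"
proof (rule modular_integral_closed)
  note [measurable] = modular_integralD[OF assms]
  show "(\<lambda>s. c * g s) \<in> borel_measurable m" by measurable
  show "integrable M (\<lambda>\<omega>. c * Y \<omega>)" by (intro integrable_mult_right) measurable
  \<comment> \<open>Since k \<ge> 1, the factor \<open>k^2\<close> covers both the quadratic cost of
    dilation in the modular and the linear cost \<open>|c|\<close> in the mean.\<close>
  define k where "k = max 1 \<bar>c\<bar>"
  have k: "1 \<le> k" "\<bar>c\<bar> \<le> k" by (auto simp: k_def)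
  fix e :: real assume "0 < e"
  then have e': "0 < e / k\<^sup>2" using k by simp
  obtain h where h: "simple_over_R h" "modular (\<lambda>s. simple_fun h s - g s) < ennreal (e / k\<^sup>2)"
    "dist1 (sint h \<Omega>) Y < ennreal (e / k\<^sup>2)"
    by (rule modular_integralE[OF assms e']) (rule that)
  have [measurable]: "simple_fun h \<in> borel_measurable m" using h by measurable
  have eq: "ennreal (k\<^sup>2) * ennreal (e / k\<^sup>2) = ennreal e"
    using k e' by (subst ennreal_mult[symmetric]) auto
  have "modular (\<lambda>s. simple_fun (simple_scale c h) s - c * g s) \<le> modular (\<lambda>s. k * (simple_fun h s - g s))"
    using k by (intro modular_mono) (auto simp: right_diff_distrib[symmetric] abs_mult intro: mult_right_mono)
  also have "\<dots> \<le> ennreal (k\<^sup>2) * modular (\<lambda>s. simple_fun h s - g s)"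
    using k by (intro modular_scale_ge_1) auto
  also have "\<dots> < ennreal (k\<^sup>2) * ennreal (e / k\<^sup>2)"
    using h k by (intro ennreal_mult_strict_left_mono) auto
  finally have 1: "modular (\<lambda>s. simple_fun (simple_scale c h) s - c * g s) < ennreal e" unfolding eq .
  have "dist1 (sint (simple_scale c h) \<Omega>) (\<lambda>\<omega>. c * Y \<omega>) =
      ennreal \<bar>c\<bar> * dist1 (sint h \<Omega>) Y"
    unfolding simple_integral_scale[abs_def] using h by (intro l1_dist_scale) measurable
  also have "\<dots> \<le> ennreal (k\<^sup>2) * dist1 (sint h \<Omega>) Y"
    using k power_increasing[of 1 2 k] by (intro mult_right_mono ennreal_leI) auto
  also have "\<dots> < ennreal (k\<^sup>2) * ennreal (e / k\<^sup>2)"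
    using h k by (intro ennreal_mult_strict_left_mono) auto
  finally have 2: "dist1 (sint (simple_scale c h) \<Omega>) (\<lambda>\<omega>. c * Y \<omega>) < ennreal e" unfolding eq .
  have "modular_integral (simple_fun (simple_scale c h)) (sint (simple_scale c h) \<Omega>)"
    using h by (intro modular_integral_simple) simp
  then show "\<exists>g'' Y''. modular_integral g'' Y'' \<and> modular (\<lambda>s. g'' s - c * g s) < ennreal e \<and>
      dist1 Y'' (\<lambda>\<omega>. c * Y \<omega>) < ennreal e"
    using 1 2 by blast
qed

text \<open>\<open>584 = 73 * 8\<close>: an approximant h of g has
  \<open>modular (h / (8 c)) \<le> (1/8) 4 (1 + 1) = 1\<close>, where the second 1 bounds the
  rescaled approximation error.\<close>

lemma modular_integral_bound:
  assumes J: "modular_integral g Y" and c: "0 < c" and mod: "modular (\<lambda>s. g s / c) \<le> 1"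
  shows "dist1 Y (\<lambda>_. 0) \<le> ennreal (584 * c)"
proof (rule ennreal_le_epsilon)
  note [measurable] = modular_integralD[OF J]
  fix e :: real assume "0 < e"
  define k where "k = max 1 (1 / c)"
  have k: "1 \<le> k" "1 / c \<le> k" by (auto simp: k_def)
  \<comment> \<open>Division by c multiplies the modular by at most \<open>k^2\<close>, so an error
    below \<open>1 / k^2\<close> stays below 1 after rescaling.\<close>
  define d where "d = min e (1 / k\<^sup>2)"
  have d: "0 < d" "d \<le> e" "d \<le> 1 / k\<^sup>2" using \<open>0 < e\<close> k by (auto simp: d_def)
  obtain h where h: "simple_over_R h" "modular (\<lambda>s. simple_fun h s - g s) < ennreal d"
    "dist1 (sint h \<Omega>) Y < ennreal d"
    by (rule modular_integralE[OF J d(1)]) (rule that)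
  have [measurable]: "simple_fun h \<in> borel_measurable m" using h by measurable
  have "modular (\<lambda>s. (simple_fun h s - g s) / c) \<le> modular (\<lambda>s. k * (simple_fun h s - g s))"
    using k c mult_right_mono[OF k(2)] by (intro modular_mono) (auto simp: abs_mult abs_divide)
  also have "\<dots> \<le> ennreal (k\<^sup>2) * modular (\<lambda>s. simple_fun h s - g s)"
    using k by (intro modular_scale_ge_1) auto
  also have "\<dots> \<le> ennreal (k\<^sup>2) * ennreal (1 / k\<^sup>2)"
    using h(2) d(3) by (intro mult_left_mono) (auto intro: order_trans[OF less_imp_le] ennreal_leI)
  also have "\<dots> = 1" using k by (subst ennreal_mult[symmetric]) auto
  finally have 1: "modular (\<lambda>s. (simple_fun h s - g s) / c) \<le> 1" .
  have "modular (\<lambda>s. simple_fun h s / (8 * c)) = modular (\<lambda>s. (1 / 8) * (g s / c + (simple_fun h s - g s) / c))"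
    by (simp add: diff_divide_distrib)
  also have "\<dots> \<le> ennreal (1 / 8) * modular (\<lambda>s. g s / c + (simple_fun h s - g s) / c)"
    by (rule modular_scale_le_1) auto
  also have "\<dots> \<le> ennreal (1 / 8) * (4 * (modular (\<lambda>s. g s / c) + modular (\<lambda>s. (simple_fun h s - g s) / c)))"
    by (intro mult_left_mono modular_add) auto
  also have "\<dots> \<le> ennreal (1 / 8) * (4 * (1 + 1))"
    using mod 1 by (intro mult_left_mono add_mono) auto
  also have "\<dots> = 1"
    using ennreal_mult[of "1 / 8" 8] by simp
  finally have "dist1 (sint h \<Omega>) (\<lambda>_. 0) \<le> ennreal (73 * (8 * c))"
    using c h(1) sets.top[of m] by (intro simple_integral_abs_le) (auto simp: space_m)
  moreover have "dist1 Y (\<lambda>_. 0) \<le> dist1 Y (sint h \<Omega>) + dist1 (sint h \<Omega>) (\<lambda>_. 0)"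
    using h(1) by (intro l1_dist_triangle) measurable
  moreover have "dist1 Y (sint h \<Omega>) \<le> ennreal e"
    using h(3) d(2) unfolding l1_dist_commute[of M Y] by (meson ennreal_leI less_imp_le order_trans)
  ultimately have "dist1 Y (\<lambda>_. 0) \<le> ennreal e + ennreal (73 * (8 * c))"
    by (meson add_mono order_trans)
  then show "dist1 Y (\<lambda>_. 0) \<le> ennreal (584 * c) + ennreal e" by (simp add: add.commute)
qed

lemma modular_integral_diff:
  assumes "modular_integral g Y" "modular_integral g' Y'"
  shows "modular_integral (\<lambda>s. g s - g' s) (\<lambda>\<omega>. Y \<omega> - Y' \<omega>)"
  using modular_integral_add[OF assms(1) modular_integral_scale[OF assms(2), of "- 1"]] by simp

section \<open>Comparison with the Rajput-Rosinski integral\<close>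

text \<open>Approximation at a geometric rate makes the modulars summable, so \<phi> of the error
  tends to 0 almost everywhere, and positivity of \<open>\<phi> 1\<close> yields convergence of the
  functions. Over each A the integrals even converge in the mean.\<close>

lemma modular_integral_imp_has_levy_integral:
  assumes J: "modular_integral g Y"
  shows "has_levy_integral M R \<Lambda> m g Y"
proof -
  note [measurable] = modular_integralD(1,3)[OF J]
  have "\<exists>h. simple_over_R h \<and> modular (\<lambda>s. simple_fun h s - g s) < ennreal ((1 / 2) ^ n) \<and>
      dist1 (sint h \<Omega>) Y < ennreal ((1 / 2) ^ n)" for n :: nat
    using J by (auto simp: modular_integral_def)
  then obtain h where h: "\<And>n. simple_over_R (h n)"
    "\<And>n. modular (\<lambda>s. simple_fun (h n) s - g s) < ennreal ((1 / 2) ^ n)"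
    "\<And>n. dist1 (sint (h n) \<Omega>) Y < ennreal ((1 / 2) ^ n)"
    by metis
  have [measurable]: "simple_fun (h n) \<in> borel_measurable m" for n using h(1) by measurable
  have half: "(\<lambda>n. ennreal ((1 / 2) ^ n)) \<longlonglongrightarrow> 0"
    by (simp add: ennreal_tendsto_0_iff LIMSEQ_realpow_zero)
  have mod0: "(\<lambda>n. modular (\<lambda>s. simple_fun (h n) s - g s)) \<longlonglongrightarrow> 0"
    by (rule tendsto_zero_ennreal_mono[OF half]) (intro always_eventually allI less_imp_le h)
  have Y0: "(\<lambda>n. dist1 (sint (h n) \<Omega>) Y) \<longlonglongrightarrow> 0"
    by (rule tendsto_zero_ennreal_mono[OF half]) (intro always_eventually allI less_imp_le h)
  have "(\<integral>\<^sup>+s. (\<Sum>n. \<phi> (simple_fun (h n) s - g s) s) \<partial>m) = (\<Sum>n. modular (\<lambda>s. simple_fun (h n) s - g s))"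
    unfolding modular_def by (rule nn_integral_suminf) measurable
  also have "\<dots> \<le> (\<Sum>n. ennreal ((1 / 2) ^ n))"
    by (intro suminf_le summableI less_imp_le h)
  also have "\<dots> < \<infinity>"
  proof -
    have "summable (\<lambda>n. (1 / 2 :: real) ^ n)" by (rule summable_geometric) simp
    then have "(\<Sum>n. ennreal ((1 / 2) ^ n)) \<noteq> top" by (rule ennreal_suminf_neq_top) simp
    then show ?thesis by (simp only: less_top infinity_ennreal_def)
  qed
  finally have "AE s in m. (\<Sum>n. \<phi> (simple_fun (h n) s - g s) s) \<noteq> \<infinity>"
    by (intro nn_integral_PInf_AE) auto
  then have ae: "AE s in m. (\<lambda>n. simple_fun (h n) s) \<longlonglongrightarrow> g s"
    using AE_phi_pos AE_space
  proof eventually_elim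
    case (elim s)
    then have "(\<lambda>n. \<phi> (simple_fun (h n) s - g s) s) \<longlonglongrightarrow> 0"
      by (intro suminf_ennreal_finite_imp_tendsto_zero) (simp add: less_top)
    then have "(\<lambda>n. simple_fun (h n) s - g s) \<longlonglongrightarrow> 0"
      using elim by (intro phi_tendsto_zero_imp[of s]) (auto simp: space_m)
    then show ?case by (simp add: LIM_zero_iff)
  qed
  have "\<exists>Z\<in>borel_measurable M. tendsto_in_probability M (\<lambda>n. sint (h n) A) Z"
    if A: "A \<in> sets m" for A
  proof -
    obtain Z where Z: "integrable M Z" "(\<lambda>n. dist1 (sint (h n) A) Z) \<longlonglongrightarrow> 0"
      by (rule simple_integral_L1_convergent[OF h(1) modular_integralD(1)[OF J] mod0 A]) (rule that)
    have "tendsto_in_probability M (\<lambda>n. sint (h n) A) Z"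
      using Z by (intro L1_imp_tendsto_in_probability simple_integral_measurable h(1) A) auto
    then show ?thesis using Z by auto
  qed
  moreover have "tendsto_in_probability M (\<lambda>n. sint (h n) \<Omega>) Y"
    using Y0 by (intro L1_imp_tendsto_in_probability simple_integral_\<Omega>_measurable h(1)) auto
  ultimately show ?thesis
    unfolding has_levy_integral_def space_m using h(1) ae by auto
qed

section \<open>Almost sure uniqueness of the integral\<close>

lemma simple_integral_split:
  assumes h: "simple_over_R h" and A: "A \<in> sets m"
  shows "AE \<omega> in M. sint h \<Omega> \<omega> = sint h A \<omega> + sint h (\<Omega> - A) \<omega>"
  using h
proof (induction h)
  case (Cons p h)
  obtain a B where p: "p = (a, B)" by (cases p)
  have B: "B \<in> R" using Cons.prems p by auto
  then have "B \<subseteq> \<Omega>" using R.space_closed by auto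
  define F where "F i = (if i = 0 then B \<inter> A else B \<inter> (\<Omega> - A))" for i :: nat
  have "\<Omega> - A \<in> sets m" using sets.compl_sets[OF A] by (simp add: space_m)
  then have "F i \<in> R" for i
    using R_trace[OF A B] R_trace[OF \<open>\<Omega> - A \<in> sets m\<close> B] by (auto simp: F_def Int_commute)
  moreover have "disjoint_family_on F {..<2}" by (auto simp: disjoint_family_on_def F_def)
  ultimately have "AE \<omega> in M. \<Lambda> (\<Union>i<2. F i) \<omega> = (\<Sum>i<2. \<Lambda> (F i) \<omega>)"
    by (intro \<Lambda>_finite_additive)
  moreover have "(\<Union>i<2. F i) = B \<inter> \<Omega>"
    using \<open>B \<subseteq> \<Omega>\<close> by (auto simp: F_def lessThan_nat_numeral lessThan_Suc)
  moreover have "(\<Sum>i<2. \<Lambda> (F i) \<omega>) = \<Lambda> (B \<inter> A) \<omega> + \<Lambda> (B \<inter> (\<Omega> - A)) \<omega>" for \<omega>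
    by (simp add: F_def numeral_2_eq_2)
  ultimately have "AE \<omega> in M. \<Lambda> (B \<inter> \<Omega>) \<omega> = \<Lambda> (B \<inter> A) \<omega> + \<Lambda> (B \<inter> (\<Omega> - A)) \<omega>" by simp
  moreover have "AE \<omega> in M. sint h \<Omega> \<omega> = sint h A \<omega> + sint h (\<Omega> - A) \<omega>"
    using Cons by auto
  ultimately show ?case
    by eventually_elim (simp add: p algebra_simps)
qed simp

lemma modular_simple_fun_finite:
  "simple_over_R h \<Longrightarrow> modular (simple_fun h) < \<infinity>"
proof (induction h)
  case Nil
  have "simple_fun [] = (\<lambda>s. 0)" by auto
  then show ?case by simp
next
  case (Cons p h)
  obtain a B where p: "p = (a, B)" by (cases p)
  have B: "B \<in> R" and h: "simple_over_R h" using Cons.prems p by auto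
  have [measurable]: "B \<in> sets m" "simple_fun h \<in> borel_measurable m" using B h R_sub_sets by auto
  have "modular (\<lambda>s. a * indicator B s) = (\<integral>\<^sup>+s. \<phi> a s * indicator B s \<partial>m)"
    unfolding modular_def by (intro nn_integral_cong) (auto simp: indicator_def)
  then have "modular (\<lambda>s. a * indicator B s) < \<infinity>" using nn_integral_phi_finite[OF B] by simp
  moreover have "modular (simple_fun (p # h)) \<le> 4 * (modular (\<lambda>s. a * indicator B s) + modular (simple_fun h))"
    unfolding p simple_fun_Cons[abs_def] by (rule modular_add) measurable
  ultimately show ?case
    using Cons.IH[OF h] by (auto intro: le_less_trans simp: ennreal_mult_less_top)
qed

lemma simple_integral_tendsto_zero:
  assumes h: "\<And>n. simple_over_R (h n)" and lim: "(\<lambda>n. modular (simple_fun (h n))) \<longlonglongrightarrow> 0" and A: "A \<in> sets m"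
  shows "tendsto_in_probability M (\<lambda>n. sint (h n) A) (\<lambda>_. 0)"
proof (rule L1_imp_tendsto_in_probability)
  show "(\<lambda>n. dist1 (sint (h n) A) (\<lambda>_. 0)) \<longlonglongrightarrow> 0"
  proof (rule tendsto_zero_ennrealI)
    fix e :: real assume "0 < e"
    define r where "r = min 1 (e / 73)"
    have r: "0 < r" "r \<le> 1" "73 * r \<le> e" using \<open>0 < e\<close> by (auto simp: r_def)
    have "\<forall>\<^sub>F n in sequentially. modular (simple_fun (h n)) < ennreal (r\<^sup>2)"
      using r by (intro tendsto_zero_ennrealD[OF lim]) auto
    then show "\<forall>\<^sub>F n in sequentially. dist1 (sint (h n) A) (\<lambda>_. 0) \<le> ennreal e"
    proof eventually_elim
      case (elim n)
      then have "dist1 (sint (h n) A) (\<lambda>_. 0) \<le> ennreal (73 * r)"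
        using h A r by (intro simple_integral_abs_le_sqrt) auto
      also have "\<dots> \<le> ennreal e" using r by (intro ennreal_leI)
      finally show ?case .
    qed
  qed
qed (use h A in measurable)

text \<open>Uniqueness of the Rajput-Rosinski integral, by a gliding hump: if the masses
  \<open>\<phi> (simple_fun (d n) s) s\<close> of a null sequence of simple functions did not vanish in the limit,
  they would concentrate on disjoint sets along a subsequence. Integrating over the union \<open>A\<close> of
  every other one of these sets gives a sequence that is asymptotically equal to the integral over
  \<open>\<Omega>\<close> along the even indices and to \<open>0\<close> along the odd ones, so that convergence over \<open>A\<close>
  forces the limit over \<open>\<Omega>\<close> to vanish.\<close>

lemma simple_integral_limit_zero:
  assumes d: "\<And>n. simple_over_R (d n)" and ae: "AE s in m. (\<lambda>n. simple_fun (d n) s) \<longlonglongrightarrow> 0"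
    and conv: "\<And>A. A \<in> sets m \<Longrightarrow> \<exists>Z\<in>borel_measurable M. tendsto_in_probability M (\<lambda>n. sint (d n) A) Z"
    and [measurable]: "Z \<in> borel_measurable M" and Z: "tendsto_in_probability M (\<lambda>n. sint (d n) \<Omega>) Z"
  shows "AE \<omega> in M. Z \<omega> = 0"
proof -
  have [measurable]: "simple_fun (d n) \<in> borel_measurable m" for n using d by measurable
  define \<tau> where "\<tau> n s = \<phi> (simple_fun (d n) s) s" for n s
  have \<tau>_meas [measurable]: "\<tau> n \<in> borel_measurable m" for n unfolding \<tau>_def by measurable
  have \<tau>_fin: "(\<integral>\<^sup>+s. \<tau> n s \<partial>m) < \<infinity>" for n
    using modular_simple_fun_finite[OF d] by (simp add: \<tau>_def modular_def)
  have \<tau>_lim: "AE s in m. (\<lambda>n. \<tau> n s) \<longlonglongrightarrow> 0"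
    using ae AE_phi_finite AE_space by eventually_elim (simp add: phi_tendsto_zero space_m \<tau>_def)
  \<comment> \<open>m may be infinite, so the threshold is a strictly positive integrable function.
    It dominates the tail of the sequence on \<open>G j\<close>, and almost every point lies in some
    \<open>G j\<close> since \<open>\<tau> n s\<close> tends to 0 < w s.\<close>
  obtain w where w [measurable]: "w \<in> borel_measurable m" and w_fin: "(\<integral>\<^sup>+s. w s \<partial>m) < \<infinity>"
    and w_pos: "\<And>s. s \<in> space m \<Longrightarrow> 0 < w s"
    using m.Ex_finite_integrable_function by (auto simp: less_top)
  define G where "G j = {s \<in> space m. \<forall>n\<in>{j..}. \<tau> n s \<le> w s}" for j
  have G [measurable]: "G j \<in> sets m" for j unfolding G_def by measurable
  have G_mono: "G i \<subseteq> G j" if "i \<le> j" for i j using that by (auto simp: G_def)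
  have G_lim: "(\<lambda>n. \<integral>\<^sup>+s. \<tau> n s * indicator (G j) s \<partial>m) \<longlonglongrightarrow> 0" for j
  proof (rule LIMSEQ_offset[where k=j])
    have "(\<lambda>n. \<integral>\<^sup>+s. \<tau> (n + j) s * indicator (G j) s \<partial>m) \<longlonglongrightarrow> (\<integral>\<^sup>+s. 0 \<partial>m)"
    proof (rule nn_integral_dominated_convergence[where w=w])
      show "AE s in m. \<tau> (n + j) s * indicator (G j) s \<le> w s" for n
        by (rule AE_I2) (auto simp: G_def indicator_def)
      show "AE s in m. (\<lambda>n. \<tau> (n + j) s * indicator (G j) s) \<longlonglongrightarrow> 0"
        using \<tau>_lim
      proof eventually_elim
        case (elim s)
        then have "(\<lambda>n. \<tau> (n + j) s) \<longlonglongrightarrow> 0" by (rule LIMSEQ_ignore_initial_segment)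
        then show ?case by (auto simp: indicator_def)
      qed
    qed (use w_fin in measurable)
    then show "(\<lambda>n. \<integral>\<^sup>+s. \<tau> (n + j) s * indicator (G j) s \<partial>m) \<longlonglongrightarrow> 0" by simp
  qed
  have G_compl_lim: "(\<lambda>j. \<integral>\<^sup>+s. \<tau> n s * indicator (\<Omega> - G j) s \<partial>m) \<longlonglongrightarrow> 0" for n
  proof -
    have [measurable]: "\<Omega> - G j \<in> sets m" for j using sets.compl_sets[OF G] by (simp add: space_m)
    have "(\<lambda>j. \<integral>\<^sup>+s. \<tau> n s * indicator (\<Omega> - G j) s \<partial>m) \<longlonglongrightarrow> (\<integral>\<^sup>+s. 0 \<partial>m)"
    proof (rule nn_integral_dominated_convergence[where w="\<tau> n"])
      show "AE s in m. \<tau> n s * indicator (\<Omega> - G j) s \<le> \<tau> n s" for j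
        by (rule AE_I2) (auto simp: indicator_def)
      show "AE s in m. (\<lambda>j. \<tau> n s * indicator (\<Omega> - G j) s) \<longlonglongrightarrow> 0"
        using \<tau>_lim AE_space
      proof eventually_elim
        case (elim s)
        then have "\<forall>\<^sub>F n in sequentially. \<tau> n s < w s" using w_pos by (intro order_tendstoD) auto
        then obtain k where "\<And>n. k \<le> n \<Longrightarrow> \<tau> n s < w s" by (auto simp: eventually_sequentially)
        then have "s \<in> G j" if "k \<le> j" for j
          using elim that by (auto simp: G_def intro!: less_imp_le)
        then have "\<forall>\<^sub>F j in sequentially. 0 = \<tau> n s * indicator (\<Omega> - G j) s"
          by (auto simp: eventually_sequentially intro!: exI[of _ k])
        then show ?case by (rule Lim_transform_eventually[OF tendsto_const])
      qed
    qed (use \<tau>_fin in measurable)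
    then show ?thesis by simp
  qed
  define e where "e k = ennreal ((1 / 2) ^ k)" for k :: nat
  \<comment> \<open>A pair consists of an index n of the sequence and a level j. P leaves little
    mass of term n outside \<open>G j\<close>, Q leaves little mass of the next chosen term inside
    the present level. Each chosen term thus lives mainly on the difference of its level and the
    preceding one.\<close>
  define P where "P k p = ((\<integral>\<^sup>+s. \<tau> (fst p) s * indicator (\<Omega> - G (snd p)) s \<partial>m) < e k)" for k and p :: "nat \<times> nat"
  define Q where "Q k p q = (fst p < fst q \<and> snd p \<le> snd q \<and>
    (\<integral>\<^sup>+s. \<tau> (fst q) s * indicator (G (snd p)) s \<partial>m) < e (Suc k))" for k and p q :: "nat \<times> nat"
  have P_ex: "\<exists>j\<ge>j0. P k (n, j)" for k n j0
  proof -
    have "\<forall>\<^sub>F j in sequentially. (\<integral>\<^sup>+s. \<tau> n s * indicator (\<Omega> - G j) s \<partial>m) < e k"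
      unfolding e_def by (rule tendsto_zero_ennrealD[OF G_compl_lim]) simp
    from eventually_conj[OF this eventually_ge_at_top[of j0]]
    have "\<exists>j. (\<integral>\<^sup>+s. \<tau> n s * indicator (\<Omega> - G j) s \<partial>m) < e k \<and> j0 \<le> j"
      by (rule eventually_happens'[OF sequentially_bot])
    then show ?thesis by (auto simp: P_def)
  qed
  have "\<exists>f. \<forall>k. P k (f k) \<and> Q k (f k) (f (Suc k))"
  proof (rule dependent_nat_choice)
    show "\<exists>p. P 0 p" using P_ex[of 0 0 0] by auto
    fix p k assume "P k p"
    have "\<forall>\<^sub>F n in sequentially. (\<integral>\<^sup>+s. \<tau> n s * indicator (G (snd p)) s \<partial>m) < e (Suc k)"
      unfolding e_def by (rule tendsto_zero_ennrealD[OF G_lim]) simp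
    from eventually_conj[OF this eventually_gt_at_top[of "fst p"]]
    have "\<exists>n. (\<integral>\<^sup>+s. \<tau> n s * indicator (G (snd p)) s \<partial>m) < e (Suc k) \<and> fst p < n"
      by (rule eventually_happens'[OF sequentially_bot])
    then obtain n where n: "(\<integral>\<^sup>+s. \<tau> n s * indicator (G (snd p)) s \<partial>m) < e (Suc k)" "fst p < n" by auto
    obtain j where "snd p \<le> j" "P (Suc k) (n, j)" using P_ex by blast
    then show "\<exists>q. P (Suc k) q \<and> Q k p q" using n by (auto simp: Q_def)
  qed
  then obtain f where f: "\<And>k. P k (f k)" "\<And>k. Q k (f k) (f (Suc k))" by auto
  define N where "N k = fst (f k)" for k
  define J where "J k = G (snd (f k))" for k
  have N: "strict_mono N" using f(2) by (auto simp: strict_mono_Suc_iff N_def Q_def)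
  have J [measurable]: "J k \<in> sets m" for k by (simp add: J_def)
  have J_Suc: "J k \<subseteq> J (Suc k)" for k unfolding J_def using f(2)[of k] by (intro G_mono) (auto simp: Q_def)
  have J_mono: "J k \<subseteq> J l" if "k \<le> l" for k l using J_Suc that by (rule lift_Suc_mono_le)
  have small: "(\<integral>\<^sup>+s. \<tau> (N (Suc k)) s * indicator B s \<partial>m) \<le> e (Suc k) + e (Suc k)"
    if "B \<subseteq> J k \<union> (\<Omega> - J (Suc k))" for k B
  proof -
    have [measurable]: "\<Omega> - J k \<in> sets m" for k using sets.compl_sets[OF J] by (simp add: space_m)
    have "(\<integral>\<^sup>+s. \<tau> (N (Suc k)) s * indicator B s \<partial>m) \<le>
        (\<integral>\<^sup>+s. \<tau> (N (Suc k)) s * indicator (J k) s + \<tau> (N (Suc k)) s * indicator (\<Omega> - J (Suc k)) s \<partial>m)"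
      using that by (intro nn_integral_mono) (auto simp: indicator_def)
    also have "\<dots> = (\<integral>\<^sup>+s. \<tau> (N (Suc k)) s * indicator (J k) s \<partial>m) + (\<integral>\<^sup>+s. \<tau> (N (Suc k)) s * indicator (\<Omega> - J (Suc k)) s \<partial>m)"
      by (rule nn_integral_add) measurable
    also have "\<dots> \<le> e (Suc k) + e (Suc k)"
      using f(1)[of "Suc k"] f(2)[of k] unfolding P_def Q_def N_def J_def
      by (intro add_mono less_imp_le) auto
    finally show ?thesis .
  qed
  \<comment> \<open>The shells of even number; the terms with odd number live on the others.\<close>
  define A where "A = (\<Union>k. J (2 * k + 2) - J (2 * k + 1))"
  have A [measurable]: "A \<in> sets m" unfolding A_def by measurable
  have A_compl [measurable]: "\<Omega> - A \<in> sets m" using sets.compl_sets[OF A] by (simp add: space_m)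
  \<comment> \<open>A shell in A with number at most 2k lies inside \<open>J (2 k)\<close>, every
    later one lies outside \<open>J (2 k + 1)\<close>.\<close>
  have odd: "A \<subseteq> J (2 * k) \<union> (\<Omega> - J (Suc (2 * k)))" for k
  proof
    fix s assume "s \<in> A"
    then obtain l where l: "s \<in> J (2 * l + 2)" "s \<notin> J (2 * l + 1)" by (auto simp: A_def)
    have "s \<in> \<Omega>" using l(1) sets.sets_into_space[OF J] space_m by blast
    moreover have "s \<in> J (2 * k)" if "s \<in> J (Suc (2 * k))"
    proof -
      have "\<not> Suc (2 * k) \<le> 2 * l + 1" using l(2) that J_mono by blast
      then have "2 * l + 2 \<le> 2 * k" by simp
      then show ?thesis using l(1) J_mono by blast
    qed
    ultimately show "s \<in> J (2 * k) \<union> (\<Omega> - J (Suc (2 * k)))" by auto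
  qed
  \<comment> \<open>A point outside A misses the shell
    \<open>J (2 k + 2) - J (2 k + 1)\<close>.\<close>
  have even: "\<Omega> - A \<subseteq> J (2 * k + 1) \<union> (\<Omega> - J (Suc (2 * k + 1)))" for k
    by (auto simp: A_def)
  have tip_zero: "tendsto_in_probability M (\<lambda>k. sint (d (N (Suc (r k)))) B) (\<lambda>_. 0)"
    if B: "B \<in> sets m" "\<And>k. B \<subseteq> J (r k) \<union> (\<Omega> - J (Suc (r k)))" and r: "strict_mono r" for B r
  proof -
    have "(\<lambda>k. modular (simple_fun (simple_restrict B (d (N (Suc (r k))))))) \<longlonglongrightarrow> 0"
    proof (rule tendsto_zero_ennreal_mono)
      have "(\<lambda>k. (1 / 2 :: real) ^ k) \<longlonglongrightarrow> 0" by (simp add: LIMSEQ_realpow_zero)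
      then have e0: "e \<longlonglongrightarrow> 0" unfolding e_def by (simp add: ennreal_tendsto_0_iff)
      have "strict_mono (\<lambda>k. Suc (r k))" using r by (simp add: strict_mono_def)
      from LIMSEQ_subseq_LIMSEQ[OF e0 this]
      show "(\<lambda>k. e (Suc (r k)) + e (Suc (r k))) \<longlonglongrightarrow> 0"
        by (intro tendsto_zero_ennreal_add) (simp_all add: o_def)
      have "modular (simple_fun (simple_restrict B (d (N (Suc (r k)))))) = (\<integral>\<^sup>+s. \<tau> (N (Suc (r k))) s * indicator B s \<partial>m)" for k
        unfolding modular_def \<tau>_def by (intro nn_integral_cong) (auto simp: indicator_def)
      then show "\<forall>\<^sub>F k in sequentially. modular (simple_fun (simple_restrict B (d (N (Suc (r k)))))) \<le> e (Suc (r k)) + e (Suc (r k))"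
        using small[OF B(2)] by simp
    qed
    from simple_integral_tendsto_zero[OF snd_simple_restrict[OF d B(1)] this sets.top]
    show ?thesis using sets.sets_into_space[OF B(1)] by (simp add: simple_integral_restrict[abs_def] Int_absorb2)
  qed
  have meas [measurable]: "sint (d n) B \<in> borel_measurable M" if "B \<in> sets m" for n B
    using d that by measurable
  obtain ZA where [measurable]: "ZA \<in> borel_measurable M"
    and ZA: "tendsto_in_probability M (\<lambda>n. sint (d n) A) ZA"
    using conv[OF A] by auto
  have sm: "strict_mono (\<lambda>k. N (Suc (2 * k)))" "strict_mono (\<lambda>k. N (Suc (2 * k + 1)))"
    using N by (auto simp: strict_mono_def)
  have "AE \<omega> in M. ZA \<omega> = 0"
    by (rule tendsto_in_probability_unique[OF meas[OF A] _ _ tendsto_in_probability_subseq[OF ZA sm(1)]])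
       (use tip_zero[OF A odd] in \<open>auto simp: strict_mono_def\<close>)
  moreover have "AE \<omega> in M. Z \<omega> = ZA \<omega> + 0"
  proof (rule tendsto_in_probability_unique)
    show "tendsto_in_probability M (\<lambda>k. sint (d (N (Suc (2 * k + 1)))) \<Omega>) Z"
      using tendsto_in_probability_subseq[OF Z sm(2)] .
    show "tendsto_in_probability M (\<lambda>k. sint (d (N (Suc (2 * k + 1)))) \<Omega>) (\<lambda>\<omega>. ZA \<omega> + 0)"
    proof (rule tendsto_in_probability_cong_AE)
      show "tendsto_in_probability M (\<lambda>k \<omega>. sint (d (N (Suc (2 * k + 1)))) A \<omega> +
          sint (d (N (Suc (2 * k + 1)))) (\<Omega> - A) \<omega>) (\<lambda>\<omega>. ZA \<omega> + 0)"
        using tendsto_in_probability_subseq[OF ZA sm(2)] tip_zero[OF A_compl even]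
        by (intro tendsto_in_probability_add meas A A_compl) (auto simp: strict_mono_def)
      show "AE \<omega> in M. sint (d (N (Suc (2 * k + 1)))) A \<omega> +
          sint (d (N (Suc (2 * k + 1)))) (\<Omega> - A) \<omega> = sint (d (N (Suc (2 * k + 1)))) \<Omega> \<omega>" for k
        using simple_integral_split[OF d[of "N (Suc (2 * k + 1))"] A] by eventually_elim simp
    qed (use meas A A_compl d in \<open>auto intro!: borel_measurable_add simple_integral_\<Omega>_measurable\<close>)
  qed (use d in \<open>auto intro!: simple_integral_\<Omega>_measurable\<close>)
  ultimately show ?thesis by eventually_elim simp
qed

lemma has_levy_integralE:
  assumes "has_levy_integral M R \<Lambda> m g Y"
  obtains h where "\<And>n. simple_over_R (h n)" "AE s in m. (\<lambda>n. simple_fun (h n) s) \<longlonglongrightarrow> g s"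
    "\<And>A. A \<in> sets m \<Longrightarrow> \<exists>Z\<in>borel_measurable M. tendsto_in_probability M (\<lambda>n. sint (h n) A) Z"
    "tendsto_in_probability M (\<lambda>n. sint (h n) \<Omega>) Y"
proof -
  from assms obtain h where h: "(\<forall>n. simple_over_R (h n)) \<and> (AE s in m. (\<lambda>n. simple_fun (h n) s) \<longlonglongrightarrow> g s) \<and>
    (\<forall>A\<in>sets m. \<exists>Z\<in>borel_measurable M. tendsto_in_probability M (\<lambda>n. sint (h n) A) Z) \<and>
    tendsto_in_probability M (\<lambda>n. sint (h n) \<Omega>) Y"
    unfolding has_levy_integral_def space_m by blast
  show ?thesis by (rule that[of h]) (use h in auto)
qed

text \<open>The differences of two approximating sequences are again simple, tend to 0 almost
  everywhere and converge in probability over every set. The argument applies to every integrand,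
  whether or not its modular is finite.\<close>

lemma has_levy_integral_unique:
  assumes Y: "has_levy_integral M R \<Lambda> m g Y" and Y': "has_levy_integral M R \<Lambda> m g Y'"
  shows "AE \<omega> in M. Y \<omega> = Y' \<omega>"
proof -
  from Y have [measurable]: "Y \<in> borel_measurable M" by (auto simp: has_levy_integral_def)
  from Y' have [measurable]: "Y' \<in> borel_measurable M" by (auto simp: has_levy_integral_def)
  from Y obtain h where h: "\<And>n. simple_over_R (h n)" "AE s in m. (\<lambda>n. simple_fun (h n) s) \<longlonglongrightarrow> g s"
    "\<And>A. A \<in> sets m \<Longrightarrow> \<exists>Z\<in>borel_measurable M. tendsto_in_probability M (\<lambda>n. sint (h n) A) Z"
    "tendsto_in_probability M (\<lambda>n. sint (h n) \<Omega>) Y"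
    by (rule has_levy_integralE) (rule that)
  from Y' obtain h' where h': "\<And>n. simple_over_R (h' n)" "AE s in m. (\<lambda>n. simple_fun (h' n) s) \<longlonglongrightarrow> g s"
    "\<And>A. A \<in> sets m \<Longrightarrow> \<exists>Z\<in>borel_measurable M. tendsto_in_probability M (\<lambda>n. sint (h' n) A) Z"
    "tendsto_in_probability M (\<lambda>n. sint (h' n) \<Omega>) Y'"
    by (rule has_levy_integralE) (rule that)
  define d where "d n = h n @ simple_scale (- 1) (h' n)" for n
  have int_d: "sint (d n) A = (\<lambda>\<omega>. sint (h n) A \<omega> + - sint (h' n) A \<omega>)" for n A
    by (auto simp: d_def fun_eq_iff)
  have diff: "tendsto_in_probability M (\<lambda>n. sint (d n) A) (\<lambda>\<omega>. Z \<omega> + - Z' \<omega>)"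
    if "A \<in> sets m" "Z \<in> borel_measurable M" "Z' \<in> borel_measurable M"
      "tendsto_in_probability M (\<lambda>n. sint (h n) A) Z"
      "tendsto_in_probability M (\<lambda>n. sint (h' n) A) Z'" for A Z Z'
    unfolding int_d using that h(1) h'(1)
    by (intro tendsto_in_probability_add tendsto_in_probability_uminus borel_measurable_uminus simple_integral_measurable)
  have "AE \<omega> in M. Y \<omega> + - Y' \<omega> = 0"
  proof (rule simple_integral_limit_zero)
    show "simple_over_R (d n)" for n using h(1) h'(1) by (auto simp: d_def image_Un)
    show "AE s in m. (\<lambda>n. simple_fun (d n) s) \<longlonglongrightarrow> 0"
      using h(2) h'(2)
    proof eventually_elim
      case (elim s)
      then show ?case using tendsto_diff[OF elim] by (simp add: d_def)
    qed
    show "\<exists>Z\<in>borel_measurable M. tendsto_in_probability M (\<lambda>n. sint (d n) A) Z" if A: "A \<in> sets m" for A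
    proof -
      obtain Z where Z: "Z \<in> borel_measurable M" "tendsto_in_probability M (\<lambda>n. sint (h n) A) Z"
        using h(3)[OF A] by blast
      obtain Z' where Z': "Z' \<in> borel_measurable M" "tendsto_in_probability M (\<lambda>n. sint (h' n) A) Z'"
        using h'(3)[OF A] by blast
      show ?thesis
        using diff[OF A Z(1) Z'(1) Z(2) Z'(2)] Z(1) Z'(1)
        by (intro bexI[of _ "\<lambda>\<omega>. Z \<omega> + - Z' \<omega>"] borel_measurable_add borel_measurable_uminus)
    qed
    show "tendsto_in_probability M (\<lambda>n. sint (d n) \<Omega>) (\<lambda>\<omega>. Y \<omega> + - Y' \<omega>)"
      using h(4) h'(4) sets.top[of m] by (intro diff) (auto simp: space_m)
  qed measurable
  then show ?thesis by eventually_elim simp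
qed

section \<open>The Luxemburg norm and the Minkowski inequality\<close>

abbreviation nrm :: "('s \<Rightarrow> real) \<Rightarrow> ennreal" where
  "nrm \<equiv> luxemburg_norm m \<sigma>2 \<nu>"

lemma nrm_eq: "nrm g = Inf {ennreal c | c. 0 < c \<and> modular (\<lambda>s. g s / c) \<le> 1}"
  by (simp add: luxemburg_norm_def modular_def divide_inverse mult.commute)

lemma nrm_le: "0 < c \<Longrightarrow> modular (\<lambda>s. g s / c) \<le> 1 \<Longrightarrow> nrm g \<le> ennreal c"
  unfolding nrm_eq by (intro Inf_lower) auto

text \<open>Strictness avoids the question whether the infimum is attained; monotonicity of the
  modular passes from an admissible constant to every larger one.\<close>

lemma modular_le_1_of_nrm_less:
  assumes "nrm g < ennreal c" shows "modular (\<lambda>s. g s / c) \<le> 1"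
proof -
  obtain c' where c': "0 < c'" "modular (\<lambda>s. g s / c') \<le> 1" "ennreal c' < ennreal c"
    using assms unfolding nrm_eq Inf_less_iff by auto
  then have "c' < c" by (simp add: ennreal_less_iff)
  then have "modular (\<lambda>s. g s / c) \<le> modular (\<lambda>s. g s / c')"
    using c'(1) by (intro modular_mono) (simp add: abs_divide divide_left_mono)
  then show ?thesis using c'(2) by (rule order_trans)
qed

lemma nrm_mono:
  assumes "\<And>s. s \<in> \<Omega> \<Longrightarrow> \<bar>g s\<bar> \<le> \<bar>g' s\<bar>" shows "nrm g \<le> nrm g'"
proof (cases "nrm g' < \<infinity>")
  case True
  then show ?thesis
  proof (rule ennreal_le_of_real_upper_bounds)
    fix c assume c: "0 < c" "nrm g' < ennreal c"
    have "modular (\<lambda>s. g s / c) \<le> modular (\<lambda>s. g' s / c)"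
      using assms c by (intro modular_mono) (simp add: abs_divide divide_right_mono)
    also have "\<dots> \<le> 1" using c(2) by (rule modular_le_1_of_nrm_less)
    finally show "nrm g \<le> ennreal c" using c by (intro nrm_le)
  qed
qed (simp add: not_less top_unique)

lemma nrm_scale_le:
  assumes "0 < a" shows "nrm (\<lambda>s. a * g s) \<le> ennreal a * nrm g"
proof (cases "nrm g < \<infinity>")
  case True
  show ?thesis
  proof (rule ennreal_le_of_real_upper_bounds)
    show "ennreal a * nrm g < \<infinity>" using True by (simp add: ennreal_mult_less_top)
    fix c assume c: "0 < c" "ennreal a * nrm g < ennreal c"
    obtain r where r: "nrm g = ennreal r" "0 \<le> r" using True by (cases "nrm g") auto
    have "a * r < c" using c r assms by (simp add: ennreal_mult[symmetric] ennreal_less_iff)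
    then have "r < c / a" using assms by (simp add: field_simps)
    then have "modular (\<lambda>s. g s / (c / a)) \<le> 1"
      using r by (intro modular_le_1_of_nrm_less) (simp add: ennreal_less_iff)
    then show "nrm (\<lambda>s. a * g s) \<le> ennreal c" using c assms by (intro nrm_le) (auto simp: mult.commute)
  qed
next
  case False
  then have "nrm g = top" by (simp add: less_top[symmetric])
  then show ?thesis using assms by (simp add: ennreal_mult_top)
qed

lemma nrm_zero [simp]: "nrm (\<lambda>s. 0) = 0"
proof -
  have "nrm (\<lambda>s. 0) \<le> 0" by (rule ennreal_le_of_real_upper_bounds) (auto intro!: nrm_le)
  then show ?thesis by simp
qed

text \<open>The factor 8 comes from \<open>phi_add\<close>; the lemma serves only to keep norm
  integrals finite.\<close>

lemma nrm_add:
  assumes [measurable]: "g \<in> borel_measurable m" "g' \<in> borel_measurable m"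
    and fin: "nrm g < \<infinity>" "nrm g' < \<infinity>"
  shows "nrm (\<lambda>s. g s + g' s) \<le> 8 * (nrm g + nrm g')"
proof (rule ennreal_le_of_real_upper_bounds)
  show "8 * (nrm g + nrm g') < \<infinity>" using fin by (simp add: ennreal_mult_less_top)
  fix c assume c: "0 < c" "8 * (nrm g + nrm g') < ennreal c"
  obtain a where a: "nrm g = ennreal a" "0 \<le> a" using fin by (cases "nrm g") auto
  obtain b where b: "nrm g' = ennreal b" "0 \<le> b" using fin by (cases "nrm g'") auto
  have "8 * (nrm g + nrm g') = ennreal (8 * (a + b))"
    unfolding a(1) b(1) using a(2) b(2) ennreal_mult[of 8 "a + b"] by (simp add: ennreal_plus)
  then have "ennreal (8 * (a + b)) < ennreal c" using c(2) by (simp only:)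
  then have "8 * (a + b) < c" by (subst (asm) ennreal_less_iff) (use a b in auto)
  then have "a < c / 8" "b < c / 8" using a b by auto
  then have *: "modular (\<lambda>s. g s / (c / 8)) \<le> 1" "modular (\<lambda>s. g' s / (c / 8)) \<le> 1"
    by - (rule modular_le_1_of_nrm_less, simp add: a b ennreal_less_iff)+
  have "modular (\<lambda>s. (g s + g' s) / c) = modular (\<lambda>s. (1 / 8) * (g s / (c / 8) + g' s / (c / 8)))"
    by (simp add: add_divide_distrib distrib_left)
  also have "\<dots> \<le> ennreal (1 / 8) * modular (\<lambda>s. g s / (c / 8) + g' s / (c / 8))"
    by (rule modular_scale_le_1) auto
  also have "\<dots> \<le> ennreal (1 / 8) * (4 * (modular (\<lambda>s. g s / (c / 8)) + modular (\<lambda>s. g' s / (c / 8))))"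
    by (intro mult_left_mono modular_add) auto
  also have "\<dots> \<le> ennreal (1 / 8) * (4 * (1 + 1))"
    using * by (intro mult_left_mono add_mono) auto
  also have "\<dots> = 1" using ennreal_mult[of "1 / 8" 8] by simp
  finally show "nrm (\<lambda>s. g s + g' s) \<le> ennreal c" using c(1) by (intro nrm_le)
qed

lemma nrm_finite:
  assumes [measurable]: "g \<in> borel_measurable m" and fin: "modular g < \<infinity>"
  shows "nrm g < \<infinity>"
proof -
  obtain r where r: "modular g = ennreal r" "0 \<le> r" using fin by (cases "modular g") auto
  have "modular (\<lambda>s. (1 / (1 + r)) * g s) \<le> ennreal (1 / (1 + r)) * modular g"
    using r by (intro modular_scale_le_1) auto
  also have "\<dots> \<le> 1"
    using r by (simp add: ennreal_mult[symmetric] divide_le_eq_1 flip: ennreal_1)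
  finally have "nrm g \<le> ennreal (1 + r)" using r by (intro nrm_le) auto
  then show ?thesis by (rule le_less_trans) simp
qed

text \<open>The quadratic dilation bound at 1/r: a modular below \<open>r^2\<close> gives norm at
  most r.\<close>

lemma nrm_tendsto_zero:
  assumes [measurable]: "\<And>n. g n \<in> borel_measurable m" and lim: "(\<lambda>n. modular (g n)) \<longlonglongrightarrow> 0"
  shows "(\<lambda>n. nrm (g n)) \<longlonglongrightarrow> 0"
proof (rule tendsto_zero_ennrealI)
  fix e :: real assume "0 < e"
  define r where "r = min 1 e"
  have r: "0 < r" "r \<le> 1" "r \<le> e" using \<open>0 < e\<close> by (auto simp: r_def)
  have "\<forall>\<^sub>F n in sequentially. modular (g n) < ennreal (r\<^sup>2)"
    using r by (intro tendsto_zero_ennrealD[OF lim]) auto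
  then show "\<forall>\<^sub>F n in sequentially. nrm (g n) \<le> ennreal e"
  proof eventually_elim
    case (elim n)
    have "modular (\<lambda>s. (1 / r) * g n s) \<le> ennreal ((1 / r)\<^sup>2) * modular (g n)"
      using r by (intro modular_scale_ge_1) auto
    also have "\<dots> \<le> ennreal ((1 / r)\<^sup>2) * ennreal (r\<^sup>2)" using elim by (intro mult_left_mono) auto
    also have "\<dots> = 1" using r by (simp add: ennreal_mult[symmetric] power_divide)
    finally have "nrm (g n) \<le> ennreal r" using r by (intro nrm_le) auto
    also have "\<dots> \<le> ennreal e" using r by (intro ennreal_leI)
    finally show ?case .
  qed
qed

lemma modular_less_of_nrm_less:
  assumes [measurable]: "g \<in> borel_measurable m" and r: "0 < r" "r \<le> 1" "nrm g < ennreal r"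
  shows "modular g \<le> ennreal r"
proof -
  have "modular g = modular (\<lambda>s. r * (g s / r))" using r by simp
  also have "\<dots> \<le> ennreal r * modular (\<lambda>s. g s / r)" using r by (intro modular_scale_le_1) auto
  also have "\<dots> \<le> ennreal r * 1" using modular_le_1_of_nrm_less[OF r(3)] by (intro mult_left_mono) auto
  finally show ?thesis by simp
qed

lemma modular_integral_nrm_bound:
  assumes J: "modular_integral g Y" and fin: "nrm g < \<infinity>"
  shows "dist1 Y (\<lambda>_. 0) \<le> 584 * nrm g"
proof (rule ennreal_le_of_real_upper_bounds)
  show "584 * nrm g < \<infinity>" using fin by (simp add: ennreal_mult_less_top)
  fix c assume c: "0 < c" "584 * nrm g < ennreal c"
  obtain r where r: "nrm g = ennreal r" "0 \<le> r" using fin by (cases "nrm g") auto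
  have "584 * r < c"
  proof -
    have "584 * ennreal r = ennreal (584 * r)" using ennreal_mult[of 584 r] r by simp
    then show ?thesis using c r by (simp add: ennreal_less_iff)
  qed
  then have "modular (\<lambda>s. g s / (c / 584)) \<le> 1"
    using r by (intro modular_le_1_of_nrm_less) (simp add: ennreal_less_iff)
  then show "dist1 Y (\<lambda>_. 0) \<le> ennreal c"
    using modular_integral_bound[OF J, of "c / 584"] c by simp
qed

text \<open>Every real c above the norm is admissible, so the condition \<open>nrm (f x) < a\<close>
  is witnessed by a rational c below a. The sublevel sets are thus countable unions of sets defined
  by the modular.\<close>

lemma nrm_measurable:
  assumes [measurable]: "case_prod f \<in> borel_measurable (N \<Otimes>\<^sub>M m)"
  shows "(\<lambda>x. nrm (f x)) \<in> borel_measurable N"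
proof (rule borel_measurableI_less)
  fix a :: ennreal
  have meas: "(\<lambda>x. modular (\<lambda>s. f x s / c)) \<in> borel_measurable N" for c
    unfolding modular_def by (rule m.borel_measurable_nn_integral) measurable
  have eq: "nrm (f x) < a \<longleftrightarrow> (\<exists>c\<in>{c\<in>\<rat>. 0 < c \<and> ennreal c < a}. modular (\<lambda>s. f x s / c) \<le> 1)" for x
  proof
    assume *: "nrm (f x) < a"
    then obtain b where b: "nrm (f x) < b" "b < a" using dense by blast
    then obtain b' where b': "b = ennreal b'" "0 \<le> b'" by (cases b) auto
    obtain r where r: "nrm (f x) = ennreal r" "0 \<le> r" using b(1) by (cases "nrm (f x)") auto
    have "r < b'" using b(1) b' r by (simp add: ennreal_less_iff)
    then obtain c where c: "c \<in> \<rat>" "r < c" "c < b'" using Rats_dense_in_real by blast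
    have "nrm (f x) < ennreal c" using c r by (simp add: ennreal_less_iff)
    then have "modular (\<lambda>s. f x s / c) \<le> 1" by (rule modular_le_1_of_nrm_less)
    moreover have "ennreal c < a" using le_less_trans[OF ennreal_leI[of c b']] c(3) b(2) b'(1) by simp
    ultimately show "\<exists>c\<in>{c\<in>\<rat>. 0 < c \<and> ennreal c < a}. modular (\<lambda>s. f x s / c) \<le> 1" using c r by force
  next
    assume "\<exists>c\<in>{c\<in>\<rat>. 0 < c \<and> ennreal c < a}. modular (\<lambda>s. f x s / c) \<le> 1"
    then show "nrm (f x) < a" using nrm_le le_less_trans by blast
  qed
  have "countable {c\<in>\<rat>. 0 < c \<and> ennreal c < a}" by (rule countable_subset[OF _ countable_rat]) auto
  moreover have "{x \<in> space N. nrm (f x) < a} =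
      (\<Union>c\<in>{c\<in>\<rat>. 0 < c \<and> ennreal c < a}. {x \<in> space N. modular (\<lambda>s. f x s / c) \<le> 1})"
    unfolding eq by auto
  moreover have "{x \<in> space N. modular (\<lambda>s. f x s / c) \<le> 1} \<in> sets N" for c
    using meas by measurable
  ultimately show "{x \<in> space N. nrm (f x) < a} \<in> sets N"
    by (simp only:) (rule sets.countable_UN', auto)
qed

lemma L_phi_iff: "g \<in> L_phi m \<sigma>2 \<nu> \<longleftrightarrow> g \<in> borel_measurable m \<and> modular g < \<infinity>"
proof (cases "g \<in> borel_measurable m")
  case [measurable]: True
  let ?I = "\<integral>\<^sup>+s. (ennreal ((g s)\<^sup>2 * \<sigma>2 s) + (\<integral>\<^sup>+u. ennreal (min (\<bar>u * g s\<bar>\<^sup>2) \<bar>u * g s\<bar>) \<partial>\<nu> s)) \<partial>m"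
  have k: "min (\<bar>t\<bar>\<^sup>2) \<bar>t\<bar> \<le> orlicz_kernel t" "orlicz_kernel t \<le> 2 * min (\<bar>t\<bar>\<^sup>2) \<bar>t\<bar>" for t :: real
  proof -
    have "min (\<bar>t\<bar>\<^sup>2) \<bar>t\<bar> = \<bar>t\<bar> * min 1 \<bar>t\<bar>"
      unfolding power2_eq_square by (subst min_mult_distrib_left) (simp add: min.commute)
    then show "min (\<bar>t\<bar>\<^sup>2) \<bar>t\<bar> \<le> orlicz_kernel t" "orlicz_kernel t \<le> 2 * min (\<bar>t\<bar>\<^sup>2) \<bar>t\<bar>"
      using orlicz_kernel_ge[of t] orlicz_kernel_le[of t] by simp_all
  qed
  have "?I \<le> modular g"
    unfolding modular_def levy_phi_eq by (intro nn_integral_mono add_mono ennreal_leI k) simp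
  \<comment> \<open>The constant is taken out on the side of \<phi>, whose measurability is known,
    so that no measurability of the integrand of \<open>?I\<close> enters.\<close>
  moreover have "modular g / 2 \<le> ?I"
  proof -
    have "modular g / 2 = (\<integral>\<^sup>+s. \<phi> (g s) s / 2 \<partial>m)"
      unfolding modular_def by (rule nn_integral_divide[symmetric]) measurable
    also have "\<dots> \<le> ?I"
    proof (rule nn_integral_mono)
      fix s assume "s \<in> space m"
      then have s: "s \<in> \<Omega>" by (simp add: space_m)
      note [simp] = measurable_\<nu>_iff[OF s]
      have "\<phi> (g s) s \<le> ennreal (2 * ((g s)\<^sup>2 * \<sigma>2 s)) + (\<integral>\<^sup>+u. ennreal (2 * min (\<bar>u * g s\<bar>\<^sup>2) \<bar>u * g s\<bar>) \<partial>\<nu> s)"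
        unfolding levy_phi_eq using nonneg_\<sigma>2[OF s]
        by (intro nn_integral_mono add_mono ennreal_leI k) simp
      also have "\<dots> = (ennreal ((g s)\<^sup>2 * \<sigma>2 s) + (\<integral>\<^sup>+u. ennreal (min (\<bar>u * g s\<bar>\<^sup>2) \<bar>u * g s\<bar>) \<partial>\<nu> s)) * 2"
        by (simp add: ennreal_mult' distrib_left nn_integral_cmult mult.commute[of _ 2])
      finally show "\<phi> (g s) s / 2 \<le> ennreal ((g s)\<^sup>2 * \<sigma>2 s) + (\<integral>\<^sup>+u. ennreal (min (\<bar>u * g s\<bar>\<^sup>2) \<bar>u * g s\<bar>) \<partial>\<nu> s)"
        by (intro divide_le_posI_ennreal) (simp_all add: mult.commute)
    qed
    finally show ?thesis .
  qed
  moreover have "top / 2 = (top :: ennreal)" by (simp add: ennreal_divide_eq_top_iff)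
  ultimately have "?I < \<infinity> \<longleftrightarrow> modular g < \<infinity>"
    by (auto intro: le_less_trans simp: less_top[symmetric] top_unique)
  then show ?thesis by (simp add: L_phi_def)
qed (simp add: L_phi_def)

lemma phi_finite:
  assumes "s \<in> \<Omega>" "\<phi> 1 s < \<infinity>" shows "\<phi> y s < \<infinity>"
proof -
  have "\<phi> y s \<le> \<phi> (max 1 \<bar>y\<bar> * 1) s" using assms by (intro phi_mono) auto
  also have "\<dots> \<le> ennreal ((max 1 \<bar>y\<bar>)\<^sup>2) * \<phi> 1 s" using assms by (intro phi_scale_ge_1) auto
  also have "\<dots> < \<infinity>" using assms by (simp add: ennreal_mult_less_top)
  finally show ?thesis .
qed

text \<open>Jensen's inequality. Integrating a supporting line works in \<open>[0, \<infinity>]\<close>, where \<open>\<integral> \<bar>g\<bar> p\<close> may be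
  infinite: excluding that case is what shows below that \<open>f(_, s)\<close> is integrable.\<close>

lemma phi_jensen:
  assumes s: "s \<in> \<Omega>" "\<phi> 1 s < \<infinity>"
    and [measurable]: "g \<in> borel_measurable \<mu>" "p \<in> borel_measurable \<mu>"
    and p: "(\<integral>\<^sup>+x. p x \<partial>\<mu>) \<le> 1"
    and t0: "0 \<le> t0" "ennreal t0 \<le> (\<integral>\<^sup>+x. ennreal \<bar>g x\<bar> * p x \<partial>\<mu>)"
  shows "\<phi> t0 s \<le> (\<integral>\<^sup>+x. \<phi> (g x) s * p x \<partial>\<mu>)"
proof -
  obtain l d where ld: "d < \<infinity>" "l * ennreal t0 = \<phi> t0 s + d"
    "\<And>t. 0 \<le> t \<Longrightarrow> l * ennreal t \<le> \<phi> t s + d"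
    by (rule phi_tangent[OF s(1) phi_finite[OF s] t0(1)]) (rule that)
  have [measurable]: "(\<lambda>x. \<phi> (g x) s) \<in> borel_measurable \<mu>"
    by (rule phi_measurable_compose) (use s(1) in \<open>auto simp: space_m\<close>)
  have "\<phi> t0 s + d \<le> l * (\<integral>\<^sup>+x. ennreal \<bar>g x\<bar> * p x \<partial>\<mu>)"
    unfolding ld(2)[symmetric] using t0(2) by (rule mult_left_mono) simp
  also have "\<dots> = (\<integral>\<^sup>+x. (l * ennreal \<bar>g x\<bar>) * p x \<partial>\<mu>)"
    by (subst nn_integral_cmult[symmetric]) (auto simp: mult.assoc)
  also have "\<dots> \<le> (\<integral>\<^sup>+x. (\<phi> (g x) s + d) * p x \<partial>\<mu>)"
    using ld(3)[of "\<bar>g x\<bar>" for x] by (intro nn_integral_mono mult_right_mono) (auto simp: phi_abs[OF s(1)])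
  also have "\<dots> = (\<integral>\<^sup>+x. \<phi> (g x) s * p x \<partial>\<mu>) + d * (\<integral>\<^sup>+x. p x \<partial>\<mu>)"
    by (simp add: distrib_right nn_integral_add nn_integral_cmult)
  \<comment> \<open>Total mass below one is harmless, because the ordinate - d of the supporting
    line is nonpositive.\<close>
  also have "\<dots> \<le> (\<integral>\<^sup>+x. \<phi> (g x) s * p x \<partial>\<mu>) + d * 1"
    using p by (intro add_left_mono mult_left_mono) auto
  finally have "d + \<phi> t0 s \<le> d + (\<integral>\<^sup>+x. \<phi> (g x) s * p x \<partial>\<mu>)" by (simp add: add.commute)
  then show ?thesis using ld(1) by (auto simp: ennreal_add_left_cancel_le)
qed

text \<open>Write \<open>f x s / c\<close> as \<open>(f x s / q x) (q x / c)\<close>: the integral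
  divided by c becomes an average, with density q / c of mass at most 1, of functions of modular at
  most 1. Jensen's inequality for each s and Tonelli's theorem bound its modular by 1.\<close>

lemma nrm_minkowski_aux:
  fixes f :: "'t \<Rightarrow> 's \<Rightarrow> real" and q :: "'t \<Rightarrow> real"
  assumes \<mu>: "sigma_finite_measure \<mu>"
    and f [measurable]: "case_prod f \<in> borel_measurable (\<mu> \<Otimes>\<^sub>M m)"
    and q [measurable]: "q \<in> borel_measurable \<mu>" and q_pos: "\<And>x. x \<in> space \<mu> \<Longrightarrow> 0 < q x"
    and c: "0 < c" and q_int: "(\<integral>\<^sup>+x. ennreal (q x) \<partial>\<mu>) \<le> ennreal c"
    and mod: "AE x in \<mu>. modular (\<lambda>s. f x s / q x) \<le> 1"
  shows "(AE s in m. integrable \<mu> (\<lambda>x. f x s)) \<and> modular (\<lambda>s. (\<integral>x. f x s \<partial>\<mu>) / c) \<le> 1"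
proof -
  interpret \<mu>: sigma_finite_measure \<mu> by fact
  interpret P: pair_sigma_finite \<mu> m ..
  define p where "p x = ennreal (q x / c)" for x
  have [measurable]: "p \<in> borel_measurable \<mu>" unfolding p_def by measurable
  have p_int: "(\<integral>\<^sup>+x. p x \<partial>\<mu>) \<le> 1"
  proof -
    have "(\<integral>\<^sup>+x. p x \<partial>\<mu>) = (\<integral>\<^sup>+x. ennreal (1 / c) * ennreal (q x) \<partial>\<mu>)"
      unfolding p_def using c by (intro nn_integral_cong) (simp add: ennreal_mult'[symmetric])
    also have "\<dots> = ennreal (1 / c) * (\<integral>\<^sup>+x. ennreal (q x) \<partial>\<mu>)" by (rule nn_integral_cmult) measurable
    also have "\<dots> \<le> ennreal (1 / c) * ennreal c" using q_int by (rule mult_left_mono) simp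
    also have "\<dots> = 1" using c by (simp add: ennreal_mult[symmetric])
    finally show ?thesis .
  qed
  define H where "H s = (\<integral>\<^sup>+x. \<phi> (f x s / q x) s * p x \<partial>\<mu>)" for s
  have fs [measurable]: "(\<lambda>x. f x s) \<in> borel_measurable \<mu>" if "s \<in> space m" for s
    using that by measurable
  have [measurable]: "(\<lambda>(x, s). \<phi> (f x s / q x) s * p x) \<in> borel_measurable (\<mu> \<Otimes>\<^sub>M m)" by measurable
  have H_meas [measurable]: "H \<in> borel_measurable m"
    unfolding H_def by (rule \<mu>.borel_measurable_nn_integral) measurable
  have "(\<integral>\<^sup>+s. H s \<partial>m) = (\<integral>\<^sup>+x. (\<integral>\<^sup>+s. \<phi> (f x s / q x) s * p x \<partial>m) \<partial>\<mu>)"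
    unfolding H_def by (rule P.Fubini') measurable
  also have "\<dots> = (\<integral>\<^sup>+x. modular (\<lambda>s. f x s / q x) * p x \<partial>\<mu>)"
    unfolding modular_def by (intro nn_integral_cong nn_integral_multc) measurable
  also have "\<dots> \<le> (\<integral>\<^sup>+x. 1 * p x \<partial>\<mu>)"
    by (intro nn_integral_mono_AE, use mod in eventually_elim) (rule mult_right_mono; simp)
  also have "\<dots> \<le> 1" using p_int by simp
  finally have H_int: "(\<integral>\<^sup>+s. H s \<partial>m) \<le> 1" .
  have "AE s in m. H s \<noteq> \<infinity>"
    using H_int by (intro nn_integral_PInf_AE H_meas) (auto simp: top_unique)
  then have main: "AE s in m. integrable \<mu> (\<lambda>x. f x s) \<and> \<phi> ((\<integral>x. f x s \<partial>\<mu>) / c) s \<le> H s"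
    using AE_phi_finite AE_phi_pos AE_space
  proof eventually_elim
    case (elim s)
    then have s: "s \<in> \<Omega>" by (simp add: space_m)
    note [measurable] = fs[OF elim(4)]
    define G where "G = (\<integral>\<^sup>+x. ennreal \<bar>f x s\<bar> \<partial>\<mu>)"
    have G_eq: "(\<integral>\<^sup>+x. ennreal \<bar>f x s / q x\<bar> * p x \<partial>\<mu>) = ennreal (1 / c) * G"
    proof -
      have "ennreal \<bar>f x s / q x\<bar> * p x = ennreal (1 / c) * ennreal \<bar>f x s\<bar>" if "x \<in> space \<mu>" for x
        using q_pos[OF that] c by (simp add: p_def ennreal_mult[symmetric])
      then have "(\<integral>\<^sup>+x. ennreal \<bar>f x s / q x\<bar> * p x \<partial>\<mu>) = (\<integral>\<^sup>+x. ennreal (1 / c) * ennreal \<bar>f x s\<bar> \<partial>\<mu>)"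
        by (rule nn_integral_cong)
      also have "\<dots> = ennreal (1 / c) * G" unfolding G_def by (rule nn_integral_cmult) measurable
      finally show ?thesis .
    qed
    have jensen: "\<phi> t s \<le> H s" if "0 \<le> t" "ennreal t \<le> ennreal (1 / c) * G" for t
      unfolding H_def using that elim s p_int by (intro phi_jensen) (simp_all only: G_eq, measurable)
    have "G < \<infinity>"
    proof (rule ccontr)
      assume "\<not> G < \<infinity>"
      then have "ennreal (1 / c) * G = top" using c by (simp add: less_top[symmetric] ennreal_mult_top)
      then have *: "\<phi> t s \<le> H s" if "0 \<le> t" for t using jensen[OF that] by simp
      obtain r where r: "H s = ennreal r" "0 \<le> r" using elim by (cases "H s") auto
      obtain a where a: "\<phi> 1 s = ennreal a" "0 < a" using elim by (cases "\<phi> 1 s") auto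
      \<comment> \<open>Then \<open>t a = a + r\<close> exceeds r, against the linear growth of
        \<phi>.\<close>
      define t where "t = 1 + r / a"
      have "1 \<le> t" using r a by (simp add: t_def)
      then have "ennreal t * \<phi> 1 s \<le> H s" using phi_ge_linear[OF s, of t] *[of t] by simp
      then have "t * a \<le> r" using a r \<open>1 \<le> t\<close> by (simp add: ennreal_mult[symmetric])
      moreover have "t * a = a + r" using a by (simp add: t_def field_simps)
      ultimately show False using a by simp
    qed
    then have int: "integrable \<mu> (\<lambda>x. f x s)" unfolding G_def by (intro integrableI_bounded) auto
    obtain r where r: "G = ennreal r" "0 \<le> r" using \<open>G < \<infinity>\<close> by (cases G) auto
    have "ennreal \<bar>\<integral>x. f x s \<partial>\<mu>\<bar> \<le> ennreal r"
      using integral_norm_bound_ennreal[OF int] r(1) by (simp add: G_def)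
    then have "\<bar>(\<integral>x. f x s \<partial>\<mu>) / c\<bar> \<le> \<bar>r / c\<bar>"
      using r c by (simp add: abs_divide divide_right_mono)
    then have "\<phi> ((\<integral>x. f x s \<partial>\<mu>) / c) s \<le> \<phi> (r / c) s" by (intro phi_mono s)
    also have "\<dots> \<le> H s" using r c by (intro jensen) (auto simp: ennreal_mult[symmetric])
    finally show ?case using int by simp
  qed
  have "modular (\<lambda>s. (\<integral>x. f x s \<partial>\<mu>) / c) \<le> (\<integral>\<^sup>+s. H s \<partial>m)"
    unfolding modular_def using main by (intro nn_integral_mono_AE) auto
  then show ?thesis using main H_int by auto
qed

lemma nrm_minkowski:
  fixes f :: "'t \<Rightarrow> 's \<Rightarrow> real"
  assumes \<mu>: "sigma_finite_measure \<mu>"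
    and f [measurable]: "case_prod f \<in> borel_measurable (\<mu> \<Otimes>\<^sub>M m)"
    and fin: "(\<integral>\<^sup>+x. nrm (f x) \<partial>\<mu>) < \<infinity>"
  shows "AE s in m. integrable \<mu> (\<lambda>x. f x s)"
    and "nrm (\<lambda>s. \<integral>x. f x s \<partial>\<mu>) \<le> (\<integral>\<^sup>+x. nrm (f x) \<partial>\<mu>)"
    and "modular (\<lambda>s. \<integral>x. f x s \<partial>\<mu>) < \<infinity>"
    and "(\<lambda>s. \<integral>x. f x s \<partial>\<mu>) \<in> borel_measurable m"
proof -
  interpret \<mu>: sigma_finite_measure \<mu> by fact
  have nrm_meas [measurable]: "(\<lambda>x. nrm (f x)) \<in> borel_measurable \<mu>" using f by (rule nrm_measurable)
  \<comment> \<open>The norm of \<open>f x\<close> may vanish, but the weight must be positive and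
    strictly above it. A small multiple of w provides the gap at an arbitrarily small cost in the
    integral.\<close>
  obtain w where w [measurable]: "w \<in> borel_measurable \<mu>" and w_fin: "(\<integral>\<^sup>+x. w x \<partial>\<mu>) \<noteq> \<infinity>"
    and w_pos: "\<And>x. x \<in> space \<mu> \<Longrightarrow> 0 < w x \<and> w x < \<infinity>"
    using \<mu>.Ex_finite_integrable_function by auto
  obtain W where W: "(\<integral>\<^sup>+x. w x \<partial>\<mu>) = ennreal W" "0 \<le> W" using w_fin by (cases "\<integral>\<^sup>+x. w x \<partial>\<mu>") auto
  obtain I where I: "(\<integral>\<^sup>+x. nrm (f x) \<partial>\<mu>) = ennreal I" "0 \<le> I" using fin by (cases "\<integral>\<^sup>+x. nrm (f x) \<partial>\<mu>") auto
  have nrm_fin: "AE x in \<mu>. nrm (f x) \<noteq> \<infinity>" using fin by (intro nn_integral_PInf_AE) auto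
  have main: "(AE s in m. integrable \<mu> (\<lambda>x. f x s)) \<and> modular (\<lambda>s. (\<integral>x. f x s \<partial>\<mu>) / c) \<le> 1" if c: "I < c" for c
  proof -
    \<comment> \<open>W + 1 instead of W, since W may be 0.\<close>
    define \<delta> where "\<delta> = (c - I) / (W + 1)"
    have \<delta>: "0 < \<delta>" "\<delta> * W \<le> c - I"
      using c W by (auto simp: \<delta>_def divide_simps mult_left_mono)
    \<comment> \<open>\<open>enn2real\<close> sends an infinite norm to 0, which affects a null set
      only.\<close>
    define q where "q x = enn2real (nrm (f x)) + \<delta> * enn2real (w x)" for x
    show ?thesis
    proof (rule nrm_minkowski_aux[OF \<mu> f])
      show "q \<in> borel_measurable \<mu>" unfolding q_def by measurable
      show "0 < q x" if "x \<in> space \<mu>" for x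
        using w_pos[OF that] \<delta> by (auto simp: q_def enn2real_positive_iff less_top intro!: add_nonneg_pos)
      show "0 < c" using c I by simp
      have "(\<integral>\<^sup>+x. ennreal (q x) \<partial>\<mu>) = (\<integral>\<^sup>+x. nrm (f x) + ennreal \<delta> * w x \<partial>\<mu>)"
      proof (rule nn_integral_cong_AE)
        show "AE x in \<mu>. ennreal (q x) = nrm (f x) + ennreal \<delta> * w x"
          using nrm_fin AE_space
        proof eventually_elim
          case (elim x)
          then show ?case using w_pos[of x] \<delta>
            by (simp add: q_def ennreal_mult' less_top)
        qed
      qed
      also have "\<dots> = ennreal I + ennreal \<delta> * ennreal W"
        by (simp add: nn_integral_add nn_integral_cmult I W)
      also have "\<dots> = ennreal (I + \<delta> * W)" using I \<delta> W by (simp add: ennreal_mult)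
      also have "\<dots> \<le> ennreal c" using \<delta> by (intro ennreal_leI) simp
      finally show "(\<integral>\<^sup>+x. ennreal (q x) \<partial>\<mu>) \<le> ennreal c" .
      show "AE x in \<mu>. modular (\<lambda>s. f x s / q x) \<le> 1"
        using nrm_fin AE_space
      proof eventually_elim
        case (elim x)
        have "0 < \<delta> * enn2real (w x)"
          using w_pos[OF elim(2)] \<delta> by (auto simp: enn2real_positive_iff less_top)
        moreover obtain r where r: "nrm (f x) = ennreal r" "0 \<le> r"
          using elim(1) by (cases "nrm (f x)") auto
        ultimately have "nrm (f x) < ennreal (q x)"
          unfolding q_def r(1) by (subst ennreal_less_iff) simp_all
        then show ?case by (rule modular_le_1_of_nrm_less)
      qed
    qed
  qed
  show "AE s in m. integrable \<mu> (\<lambda>x. f x s)" using main[of "I + 1"] by simp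
  show meas [measurable]: "(\<lambda>s. \<integral>x. f x s \<partial>\<mu>) \<in> borel_measurable m"
    by (rule \<mu>.borel_measurable_lebesgue_integral) measurable
  show "nrm (\<lambda>s. \<integral>x. f x s \<partial>\<mu>) \<le> (\<integral>\<^sup>+x. nrm (f x) \<partial>\<mu>)"
  proof (rule ennreal_le_of_real_upper_bounds[OF fin])
    fix c assume c: "0 < c" "(\<integral>\<^sup>+x. nrm (f x) \<partial>\<mu>) < ennreal c"
    then have "I < c" unfolding I(1) using I(2) by (simp only: ennreal_less_iff)
    then show "nrm (\<lambda>s. \<integral>x. f x s \<partial>\<mu>) \<le> ennreal c" using main[OF \<open>I < c\<close>] by (intro nrm_le c(1)) simp
  qed
  have "modular (\<lambda>s. (I + 1) * ((\<integral>x. f x s \<partial>\<mu>) / (I + 1))) < \<infinity>"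
  proof (rule modular_scale_finite)
    show "modular (\<lambda>s. (\<integral>x. f x s \<partial>\<mu>) / (I + 1)) < \<infinity>"
      using main[of "I + 1"] by (auto intro: le_less_trans[of _ 1])
  qed measurable
  then show "modular (\<lambda>s. \<integral>x. f x s \<partial>\<mu>) < \<infinity>" using I by simp
qed

end

section \<open>Interchange of the integrals\<close>

text \<open>Requiring \<open>space \<mu> = UNIV\<close> makes every section \<open>f x\<close>
  measurable, so that statements may range over all x.\<close>

locale levy_fubini = centered_levy_characteristics M \<Omega> R \<Lambda> m \<sigma>2 \<nu>
  for M :: "'w measure" and \<Omega> :: "'s set" and R :: "'s set set" and \<Lambda> :: "'s set \<Rightarrow> 'w \<Rightarrow> real"
    and m :: "'s measure" and \<sigma>2 :: "'s \<Rightarrow> real" and \<nu> :: "'s \<Rightarrow> real measure" +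
  fixes \<mu> :: "'t measure"
  assumes space_\<mu>: "space \<mu> = UNIV" and sigma_finite_\<mu>: "sigma_finite_measure \<mu>"
begin

sublocale \<mu>: sigma_finite_measure \<mu>
  by (rule sigma_finite_\<mu>)

sublocale \<mu>M: pair_sigma_finite \<mu> M ..

definition norm_integrable :: "('t \<Rightarrow> 's \<Rightarrow> real) \<Rightarrow> bool" where
  "norm_integrable f \<longleftrightarrow> case_prod f \<in> borel_measurable (\<mu> \<Otimes>\<^sub>M m) \<and> (\<forall>x. modular (f x) < \<infinity>) \<and>
    (\<integral>\<^sup>+x. nrm (f x) \<partial>\<mu>) < \<infinity>"

definition joint_integral :: "('t \<Rightarrow> 's \<Rightarrow> real) \<Rightarrow> ('t \<Rightarrow> 'w \<Rightarrow> real) \<Rightarrow> bool" where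
  "joint_integral f Y \<longleftrightarrow> case_prod Y \<in> borel_measurable (\<mu> \<Otimes>\<^sub>M M) \<and> (\<forall>x. modular_integral (f x) (Y x))"

text \<open>One jointly measurable version is enough here; the others are reached at the end through
  uniqueness.\<close>

definition fubini :: "('t \<Rightarrow> 's \<Rightarrow> real) \<Rightarrow> bool" where
  "fubini f \<longleftrightarrow> norm_integrable f \<and> (\<exists>Y. joint_integral f Y \<and>
    modular_integral (\<lambda>s. \<integral>x. f x s \<partial>\<mu>) (\<lambda>\<omega>. \<integral>x. Y x \<omega> \<partial>\<mu>))"

lemma norm_integrableD:
  assumes "norm_integrable f"
  shows "case_prod f \<in> borel_measurable (\<mu> \<Otimes>\<^sub>M m)" "f x \<in> borel_measurable m"
    "modular (f x) < \<infinity>" "(\<integral>\<^sup>+x. nrm (f x) \<partial>\<mu>) < \<infinity>" "nrm (f x) < \<infinity>"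
    "(\<lambda>x. nrm (f x)) \<in> borel_measurable \<mu>"
proof -
  show f [measurable]: "case_prod f \<in> borel_measurable (\<mu> \<Otimes>\<^sub>M m)"
    and fin: "modular (f x) < \<infinity>" and "(\<integral>\<^sup>+x. nrm (f x) \<partial>\<mu>) < \<infinity>"
    using assms by (auto simp: norm_integrable_def)
  show fx: "f x \<in> borel_measurable m"
    using measurable_Pair2[OF f, of x] by (simp add: space_\<mu>)
  show "nrm (f x) < \<infinity>" using fx fin by (rule nrm_finite)
  show "(\<lambda>x. nrm (f x)) \<in> borel_measurable \<mu>" using f by (rule nrm_measurable)
qed

lemma norm_integrable_mono:
  assumes F: "norm_integrable F" and f: "case_prod f \<in> borel_measurable (\<mu> \<Otimes>\<^sub>M m)"
    and le: "\<And>x s. s \<in> \<Omega> \<Longrightarrow> \<bar>f x s\<bar> \<le> \<bar>F x s\<bar>"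
  shows "norm_integrable f"
proof -
  have "modular (f x) < \<infinity>" for x
    using modular_mono[of "f x" "F x"] le norm_integrableD(3)[OF F, of x] by (auto intro: le_less_trans)
  moreover have "(\<integral>\<^sup>+x. nrm (f x) \<partial>\<mu>) \<le> (\<integral>\<^sup>+x. nrm (F x) \<partial>\<mu>)"
    by (intro nn_integral_mono nrm_mono le)
  ultimately show ?thesis
    using f norm_integrableD(4)[OF F] by (auto simp: norm_integrable_def intro: le_less_trans)
qed

lemma norm_integrable_scale:
  assumes "norm_integrable f" shows "norm_integrable (\<lambda>x s. a * f x s)"
proof -
  note [measurable] = norm_integrableD(1,2,6)[OF assms]
  define b where "b = max 1 \<bar>a\<bar>"
  have b: "0 < b" "\<bar>a\<bar> \<le> b" by (auto simp: b_def)
  have "(\<integral>\<^sup>+x. nrm (\<lambda>s. a * f x s) \<partial>\<mu>) \<le> (\<integral>\<^sup>+x. ennreal b * nrm (f x) \<partial>\<mu>)"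
  proof (rule nn_integral_mono)
    fix x
    have "nrm (\<lambda>s. a * f x s) \<le> nrm (\<lambda>s. b * f x s)"
      using b by (intro nrm_mono) (auto simp: abs_mult intro!: mult_right_mono)
    also have "\<dots> \<le> ennreal b * nrm (f x)" using b by (intro nrm_scale_le)
    finally show "nrm (\<lambda>s. a * f x s) \<le> ennreal b * nrm (f x)" .
  qed
  also have "\<dots> = ennreal b * (\<integral>\<^sup>+x. nrm (f x) \<partial>\<mu>)" by (rule nn_integral_cmult) measurable
  also have "\<dots> < \<infinity>" using norm_integrableD(4)[OF assms] by (simp add: ennreal_mult_less_top)
  finally have "(\<integral>\<^sup>+x. nrm (\<lambda>s. a * f x s) \<partial>\<mu>) < \<infinity>" .
  moreover have "modular (\<lambda>s. a * f x s) < \<infinity>" for x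
    by (rule modular_scale_finite[OF norm_integrableD(2,3)[OF assms]])
  ultimately show ?thesis by (auto simp: norm_integrable_def)
qed

lemma norm_integrable_add:
  assumes f: "norm_integrable f" and g: "norm_integrable g"
  shows "norm_integrable (\<lambda>x s. f x s + g x s)"
proof -
  note [measurable] = norm_integrableD(1,2,6)[OF f] norm_integrableD(1,2,6)[OF g]
  have "(\<integral>\<^sup>+x. nrm (\<lambda>s. f x s + g x s) \<partial>\<mu>) \<le> (\<integral>\<^sup>+x. 8 * (nrm (f x) + nrm (g x)) \<partial>\<mu>)"
  proof (rule nn_integral_mono)
    fix x
    show "nrm (\<lambda>s. f x s + g x s) \<le> 8 * (nrm (f x) + nrm (g x))"
      by (rule nrm_add[OF norm_integrableD(2)[OF f] norm_integrableD(2)[OF g] norm_integrableD(5)[OF f] norm_integrableD(5)[OF g]])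
  qed
  also have "\<dots> = 8 * ((\<integral>\<^sup>+x. nrm (f x) \<partial>\<mu>) + (\<integral>\<^sup>+x. nrm (g x) \<partial>\<mu>))"
    by (simp add: nn_integral_cmult nn_integral_add)
  also have "\<dots> < \<infinity>" using norm_integrableD(4)[OF f] norm_integrableD(4)[OF g] by (simp add: ennreal_mult_less_top)
  finally have "(\<integral>\<^sup>+x. nrm (\<lambda>s. f x s + g x s) \<partial>\<mu>) < \<infinity>" .
  moreover have "modular (\<lambda>s. f x s + g x s) < \<infinity>" for x
  proof (rule le_less_trans[OF modular_add])
    show "4 * (modular (f x) + modular (g x)) < \<infinity>"
      using norm_integrableD(3)[OF f, of x] norm_integrableD(3)[OF g, of x] by (simp add: ennreal_mult_less_top)
  qed measurable
  ultimately show ?thesis by (auto simp: norm_integrable_def)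
qed

lemma norm_integrable_integral:
  assumes "norm_integrable f"
  shows "AE s in m. integrable \<mu> (\<lambda>x. f x s)"
    and "nrm (\<lambda>s. \<integral>x. f x s \<partial>\<mu>) \<le> (\<integral>\<^sup>+x. nrm (f x) \<partial>\<mu>)"
    and "modular (\<lambda>s. \<integral>x. f x s \<partial>\<mu>) < \<infinity>"
    and "(\<lambda>s. \<integral>x. f x s \<partial>\<mu>) \<in> borel_measurable m"
  using nrm_minkowski[OF sigma_finite_\<mu> norm_integrableD(1,4)[OF assms]] by auto

lemma joint_integralD:
  assumes "joint_integral f Y"
  shows "case_prod Y \<in> borel_measurable (\<mu> \<Otimes>\<^sub>M M)" "modular_integral (f x) (Y x)"
    "Y x \<in> borel_measurable M"
  using assms modular_integralD[of "f x" "Y x"] by (auto simp: joint_integral_def)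

text \<open>The exceptional event depends on x. Tonelli's theorem exchanges the quantifiers: the
  double integral of \<open>|Y - Y'|\<close> vanishes in one order, hence in the other.\<close>

lemma AE_eq_of_l1_dist_integral_zero:
  fixes Y Y' :: "'t \<Rightarrow> 'w \<Rightarrow> real"
  assumes Y [measurable]: "case_prod Y \<in> borel_measurable (\<mu> \<Otimes>\<^sub>M M)" "case_prod Y' \<in> borel_measurable (\<mu> \<Otimes>\<^sub>M M)"
    and eq: "\<And>x. AE \<omega> in M. Y x \<omega> = Y' x \<omega>"
  shows "AE \<omega> in M. AE x in \<mu>. Y x \<omega> = Y' x \<omega>"
proof -
  have "(\<integral>\<^sup>+\<omega>. (\<integral>\<^sup>+x. ennreal \<bar>Y x \<omega> - Y' x \<omega>\<bar> \<partial>\<mu>) \<partial>M) = (\<integral>\<^sup>+x. dist1 (Y x) (Y' x) \<partial>\<mu>)"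
    unfolding l1_dist_def by (rule \<mu>M.Fubini') measurable
  also have "\<dots> = (\<integral>\<^sup>+x. 0 \<partial>\<mu>)"
  proof (rule nn_integral_cong)
    fix x
    have "dist1 (Y x) (Y' x) = dist1 (Y x) (Y x)" using eq[of x] by (intro l1_dist_cong_AE) auto
    then show "dist1 (Y x) (Y' x) = 0" by (simp add: l1_dist_def)
  qed
  finally have "(\<integral>\<^sup>+\<omega>. (\<integral>\<^sup>+x. ennreal \<bar>Y x \<omega> - Y' x \<omega>\<bar> \<partial>\<mu>) \<partial>M) = 0" by simp
  moreover have "(\<lambda>\<omega>. \<integral>\<^sup>+x. ennreal \<bar>Y x \<omega> - Y' x \<omega>\<bar> \<partial>\<mu>) \<in> borel_measurable M"
    by (rule \<mu>.borel_measurable_nn_integral) measurable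
  ultimately have "AE \<omega> in M. (\<integral>\<^sup>+x. ennreal \<bar>Y x \<omega> - Y' x \<omega>\<bar> \<partial>\<mu>) = 0"
    by (simp add: nn_integral_0_iff_AE)
  with AE_space show ?thesis
  proof eventually_elim
    case (elim \<omega>)
    have "(\<lambda>x. ennreal \<bar>Y x \<omega> - Y' x \<omega>\<bar>) \<in> borel_measurable \<mu>" using elim(1) by measurable
    then have "AE x in \<mu>. ennreal \<bar>Y x \<omega> - Y' x \<omega>\<bar> = 0"
      using elim(2) by (simp add: nn_integral_0_iff_AE)
    then show ?case by eventually_elim (simp add: ennreal_eq_0_iff)
  qed
qed

text \<open>The mean of \<open>|Y x|\<close> is at most 584 times the norm of \<open>f x\<close>, so
  Y is integrable on the product space and the ordinary Fubini theorem applies.\<close>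

lemma joint_integral_integrable:
  assumes f: "norm_integrable f" and Y: "joint_integral f Y"
  shows "AE \<omega> in M. integrable \<mu> (\<lambda>x. Y x \<omega>)"
    and "integrable M (\<lambda>\<omega>. \<integral>x. Y x \<omega> \<partial>\<mu>)"
proof -
  note [measurable] = norm_integrableD(1,2,6)[OF f] joint_integralD(1)[OF Y]
  have "(\<integral>\<^sup>+x. (\<integral>\<^sup>+\<omega>. ennreal (norm (Y x \<omega>)) \<partial>M) \<partial>\<mu>) \<le> (\<integral>\<^sup>+x. 584 * nrm (f x) \<partial>\<mu>)"
    using modular_integral_nrm_bound[OF joint_integralD(2)[OF Y] norm_integrableD(5)[OF f]]
    by (intro nn_integral_mono) (simp add: l1_dist_def)
  also have "\<dots> = 584 * (\<integral>\<^sup>+x. nrm (f x) \<partial>\<mu>)" by (rule nn_integral_cmult) measurable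
  also have "\<dots> < \<infinity>" using norm_integrableD(4)[OF f] by (simp add: ennreal_mult_less_top)
  finally have "integrable (\<mu> \<Otimes>\<^sub>M M) (case_prod Y)"
    by (intro integrableI_bounded) (auto simp: nn_integral_fst[symmetric])
  then show "AE \<omega> in M. integrable \<mu> (\<lambda>x. Y x \<omega>)" "integrable M (\<lambda>\<omega>. \<integral>x. Y x \<omega> \<partial>\<mu>)"
    using \<mu>M.AE_integrable_snd[of Y] \<mu>M.integrable_snd[of Y] by auto
qed

lemma l1_dist_integral_le:
  fixes Y Y' :: "'t \<Rightarrow> 'w \<Rightarrow> real"
  assumes [measurable]: "case_prod Y \<in> borel_measurable (\<mu> \<Otimes>\<^sub>M M)" "case_prod Y' \<in> borel_measurable (\<mu> \<Otimes>\<^sub>M M)"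
    and "AE \<omega> in M. integrable \<mu> (\<lambda>x. Y x \<omega>)" "AE \<omega> in M. integrable \<mu> (\<lambda>x. Y' x \<omega>)"
  shows "dist1 (\<lambda>\<omega>. \<integral>x. Y x \<omega> \<partial>\<mu>) (\<lambda>\<omega>. \<integral>x. Y' x \<omega> \<partial>\<mu>) \<le> (\<integral>\<^sup>+x. dist1 (Y x) (Y' x) \<partial>\<mu>)"
proof -
  have "dist1 (\<lambda>\<omega>. \<integral>x. Y x \<omega> \<partial>\<mu>) (\<lambda>\<omega>. \<integral>x. Y' x \<omega> \<partial>\<mu>) \<le>
      (\<integral>\<^sup>+\<omega>. (\<integral>\<^sup>+x. ennreal \<bar>Y x \<omega> - Y' x \<omega>\<bar> \<partial>\<mu>) \<partial>M)"
    unfolding l1_dist_def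
  proof (rule nn_integral_mono_AE, use assms(3,4) in eventually_elim)
    case (elim \<omega>)
    then show ?case
      using integral_norm_bound_ennreal[OF Bochner_Integration.integrable_diff[OF elim]] by simp
  qed
  also have "\<dots> = (\<integral>\<^sup>+x. dist1 (Y x) (Y' x) \<partial>\<mu>)"
    unfolding l1_dist_def by (rule \<mu>M.Fubini') measurable
  finally show ?thesis .
qed

lemma fubini_add:
  assumes f: "fubini f" and g: "fubini g"
  shows "fubini (\<lambda>x s. f x s + g x s)"
proof -
  from f g have nf: "norm_integrable f" and ng: "norm_integrable g" by (auto simp: fubini_def)
  note n = norm_integrable_add[OF nf ng]
  note [measurable] = norm_integrable_integral(4)[OF n]
  obtain Y where Y: "joint_integral f Y" "modular_integral (\<lambda>s. \<integral>x. f x s \<partial>\<mu>) (\<lambda>\<omega>. \<integral>x. Y x \<omega> \<partial>\<mu>)"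
    using f by (auto simp: fubini_def)
  obtain Y' where Y': "joint_integral g Y'" "modular_integral (\<lambda>s. \<integral>x. g x s \<partial>\<mu>) (\<lambda>\<omega>. \<integral>x. Y' x \<omega> \<partial>\<mu>)"
    using g by (auto simp: fubini_def)
  note [measurable] = joint_integralD(1)[OF Y(1)] joint_integralD(1)[OF Y'(1)]
  have "joint_integral (\<lambda>x s. f x s + g x s) (\<lambda>x \<omega>. Y x \<omega> + Y' x \<omega>)"
    using modular_integral_add[OF joint_integralD(2)[OF Y(1)] joint_integralD(2)[OF Y'(1)]]
    by (simp add: joint_integral_def)
  moreover have "modular_integral (\<lambda>s. \<integral>x. f x s + g x s \<partial>\<mu>) (\<lambda>\<omega>. \<integral>x. Y x \<omega> + Y' x \<omega> \<partial>\<mu>)"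
  proof (rule modular_integral_cong_AE[OF modular_integral_add[OF Y(2) Y'(2)]])
    show "AE s in m. (\<integral>x. f x s \<partial>\<mu>) + (\<integral>x. g x s \<partial>\<mu>) = (\<integral>x. f x s + g x s \<partial>\<mu>)"
      using norm_integrable_integral(1)[OF nf] norm_integrable_integral(1)[OF ng] by eventually_elim simp
    show "AE \<omega> in M. (\<integral>x. Y x \<omega> \<partial>\<mu>) + (\<integral>x. Y' x \<omega> \<partial>\<mu>) = (\<integral>x. Y x \<omega> + Y' x \<omega> \<partial>\<mu>)"
      using joint_integral_integrable(1)[OF nf Y(1)] joint_integral_integrable(1)[OF ng Y'(1)] by eventually_elim simp
  qed measurable
  ultimately show ?thesis using n by (auto simp: fubini_def)
qed

lemma fubini_scale:
  assumes f: "fubini f" shows "fubini (\<lambda>x s. a * f x s)"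
proof -
  from f have nf: "norm_integrable f" by (auto simp: fubini_def)
  obtain Y where Y: "joint_integral f Y" "modular_integral (\<lambda>s. \<integral>x. f x s \<partial>\<mu>) (\<lambda>\<omega>. \<integral>x. Y x \<omega> \<partial>\<mu>)"
    using f by (auto simp: fubini_def)
  note [measurable] = joint_integralD(1)[OF Y(1)]
  have "joint_integral (\<lambda>x s. a * f x s) (\<lambda>x \<omega>. a * Y x \<omega>)"
    using modular_integral_scale[OF joint_integralD(2)[OF Y(1)]] by (simp add: joint_integral_def)
  moreover have "modular_integral (\<lambda>s. \<integral>x. a * f x s \<partial>\<mu>) (\<lambda>\<omega>. \<integral>x. a * Y x \<omega> \<partial>\<mu>)"
    using modular_integral_scale[OF Y(2)] by simp
  ultimately show ?thesis using norm_integrable_scale[OF nf] by (auto simp: fubini_def)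
qed

text \<open>The version of the limit process is jointly measurable because the subsequence along which
  the approximations converge at \<open>x\<close> is selected measurably in \<open>x\<close>, through the norms.\<close>

lemma joint_integral_limit:
  assumes Y: "\<And>n. joint_integral (f n) (Y n)" and f: "\<And>n. norm_integrable (f n)" and g: "norm_integrable g"
    and lim: "\<And>x. (\<lambda>n. nrm (\<lambda>s. f n x s - g x s)) \<longlonglongrightarrow> 0"
  shows "\<exists>Z. joint_integral g Z"
proof -
  note [measurable] = joint_integralD(1)[OF Y] norm_integrableD(1)[OF f] norm_integrableD(1)[OF g]
  define D where "D n x = nrm (\<lambda>s. f n x s - g x s)" for n x
  have [measurable]: "D n \<in> borel_measurable \<mu>" for n unfolding D_def by (rule nrm_measurable) measurable
  \<comment> \<open>The first index of accuracy \<open>2^-k\<close>. It takes countably many values,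
    which makes W jointly measurable, and the geometric accuracy makes the distances
    summable.\<close>
  define \<kappa> where "\<kappa> k x = (LEAST n. D n x < ennreal ((1 / 2) ^ k))" for k :: nat and x
  have \<kappa>_meas: "\<kappa> k \<in> measurable \<mu> (count_space UNIV)" for k unfolding \<kappa>_def by measurable
  have \<kappa>: "D (\<kappa> k x) x < ennreal ((1 / 2) ^ k)" for k x
  proof -
    have "\<exists>n. D n x < ennreal ((1 / 2) ^ k)"
      using eventually_happens'[OF sequentially_bot tendsto_zero_ennrealD[OF lim[of x], of "(1 / 2) ^ k"]]
      by (simp add: D_def)
    then show ?thesis unfolding \<kappa>_def by (rule LeastI_ex)
  qed
  define W where "W k x \<omega> = Y (\<kappa> k x) x \<omega>" for k x \<omega>
  have W_meas [measurable]: "case_prod (W k) \<in> borel_measurable (\<mu> \<Otimes>\<^sub>M M)" for k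
  proof -
    have "(\<lambda>p. case_prod (Y (\<kappa> k (fst p))) p) \<in> borel_measurable (\<mu> \<Otimes>\<^sub>M M)"
      by (rule measurable_compose_countable) (use measurable_compose[OF measurable_fst \<kappa>_meas] in measurable)
    then show ?thesis by (simp add: W_def case_prod_beta')
  qed
  define Z where "Z x \<omega> = lim (\<lambda>k. W k x \<omega>)" for x \<omega>
  have Z_meas [measurable]: "case_prod Z \<in> borel_measurable (\<mu> \<Otimes>\<^sub>M M)"
  proof -
    have "(\<lambda>p. lim (\<lambda>k. case_prod (W k) p)) \<in> borel_measurable (\<mu> \<Otimes>\<^sub>M M)" by measurable
    then show ?thesis by (simp add: Z_def case_prod_beta')
  qed
  have "modular_integral (g x) (Z x)" for x
  proof -
    \<comment> \<open>A version for this x alone, with no measurability in x; it merely identifies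
      the limit.\<close>
    obtain V where V: "modular_integral (g x) V"
      using modular_integral_exists[OF norm_integrableD(2,3)[OF g]] by blast
    note [measurable] = modular_integralD(3)[OF V] joint_integralD(3)[OF Y] norm_integrableD(2)[OF g]
    have W_x: "W k x = Y (\<kappa> k x) x" for k by (simp add: W_def fun_eq_iff)
    have "dist1 (W k x) V \<le> ennreal (584 * (1 / 2) ^ k)" for k
    proof -
      have "dist1 (\<lambda>\<omega>. W k x \<omega> - V \<omega>) (\<lambda>_. 0) \<le> 584 * D (\<kappa> k x) x"
        unfolding W_x D_def using \<kappa>[of k x]
        by (intro modular_integral_nrm_bound modular_integral_diff joint_integralD(2)[OF Y] V)
           (auto simp: D_def intro: less_trans)
      also have "\<dots> \<le> 584 * ennreal ((1 / 2) ^ k)" using \<kappa>[of k x] by (intro mult_left_mono) auto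
      also have "\<dots> = ennreal (584 * (1 / 2) ^ k)" using ennreal_mult[of 584 "(1 / 2) ^ k"] by simp
      finally show ?thesis by (simp add: l1_dist_def)
    qed
    then have "(\<Sum>k. dist1 (W k x) V) \<le> (\<Sum>k. ennreal (584 * (1 / 2) ^ k))"
      by (intro suminf_le summableI)
    also have "\<dots> < \<infinity>"
    proof -
      have "summable (\<lambda>k. 584 * (1 / 2 :: real) ^ k)" by (intro summable_mult summable_geometric) simp
      then have "(\<Sum>k. ennreal (584 * (1 / 2) ^ k)) \<noteq> top" by (rule ennreal_suminf_neq_top) simp
      then show ?thesis by (simp only: less_top infinity_ennreal_def)
    qed
    finally have "AE \<omega> in M. (\<lambda>k. W k x \<omega>) \<longlonglongrightarrow> V \<omega>"
      by (intro AE_tendsto_of_l1_summable) (simp_all add: W_x)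
    then have "AE \<omega> in M. V \<omega> = Z x \<omega>"
      by eventually_elim (simp add: Z_def limI)
    moreover have "Z x \<in> borel_measurable M"
      using measurable_Pair2[OF Z_meas, of x] by (simp add: space_\<mu>)
    ultimately show ?thesis by (intro modular_integral_cong_AE[OF V]) auto
  qed
  then have "joint_integral g Z" using Z_meas by (simp add: joint_integral_def)
  then show ?thesis by blast
qed

text \<open>Domination makes the norms of \<open>f n x - g x\<close> tend to 0 for each x, and also
  their integral over x. The mean bound controls the left iterated integral, Minkowski's inequality
  the integrand on the right; closedness of the relation concludes.\<close>

lemma fubini_limit:
  assumes F: "norm_integrable F" and f: "\<And>n. fubini (f n)"
    and g [measurable]: "case_prod g \<in> borel_measurable (\<mu> \<Otimes>\<^sub>M m)"
    and dom: "\<And>n x s. s \<in> \<Omega> \<Longrightarrow> \<bar>f n x s\<bar> \<le> \<bar>F x s\<bar>"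
    and lim: "\<And>x s. s \<in> \<Omega> \<Longrightarrow> (\<lambda>n. f n x s) \<longlonglongrightarrow> g x s"
  shows "fubini g"
proof -
  have nf: "norm_integrable (f n)" for n using f by (auto simp: fubini_def)
  have dom_g: "\<bar>g x s\<bar> \<le> \<bar>F x s\<bar>" if "s \<in> \<Omega>" for x s
    using dom[OF that, of _ x] by (intro LIMSEQ_le_const2[OF tendsto_rabs[OF lim[OF that, of x]]]) auto
  have ng: "norm_integrable g" by (rule norm_integrable_mono[OF F g dom_g])
  note n2F = norm_integrable_scale[OF F, of 2]
  obtain Y where Y: "\<And>n. joint_integral (f n) (Y n)"
    "\<And>n. modular_integral (\<lambda>s. \<integral>x. f n x s \<partial>\<mu>) (\<lambda>\<omega>. \<integral>x. Y n x \<omega> \<partial>\<mu>)"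
    using f unfolding fubini_def by metis
  note [measurable] = joint_integralD(1)[OF Y(1)] norm_integrableD(1,2)[OF nf] norm_integrableD(1,2,6)[OF n2F]
    norm_integrableD(2)[OF ng]
  define D where "D n x = nrm (\<lambda>s. f n x s - g x s)" for n x
  have D_meas [measurable]: "D n \<in> borel_measurable \<mu>" for n unfolding D_def by (rule nrm_measurable) measurable
  have dom2: "\<bar>f n x s - g x s\<bar> \<le> \<bar>2 * F x s\<bar>" if "s \<in> \<Omega>" for n x s
    using dom[OF that, of n x] dom_g[OF that, of x] by linarith
  have n_diff: "norm_integrable (\<lambda>x s. f n x s - g x s)" for n
    by (rule norm_integrable_mono[OF n2F _ dom2]) measurable
  have D_lim: "(\<lambda>n. D n x) \<longlonglongrightarrow> 0" for x
    unfolding D_def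
  proof (rule nrm_tendsto_zero)
    show "(\<lambda>n. modular (\<lambda>s. f n x s - g x s)) \<longlonglongrightarrow> 0"
    proof (rule modular_dominated_convergence[where G="\<lambda>s. 2 * F x s"])
      show "modular (\<lambda>s. 2 * F x s) < \<infinity>" by (rule norm_integrableD(3)[OF n2F])
      show "AE s in m. (\<lambda>n. f n x s - g x s) \<longlonglongrightarrow> 0"
        by (rule AE_I2) (simp add: LIM_zero lim space_m)
    qed (use dom2 in measurable)
  qed measurable
  have "(\<lambda>n. \<integral>\<^sup>+x. D n x \<partial>\<mu>) \<longlonglongrightarrow> (\<integral>\<^sup>+x. 0 \<partial>\<mu>)"
  proof (rule nn_integral_dominated_convergence[where w="\<lambda>x. nrm (\<lambda>s. 2 * F x s)"])
    show "AE x in \<mu>. D n x \<le> nrm (\<lambda>s. 2 * F x s)" for n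
      unfolding D_def by (intro AE_I2 nrm_mono dom2)
    show "(\<integral>\<^sup>+x. nrm (\<lambda>s. 2 * F x s) \<partial>\<mu>) < \<infinity>" by (rule norm_integrableD(4)[OF n2F])
  qed (auto simp: D_lim)
  then have D_int_lim: "(\<lambda>n. \<integral>\<^sup>+x. D n x \<partial>\<mu>) \<longlonglongrightarrow> 0" by simp
  obtain Z where Z: "joint_integral g Z"
    using joint_integral_limit[where f=f and Y=Y, OF Y(1) nf ng D_lim[unfolded D_def]] by blast
  note [measurable] = joint_integralD(1)[OF Z]
  have Y_Z: "dist1 (Y n x) (Z x) \<le> 584 * D n x" for n x
  proof -
    have "dist1 (\<lambda>\<omega>. Y n x \<omega> - Z x \<omega>) (\<lambda>_. 0) \<le> 584 * D n x"
      unfolding D_def using norm_integrableD(5)[OF n_diff]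
      by (intro modular_integral_nrm_bound modular_integral_diff joint_integralD(2)[OF Y(1)] joint_integralD(2)[OF Z])
    then show ?thesis by (simp add: l1_dist_def)
  qed
  note [measurable] = norm_integrable_integral(4)[OF nf] norm_integrable_integral(4)[OF ng]
  have "modular_integral (\<lambda>s. \<integral>x. g x s \<partial>\<mu>) (\<lambda>\<omega>. \<integral>x. Z x \<omega> \<partial>\<mu>)"
  proof (rule modular_integral_closed)
    show "integrable M (\<lambda>\<omega>. \<integral>x. Z x \<omega> \<partial>\<mu>)"
      by (rule joint_integral_integrable(2)[OF ng Z])
    fix e :: real assume "0 < e"
    \<comment> \<open>\<open>584 r < e\<close> serves the distance in the mean; r \<le> 1 and r < e
      serve the modular.\<close>
    define r where "r = min 1 (e / 585)"
    have r: "0 < r" "r \<le> 1" "584 * r < e" using \<open>0 < e\<close> by (auto simp: r_def min_def field_simps)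
    obtain n where n: "(\<integral>\<^sup>+x. D n x \<partial>\<mu>) < ennreal r"
      using eventually_happens'[OF sequentially_bot tendsto_zero_ennrealD[OF D_int_lim r(1)]] by blast
    have "modular (\<lambda>s. (\<integral>x. f n x s \<partial>\<mu>) - (\<integral>x. g x s \<partial>\<mu>)) = modular (\<lambda>s. \<integral>x. f n x s - g x s \<partial>\<mu>)"
    proof (rule modular_cong_AE)
      show "AE s in m. (\<integral>x. f n x s \<partial>\<mu>) - (\<integral>x. g x s \<partial>\<mu>) = (\<integral>x. f n x s - g x s \<partial>\<mu>)"
        using norm_integrable_integral(1)[OF nf[of n]] norm_integrable_integral(1)[OF ng] by eventually_elim simp
    qed
    also have "\<dots> \<le> ennreal r"
    proof (rule modular_less_of_nrm_less[OF norm_integrable_integral(4)[OF n_diff] r(1,2)])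
      show "nrm (\<lambda>s. \<integral>x. f n x s - g x s \<partial>\<mu>) < ennreal r"
        using norm_integrable_integral(2)[OF n_diff[of n]] n unfolding D_def by (rule le_less_trans)
    qed
    also have "\<dots> < ennreal e" using r by (simp add: ennreal_less_iff)
    finally have 1: "modular (\<lambda>s. (\<integral>x. f n x s \<partial>\<mu>) - (\<integral>x. g x s \<partial>\<mu>)) < ennreal e" .
    have "dist1 (\<lambda>\<omega>. \<integral>x. Y n x \<omega> \<partial>\<mu>) (\<lambda>\<omega>. \<integral>x. Z x \<omega> \<partial>\<mu>) \<le> (\<integral>\<^sup>+x. dist1 (Y n x) (Z x) \<partial>\<mu>)"
      by (rule l1_dist_integral_le[OF _ _ joint_integral_integrable(1)[OF nf Y(1)] joint_integral_integrable(1)[OF ng Z]]) measurable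
    also have "\<dots> \<le> (\<integral>\<^sup>+x. 584 * D n x \<partial>\<mu>)" by (intro nn_integral_mono Y_Z)
    also have "\<dots> = 584 * (\<integral>\<^sup>+x. D n x \<partial>\<mu>)" by (rule nn_integral_cmult) measurable
    also have "\<dots> \<le> 584 * ennreal r" using n by (intro mult_left_mono) auto
    also have "\<dots> = ennreal (584 * r)" using ennreal_mult[of 584 r] r by simp
    also have "\<dots> < ennreal e" using r by (simp add: ennreal_less_iff)
    finally have 2: "dist1 (\<lambda>\<omega>. \<integral>x. Y n x \<omega> \<partial>\<mu>) (\<lambda>\<omega>. \<integral>x. Z x \<omega> \<partial>\<mu>) < ennreal e" .
    show "\<exists>g' Y'. modular_integral g' Y' \<and> modular (\<lambda>s. g' s - (\<integral>x. g x s \<partial>\<mu>)) < ennreal e \<and>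
        dist1 Y' (\<lambda>\<omega>. \<integral>x. Z x \<omega> \<partial>\<mu>) < ennreal e"
      using Y(2)[of n] 1 2 by (intro exI[of _ "\<lambda>s. \<integral>x. f n x s \<partial>\<mu>"] exI[of _ "\<lambda>\<omega>. \<integral>x. Y n x \<omega> \<partial>\<mu>"]) auto
  qed measurable
  then show ?thesis using ng Z by (auto simp: fubini_def)
qed

section \<open>From rectangles to all norm-integrable functions\<close>

lemma fubini_rectangle:
  assumes B [measurable]: "B \<in> sets \<mu>" "emeasure \<mu> B < \<infinity>" and A: "A \<in> R"
  shows "fubini (\<lambda>x s. indicator B x * indicator A s)"
proof -
  have [measurable]: "A \<in> sets m" using A by (rule R_sub_sets)
  have h: "snd ` set [(1, A)] \<subseteq> R" using A by simp
  have fun_A: "simple_fun [(1, A)] = (indicator A :: _ \<Rightarrow> real)" by (auto simp: fun_eq_iff)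
  have int_A: "sint [(1, A)] \<Omega> = \<Lambda> A"
    using A by (auto simp: fun_eq_iff R.Int_space_eq2)
  have J: "modular_integral (indicator A) (\<Lambda> A)"
    using modular_integral_simple[OF h] unfolding fun_A int_A .
  have mod: "modular (indicator A) < \<infinity>"
    using modular_simple_fun_finite[OF h] unfolding fun_A .
  have nrm_A: "nrm (indicator A) < \<infinity>" using mod by (intro nrm_finite) auto
  have [measurable]: "\<Lambda> A \<in> borel_measurable M" using A by (rule random_variable)
  have "(\<integral>\<^sup>+x. nrm (\<lambda>s. indicator B x * indicator A s) \<partial>\<mu>) = (\<integral>\<^sup>+x. nrm (indicator A) * indicator B x \<partial>\<mu>)"
    by (intro nn_integral_cong) (simp split: split_indicator)
  also have "\<dots> < \<infinity>" using B nrm_A by (simp add: nn_integral_cmult_indicator ennreal_mult_less_top)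
  moreover have "modular (\<lambda>s. indicator B x * indicator A s) < \<infinity>" for x
    using mod by (intro modular_scale_finite) auto
  ultimately have "norm_integrable (\<lambda>x s. indicator B x * indicator A s)"
    by (auto simp: norm_integrable_def)
  moreover have "joint_integral (\<lambda>x s. indicator B x * indicator A s) (\<lambda>x \<omega>. indicator B x * \<Lambda> A \<omega>)"
    using modular_integral_scale[OF J] by (auto simp: joint_integral_def)
  moreover have "modular_integral (\<lambda>s. \<integral>x. indicator B x * indicator A s \<partial>\<mu>) (\<lambda>\<omega>. \<integral>x. indicator B x * \<Lambda> A \<omega> \<partial>\<mu>)"
    using modular_integral_scale[OF J, of "measure \<mu> B"] B space_\<mu> by simp
  ultimately show ?thesis by (auto simp: fubini_def)
qed

lemma fubini_sum:
  assumes "finite I" "\<And>i. i \<in> I \<Longrightarrow> fubini (f i)" and 0: "fubini (\<lambda>x s. 0)"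
  shows "fubini (\<lambda>x s. \<Sum>i\<in>I. f i x s)"
  using assms(1,2)
proof (induction I)
  case empty
  then show ?case using 0 by simp
next
  case (insert i I)
  then show ?case using fubini_add[of "f i" "\<lambda>x s. \<Sum>i\<in>I. f i x s"] by simp
qed

lemma fubini_zero: "fubini (\<lambda>x s. 0)"
  using fubini_rectangle[of "{}" "{}"] by simp

text \<open>A Dynkin argument inside a fixed box. The box makes complements accessible by linearity
  and dominates the increasing unions.\<close>

lemma fubini_indicator:
  assumes B: "B \<in> sets \<mu>" "emeasure \<mu> B < \<infinity>" and A: "A \<in> R" and D: "D \<in> sets (\<mu> \<Otimes>\<^sub>M m)"
  shows "fubini (\<lambda>x s. indicator D (x, s) * (indicator B x * indicator A s))"
proof -
  note box = fubini_rectangle[OF B A]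
  then have n_box: "norm_integrable (\<lambda>x s. indicator B x * indicator A s)" by (auto simp: fubini_def)
  have A_sub: "A \<subseteq> \<Omega>" using A R.space_closed by auto
  have [measurable]: "A \<in> sets m" "B \<in> sets \<mu>" using A B R_sub_sets by auto
  have "D \<in> sigma_sets (space \<mu> \<times> space m) {a \<times> b | a b. a \<in> sets \<mu> \<and> b \<in> sets m}"
    using D by (simp add: sets_pair_measure)
  with Int_stable_pair_measure_generator pair_measure_closed show ?thesis
  proof (induction D rule: sigma_sets_induct_disjoint)
    case (basic D)
    then obtain b a where D: "D = b \<times> a" "b \<in> sets \<mu>" "a \<in> sets m" by auto
    have "emeasure \<mu> (b \<inter> B) \<le> emeasure \<mu> B" using D(2) by (intro emeasure_mono) auto
    then have "fubini (\<lambda>x s. indicator (b \<inter> B) x * indicator (a \<inter> A) s)"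
      using D(2) B(2) R_trace[OF D(3) A] by (intro fubini_rectangle) auto
    moreover have "indicator D (x, s) * (indicator B x * indicator A s) = (indicator (b \<inter> B) x * indicator (a \<inter> A) s :: real)" for x s
      by (auto simp: D(1) indicator_def)
    ultimately show ?case by simp
  next
    case empty
    then show ?case using fubini_zero by simp
  next
    case (compl D)
    have "fubini (\<lambda>x s. indicator B x * indicator A s + (- 1) * (indicator D (x, s) * (indicator B x * indicator A s)))"
      by (intro fubini_add fubini_scale box compl.IH)
    moreover have "indicator B x * indicator A s + (- 1) * (indicator D (x, s) * (indicator B x * indicator A s)) =
        (indicator (space \<mu> \<times> space m - D) (x, s) * (indicator B x * indicator A s) :: real)" for x s
      using A_sub by (auto simp: indicator_def space_\<mu> space_m)
    ultimately show ?case by simp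
  next
    case (union D)
    have D_sets [measurable]: "D i \<in> sets (\<mu> \<Otimes>\<^sub>M m)" for i
      using union.hyps by (auto simp: sets_pair_measure)
    have D_disj: "disjoint_family D" using union by blast
    show ?case
    proof (rule fubini_limit[OF n_box])
      have "fubini (\<lambda>x s. \<Sum>i<n. indicator (D i) (x, s) * (indicator B x * indicator A s))" for n
        by (intro fubini_sum fubini_zero union.IH) auto
      moreover have "(\<Sum>i<n. indicator (D i) (x, s) * (indicator B x * indicator A s)) =
          (indicator (\<Union>i<n. D i) (x, s) * (indicator B x * indicator A s) :: real)" for n x s
        using disjoint_family_on_mono[OF subset_UNIV D_disj]
        by (subst indicator_UN_disjoint) (auto simp: sum_distrib_right)
      ultimately show "fubini (\<lambda>x s. indicator (\<Union>i<n. D i) (x, s) * (indicator B x * indicator A s))" for n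
        by simp
      show "(\<lambda>n. indicator (\<Union>i<n. D i) (x, s) * (indicator B x * indicator A s)) \<longlonglongrightarrow>
          (indicator (\<Union>i. D i) (x, s) * (indicator B x * indicator A s) :: real)" for x s
        by (intro tendsto_mult_right LIMSEQ_indicator_UN)
      show "\<bar>indicator (\<Union>i<n. D i) (x, s) * (indicator B x * indicator A s)\<bar> \<le> \<bar>indicator B x * indicator A s :: real\<bar>" for n x s
        by (auto simp: indicator_def)
      show "(\<lambda>(x, s). indicator (\<Union>i. D i) (x, s) * (indicator B x * indicator A s) :: real) \<in> borel_measurable (\<mu> \<Otimes>\<^sub>M m)"
        unfolding case_prod_beta' prod.collapse by measurable
    qed
  qed
qed

text \<open>Simple functions on the product with modulus at most \<open>2 |f|\<close>, cut off to
  boxes that exhaust the space, reduce the claim to indicators and dominated limits.\<close>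

lemma fubini_norm_integrable:
  assumes nf: "norm_integrable f" shows "fubini f"
proof -
  note f [measurable] = norm_integrableD(1)[OF nf]
  obtain E :: "nat \<Rightarrow> 's set" where E: "\<And>n. E n \<in> R" "incseq E" "(\<Union>n. E n) = \<Omega>"
    by (rule R_exhaustion) (rule that)
  obtain B :: "nat \<Rightarrow> 't set" where B: "range B \<subseteq> sets \<mu>" "(\<Union>i. B i) = space \<mu>" "\<And>i. emeasure \<mu> (B i) \<noteq> \<infinity>" "incseq B"
    using \<mu>.sigma_finite_incseq by metis
  from borel_measurable_implies_sequence_metric[OF f, of 0] obtain U where
    U: "\<And>i. simple_function (\<mu> \<Otimes>\<^sub>M m) (U i)"
      "\<And>z. z \<in> space (\<mu> \<Otimes>\<^sub>M m) \<Longrightarrow> (\<lambda>i. U i z) \<longlonglongrightarrow> case_prod f z"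
      "\<And>i z. z \<in> space (\<mu> \<Otimes>\<^sub>M m) \<Longrightarrow> \<bar>U i z\<bar> \<le> 2 * \<bar>case_prod f z\<bar>"
    by simp metis
  have in_space: "(x, s) \<in> space (\<mu> \<Otimes>\<^sub>M m) \<longleftrightarrow> s \<in> \<Omega>" for x s
    by (simp add: space_pair_measure space_\<mu> space_m)
  define g where "g i x s = U i (x, s) * (indicator (B i) x * indicator (E i) s)" for i x s
  show ?thesis
  proof (rule fubini_limit[OF norm_integrable_scale[OF nf, of 2] _ f])
    show "fubini (g i)" for i
    proof -
      have fin: "finite (U i ` space (\<mu> \<Otimes>\<^sub>M m))" using U(1) by (rule simple_functionD)
      have D: "U i -` {y} \<inter> space (\<mu> \<Otimes>\<^sub>M m) \<in> sets (\<mu> \<Otimes>\<^sub>M m)" for y using U(1) by (rule simple_functionD)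
      have "fubini (\<lambda>x s. \<Sum>y\<in>U i ` space (\<mu> \<Otimes>\<^sub>M m). y * (indicator (U i -` {y} \<inter> space (\<mu> \<Otimes>\<^sub>M m)) (x, s) *
          (indicator (B i) x * indicator (E i) s)))"
        using B E(1) by (intro fubini_sum fubini_zero fubini_scale fubini_indicator fin D) (auto simp: less_top)
      moreover have "(\<Sum>y\<in>U i ` space (\<mu> \<Otimes>\<^sub>M m). y * (indicator (U i -` {y} \<inter> space (\<mu> \<Otimes>\<^sub>M m)) (x, s) *
          (indicator (B i) x * indicator (E i) s))) = g i x s" for x s
      proof (cases "s \<in> \<Omega>")
        case True
        then have z: "(x, s) \<in> space (\<mu> \<Otimes>\<^sub>M m)" by (simp add: in_space)
        have "(\<Sum>y\<in>U i ` space (\<mu> \<Otimes>\<^sub>M m). y * (indicator (U i -` {y} \<inter> space (\<mu> \<Otimes>\<^sub>M m)) (x, s) *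
            (indicator (B i) x * indicator (E i) s))) = (\<Sum>y\<in>U i ` space (\<mu> \<Otimes>\<^sub>M m). if y = U i (x, s) then g i x s else 0)"
          using z by (intro sum.cong refl) (auto simp: g_def indicator_def)
        also have "\<dots> = g i x s" using fin z by simp
        finally show ?thesis .
      next
        case False
        then have "s \<notin> E i" using E(1)[of i] R.space_closed by auto
        then show ?thesis by (simp add: g_def)
      qed
      ultimately show ?thesis by simp
    qed
    fix x s assume s: "s \<in> \<Omega>"
    then have z: "(x, s) \<in> space (\<mu> \<Otimes>\<^sub>M m)" by (simp add: in_space)
    show "\<bar>g i x s\<bar> \<le> \<bar>2 * f x s\<bar>" for i
      using U(3)[OF z, of i] by (auto simp: g_def indicator_def)
    obtain k where k: "s \<in> E k" using s E(3) by auto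
    obtain l where l: "x \<in> B l" using B(2) space_\<mu> by auto
    have "U n (x, s) = g n x s" if "max k l \<le> n" for n
    proof -
      have "s \<in> E n" "x \<in> B n"
        using that k l incseqD[OF E(2), of k n] incseqD[OF B(4), of l n] by auto
      then show ?thesis by (simp add: g_def)
    qed
    then have "\<forall>\<^sub>F n in sequentially. U n (x, s) = g n x s"
      unfolding eventually_sequentially by blast
    moreover have "(\<lambda>n. U n (x, s)) \<longlonglongrightarrow> f x s" using U(2)[OF z] by simp
    ultimately show "(\<lambda>n. g n x s) \<longlonglongrightarrow> f x s" by (rule Lim_transform_eventually[rotated])
  qed
qed

end

theorem theorem3p1:
  fixes M :: "'w measure" and \<Omega> :: "'s set" and R :: "'s set set"
    and \<Lambda> :: "'s set \<Rightarrow> 'w \<Rightarrow> real"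
    and m :: "'s measure" and \<sigma>2 :: "'s \<Rightarrow> real" and \<nu> :: "'s \<Rightarrow> real measure"
    and \<mu> :: "'t::polish_space measure" and f :: "'t \<Rightarrow> 's \<Rightarrow> real"
  assumes "\<Omega> \<noteq> {}"
    and "centered_levy_characteristics M \<Omega> R \<Lambda> m \<sigma>2 \<nu>"
    and "sets \<mu> = sets borel" and "sigma_finite_measure \<mu>"
    and "(\<lambda>(x, s). f x s) \<in> borel_measurable (borel \<Otimes>\<^sub>M sigma \<Omega> R)"
    and "\<And>x. f x \<in> L_phi m \<sigma>2 \<nu>"
    and "(\<integral>\<^sup>+x. luxemburg_norm m \<sigma>2 \<nu> (f x) \<partial>\<mu>) < \<infinity>"
  shows "(AE s in m. integrable \<mu> (\<lambda>x. f x s)) \<and>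
    (\<lambda>s. \<integral>x. f x s \<partial>\<mu>) \<in> L_phi m \<sigma>2 \<nu> \<and>
    (\<forall>x. levy_integrable M R \<Lambda> m (f x)) \<and>
    levy_integrable M R \<Lambda> m (\<lambda>s. \<integral>x. f x s \<partial>\<mu>) \<and>
    (\<exists>Y. measurable_levy_integral M R \<Lambda> m f Y) \<and>
    (\<forall>Y. measurable_levy_integral M R \<Lambda> m f Y \<longrightarrow>
      (AE \<omega> in M. integrable \<mu> (\<lambda>x. Y x \<omega>)) \<and>
      (\<forall>Z. has_levy_integral M R \<Lambda> m (\<lambda>s. \<integral>x. f x s \<partial>\<mu>) Z \<longrightarrow>
        (AE \<omega> in M. (\<integral>x. Y x \<omega> \<partial>\<mu>) = Z \<omega>)))"
proof -
  have space_\<mu>: "space \<mu> = UNIV" using sets_eq_imp_space_eq[OF assms(3)] by simp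
  interpret centered_levy_characteristics M \<Omega> R \<Lambda> m \<sigma>2 \<nu> by fact
  interpret levy_fubini M \<Omega> R \<Lambda> m \<sigma>2 \<nu> \<mu>
    by (rule levy_fubini.intro[OF assms(2) levy_fubini_axioms.intro[OF space_\<mu> assms(4)]])
  \<comment> \<open>The statement measures f by the generated sigma-algebra, the development by
    m.\<close>
  have "sets (sigma \<Omega> R) = sets m"
    using R.space_closed by (simp add: sets_m)
  then have "measurable (borel \<Otimes>\<^sub>M sigma \<Omega> R) borel = measurable (\<mu> \<Otimes>\<^sub>M m) (borel :: real measure)"
    using assms(3) by (intro measurable_cong_sets sets_pair_measure_cong) auto
  then have "case_prod f \<in> borel_measurable (\<mu> \<Otimes>\<^sub>M m)" using assms(5) by simp
  then have nf: "norm_integrable f"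
    using assms(6,7) by (auto simp: norm_integrable_def L_phi_iff)
  have joint_sets: "measurable (borel \<Otimes>\<^sub>M M) borel = measurable (\<mu> \<Otimes>\<^sub>M M) (borel :: real measure)"
    using assms(3) by (intro measurable_cong_sets sets_pair_measure_cong) auto
  obtain Y0 where Y0: "joint_integral f Y0"
    "modular_integral (\<lambda>s. \<integral>x. f x s \<partial>\<mu>) (\<lambda>\<omega>. \<integral>x. Y0 x \<omega> \<partial>\<mu>)"
    using fubini_norm_integrable[OF nf] by (auto simp: fubini_def)
  have Y0_x: "has_levy_integral M R \<Lambda> m (f x) (Y0 x)" for x
    by (rule modular_integral_imp_has_levy_integral[OF joint_integralD(2)[OF Y0(1)]])
  note Z0 = modular_integral_imp_has_levy_integral[OF Y0(2)]
  have "measurable_levy_integral M R \<Lambda> m f Y0"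
    using Y0_x joint_integralD(1)[OF Y0(1)] joint_sets by (simp add: measurable_levy_integral_def)
  moreover have "(AE \<omega> in M. integrable \<mu> (\<lambda>x. Y x \<omega>)) \<and>
      (\<forall>Z. has_levy_integral M R \<Lambda> m (\<lambda>s. \<integral>x. f x s \<partial>\<mu>) Z \<longrightarrow>
        (AE \<omega> in M. (\<integral>x. Y x \<omega> \<partial>\<mu>) = Z \<omega>))"
    if Y: "measurable_levy_integral M R \<Lambda> m f Y" for Y
  proof -
    have Y_meas [measurable]: "case_prod Y \<in> borel_measurable (\<mu> \<Otimes>\<^sub>M M)"
      using Y joint_sets by (simp add: measurable_levy_integral_def)
    note [measurable] = joint_integralD(1)[OF Y0(1)]
    \<comment> \<open>An arbitrary version Y carries no bound in the mean; its integrability in x is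
      inherited from Y0 through uniqueness.\<close>
    have "AE \<omega> in M. Y0 x \<omega> = Y x \<omega>" for x
      using Y Y0_x by (intro has_levy_integral_unique[of "f x"]) (auto simp: measurable_levy_integral_def)
    then have "AE \<omega> in M. AE x in \<mu>. Y0 x \<omega> = Y x \<omega>"
      by (intro AE_eq_of_l1_dist_integral_zero) measurable
    then have eq: "AE \<omega> in M. integrable \<mu> (\<lambda>x. Y x \<omega>) \<and> (\<integral>x. Y0 x \<omega> \<partial>\<mu>) = (\<integral>x. Y x \<omega> \<partial>\<mu>)"
      using joint_integral_integrable(1)[OF nf Y0(1)] AE_space
    proof eventually_elim
      case (elim \<omega>)
      have [measurable]: "(\<lambda>x. Y x \<omega>) \<in> borel_measurable \<mu>" "(\<lambda>x. Y0 x \<omega>) \<in> borel_measurable \<mu>"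
        using elim(3) by measurable
      show ?case
        using integrable_cong_AE_imp[OF elim(2) _ elim(1)] elim(1) by (auto intro!: integral_cong_AE)
    qed
    have "AE \<omega> in M. (\<integral>x. Y x \<omega> \<partial>\<mu>) = Z \<omega>" if "has_levy_integral M R \<Lambda> m (\<lambda>s. \<integral>x. f x s \<partial>\<mu>) Z" for Z
      using has_levy_integral_unique[OF Z0 that] eq by eventually_elim simp
    then show ?thesis using eq by auto
  qed
  ultimately show ?thesis
    using norm_integrable_integral[OF nf] Y0_x Z0
    by (auto simp: L_phi_iff levy_integrable_def)
qed

end
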